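(* Let $p>3$ be a prime and let $G_p$ be the finite $p$-group defined below. Let $D_p$ be the number of isomorphism classes of immediate descendants of $G_p$ which have order $p^{10}$ and exponent $p$. Let $V_p$ be the number of pairs $(x,y)\in\mathbb{F}_p^2$ satisfying both $x^4+6x^2-3=0$ and $y^2=x^3-x$. Then: (1) if $p\equiv 5 \pmod{12}$ then $D_p=(p+1)^2/4+3$; (2) if $p\equiv 7 \pmod{12}$ then $D_p=(p+1)^2/2+2$; (3) if $p\equiv 11 \pmod{12}$ then $D_p=(p+1)^2/6+(p+1)/3+2$; (4) if $p\equiv 1 \pmod{12}$ and $V_p=0$ then $D_p=(p+1)^2/4+3$; (5) if $p\equiv 1 \pmod{12}$ and $V_p\neq 0$ then $D_p=(p-1)^2/36+(p-1)/3+4$.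
   Context: For a prime $p$, $G_p$ is the group of exponent $p$ and order $p^9$, nilpotent of class $2$, generated by $x_1,\dots,x_6,y_1,y_2,y_3$ subject to the commutator relations $[x_1,x_4]=y_3$, $[x_1,x_5]=y_1$, $[x_1,x_6]=y_2$, $[x_2,x_4]=y_1$, $[x_2,x_5]=y_3$, $[x_3,x_4]=y_2$, $[x_3,x_6]=y_1$, with all other commutators of pairs of generators equal to $1$ (so $y_1,y_2,y_3$ are central). An immediate descendant of $G_p$ is a finite $p$-group $K$ of nilpotency class exactly $3$ such that $K/\gamma_3(K)\cong G_p$, where $\gamma_3(K)$ is the third term of the lower central series of $K$. *)

theory Defs
  imports "HOL-Algebra.Algebra"
begin

text \<open>Elements are pairs (a, c) where a i (i = 1..6) is the exponent of x_i and
  c k (k = 1..3) the exponent of y_k, all in {0..p-1}. Multiplication uses the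
  bilinear cocycle beta, so that the commutator x^-1 y^-1 x y of the
  generators gives exactly the listed relations.\<close>

definition gp_beta :: "(nat \<Rightarrow> int) \<Rightarrow> (nat \<Rightarrow> int) \<Rightarrow> nat \<Rightarrow> int" where
  "gp_beta a b k =
     (if k = 1 then a 1 * b 5 + a 2 * b 4 + a 3 * b 6
      else if k = 2 then a 1 * b 6 + a 3 * b 4
      else if k = 3 then a 1 * b 4 + a 2 * b 5
      else 0)"

definition Gp :: "nat \<Rightarrow> ((nat \<Rightarrow> int) \<times> (nat \<Rightarrow> int)) monoid" where
  "Gp p = \<lparr> carrier = {(a, c). (\<forall>i. a i \<in> {0..<int p} \<and> (i \<notin> {1..6} \<longrightarrow> a i = 0)) \<and>
                                (\<forall>k. c k \<in> {0..<int p} \<and> (k \<notin> {1..3} \<longrightarrow> c k = 0))},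
            monoid.mult = (\<lambda>(a, c) (b, d). (\<lambda>i. (a i + b i) mod int p,
                                     \<lambda>k. (c k + d k + gp_beta a b k) mod int p)),
            monoid.one = (\<lambda>_. 0, \<lambda>_. 0) \<rparr>"

definition commutator_subgroup :: "('a, 'b) monoid_scheme \<Rightarrow> 'a set \<Rightarrow> 'a set \<Rightarrow> 'a set" where
  "commutator_subgroup G H K =
     generate G {inv\<^bsub>G\<^esub> x \<otimes>\<^bsub>G\<^esub> inv\<^bsub>G\<^esub> y \<otimes>\<^bsub>G\<^esub> x \<otimes>\<^bsub>G\<^esub> y | x y. x \<in> H \<and> y \<in> K}"

fun lower_central :: "('a, 'b) monoid_scheme \<Rightarrow> nat \<Rightarrow> 'a set" where
  "lower_central G 0 = carrier G"
| "lower_central G (Suc 0) = carrier G"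
| "lower_central G (Suc (Suc n)) = commutator_subgroup G (lower_central G (Suc n)) (carrier G)"

definition nilpotent_class_exactly :: "('a, 'b) monoid_scheme \<Rightarrow> nat \<Rightarrow> bool" where
  "nilpotent_class_exactly G c \<longleftrightarrow>
     lower_central G (Suc c) = {\<one>\<^bsub>G\<^esub>} \<and> lower_central G c \<noteq> {\<one>\<^bsub>G\<^esub>}"

definition has_exponent :: "('a, 'b) monoid_scheme \<Rightarrow> nat \<Rightarrow> bool" where
  "has_exponent G e \<longleftrightarrow> e = (LEAST n::nat. n > 0 \<and> (\<forall>x \<in> carrier G. x [^]\<^bsub>G\<^esub> n = \<one>\<^bsub>G\<^esub>))
                         \<and> (\<exists>n::nat > 0. \<forall>x \<in> carrier G. x [^]\<^bsub>G\<^esub> n = \<one>\<^bsub>G\<^esub>)"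

definition immediate_descendant_Gp :: "nat \<Rightarrow> ('a, 'b) monoid_scheme \<Rightarrow> bool" where
  "immediate_descendant_Gp p K \<longleftrightarrow>
     group K \<and> finite (carrier K) \<and> (\<exists>n. order K = p ^ n) \<and>
     nilpotent_class_exactly K 3 \<and>
     (K Mod (lower_central K 3)) \<cong> Gp p"

text \<open>Every finite group is isomorphic to one with carrier a set of naturals, so
  isomorphism classes can be counted among groups on nat.\<close>
definition Dp :: "nat \<Rightarrow> nat" where
  "Dp p = card ({K :: nat monoid. immediate_descendant_Gp p K \<and> order K = p ^ 10 \<and> has_exponent K p}
                // {(K, L). K \<cong> L})"

definition Vp :: "nat \<Rightarrow> nat" where
  "Vp p = card {(x, y). (x::int) \<in> {0..<int p} \<and> (y::int) \<in> {0..<int p} \<and>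
                  (x ^ 4 + 6 * x ^ 2 - 3) mod int p = 0 \<and> (y ^ 2 - (x ^ 3 - x)) mod int p = 0}"

end

theory Submission
  imports Defs "Berlekamp_Zassenhaus.Finite_Field" "HOL-Number_Theory.Quadratic_Reciprocity"
begin

text \<open>The commutator pairing of \<open>G\<^sub>p\<close> is the gradient of the symmetric trilinear form \<open>tri\<close> of a smooth
  plane cubic with complex multiplication by \<open>i\<close>. In an immediate descendant of order \<open>p\<^sup>1\<^sup>0\<close> and exponent
  \<open>p\<close> the Hall-Witt identity forces the triple commutators to be a multiple of this form on one of
  the two coordinate spaces, and after a change of generators the only remaining freedom is an alternating form on a
  three-dimensional space, that is, a vector \<open>v\<close>. Two vectors give isomorphic groups iff they lie in
  one orbit of the group of linear maps preserving the cubic up to a factor. Modulo scalars this is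
  the group of rational 3-torsion points of an elliptic curve extended by its rational automorphisms
  fixing the origin; it permutes the rational flexes, and Burnside's lemma counts its orbits.\<close>

section \<open>The trilinear form and its similarities\<close>

text \<open>Where the curve comes from: the matrix of \<open>phi a\<close> has determinant
  \<open>a1 a2\<^sup>2 - a1\<^sup>3 - a2 a3\<^sup>2\<close>, which is the Hessian of the cubic and,
  after a change of sign, the curve \<open>y\<^sup>2 = x\<^sup>3 - x\<close>. A cubic and its
  Hessian have the same flexes. Eliminating one coordinate between them leaves
  \<open>x\<^sup>4 + 6 x\<^sup>2 - 3\<close>, so in the residue class where \<open>V\<^sub>p\<close>
  matters it detects a rational flex other than the obvious one \<open>e3\<close>. What makes the
  classification rigid: an isomorphism acts on the two coordinate spaces by maps that are
  independent a priori. Self-adjoint maps for the trilinear form are scalars, and this ties the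
  second map to the first up to a factor. That factor can be tuned to match determinants, so the
  orbits concern vectors and not vectors up to a multiple. All nonzero scalars are similarities,
  hence the orbits are the zero vector and the orbits on the projective plane. Modulo scalars there
  are few kinds of elements: the identity, reflections, translations and elements of order four.
  Only their numbers of eigenvectors enter the count.\<close>

class prime_field = field + finite +
  assumes of_nat_onto: "\<exists>n. x = of_nat n"
    and two_neq_0 [simp]: "2 \<noteq> 0"
    and three_neq_0 [simp]: "3 \<noteq> 0"

section \<open>Vectors, the pairing and the forms\<close>

datatype 'k vec3 = Vec 'k 'k 'k

instantiation vec3 :: (ab_group_add) ab_group_add
begin

definition zero_vec3 :: "'a vec3" where
  "0 = Vec 0 0 0"

fun plus_vec3 :: "'a vec3 \<Rightarrow> 'a vec3 \<Rightarrow> 'a vec3" where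
  "Vec a b c + Vec a' b' c' = Vec (a + a') (b + b') (c + c')"

fun minus_vec3 :: "'a vec3 \<Rightarrow> 'a vec3 \<Rightarrow> 'a vec3" where
  "Vec a b c - Vec a' b' c' = Vec (a - a') (b - b') (c - c')"

fun uminus_vec3 :: "'a vec3 \<Rightarrow> 'a vec3" where
  "- Vec a b c = Vec (- a) (- b) (- c)"

instance
proof
  fix a b c :: "'a vec3"
  show "a + b + c = a + (b + c)" by (cases a; cases b; cases c) (simp add: add.assoc)
  show "a + b = b + a" by (cases a; cases b) (simp add: add.commute)
  show "0 + a = a" by (cases a) (simp add: zero_vec3_def)
  show "- a + a = 0" by (cases a) (simp add: zero_vec3_def)
  show "a - b = a + - b" by (cases a; cases b) simp
qed

end

lemma bij_Vec: "bij (\<lambda>(a, b, c). Vec a b c)"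
  by (rule bijI') (auto split: prod.splits, metis vec3.exhaust)

instance vec3 :: (finite) finite
proof
  have "finite (range (\<lambda>(a, b, c). Vec a b c :: 'a vec3))" by simp
  then show "finite (UNIV :: 'a vec3 set)" by (simp only: bij_is_surj[OF bij_Vec])
qed

lemma CARD_vec3: "CARD('a::finite vec3) = CARD('a) ^ 3"
  using bij_betw_same_card[OF bij_Vec[where 'a = 'a]] by (simp add: power3_eq_cube)

fun smul :: "'k::times \<Rightarrow> 'k vec3 \<Rightarrow> 'k vec3" where
  "smul c (Vec x y z) = Vec (c * x) (c * y) (c * z)"

fun dot :: "'k::comm_ring_1 vec3 \<Rightarrow> 'k vec3 \<Rightarrow> 'k" where
  "dot (Vec a1 a2 a3) (Vec b1 b2 b3) = a1 * b1 + a2 * b2 + a3 * b3"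

fun phi :: "'k::comm_ring_1 vec3 \<Rightarrow> 'k vec3 \<Rightarrow> 'k vec3" where
  "phi (Vec a1 a2 a3) (Vec b1 b2 b3) = Vec (a1 * b2 + a2 * b1 + a3 * b3) (a1 * b1 + a2 * b2) (a1 * b3 + a3 * b1)"

fun det3 :: "'k::comm_ring_1 vec3 \<Rightarrow> 'k vec3 \<Rightarrow> 'k vec3 \<Rightarrow> 'k" where
  "det3 (Vec a1 a2 a3) (Vec b1 b2 b3) (Vec c1 c2 c3) =
     a1 * (b2 * c3 - b3 * c2) - a2 * (b1 * c3 - b3 * c1) + a3 * (b1 * c2 - b2 * c1)"

text \<open>The polar form of \<open>3 x\<^sup>2 y + y\<^sup>3 + 3 x z\<^sup>2\<close>. In the chart
  \<open>x = 1\<close> the curve is a Weierstrass cubic with its origin at the flex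
  \<open>e3\<close>, where the tangent is \<open>x = 0\<close>.\<close>

definition tri :: "'k::comm_ring_1 vec3 \<Rightarrow> 'k vec3 \<Rightarrow> 'k vec3 \<Rightarrow> 'k" where
  "tri a b c = dot (phi a b) c"

abbreviation (input) e1 :: "'k::comm_ring_1 vec3" where "e1 \<equiv> (Vec 1 0 0)"
abbreviation (input) e2 :: "'k::comm_ring_1 vec3" where "e2 \<equiv> (Vec 0 1 0)"
abbreviation (input) e3 :: "'k::comm_ring_1 vec3" where "e3 \<equiv> (Vec 0 0 1)"

lemma phi_commute: "phi a b = phi b a"
  by (cases a; cases b) (simp add: algebra_simps)

lemma phi_add_left: "phi (a + a') b = phi a b + phi a' b"
  by (cases a; cases a'; cases b) (simp add: algebra_simps)

lemma phi_add_right: "phi b (a + a') = phi b a + phi b a'"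
  by (cases a; cases a'; cases b) (simp add: algebra_simps)

lemma phi_smul: "phi (smul c a) b = smul c (phi a b)" "phi a (smul c b) = smul c (phi a b)"
  by (cases a; cases b; simp add: algebra_simps)+

lemma phi_uminus: "phi (- a) b = - phi a b" "phi a (- b) = - phi a b"
  by (cases a; cases b; simp add: algebra_simps)+

lemma phi_0 [simp]: "phi 0 b = 0" "phi b 0 = 0"
  by (cases b; simp add: zero_vec3_def)+

lemma dot_commute: "dot a b = dot b a"
  by (cases a; cases b) (simp add: algebra_simps)

lemma dot_add_left: "dot (a + a') b = dot a b + dot a' b"
  by (cases a; cases a'; cases b) (simp add: algebra_simps)

lemma dot_add_right: "dot b (a + a') = dot b a + dot b a'"
  by (cases a; cases a'; cases b) (simp add: algebra_simps)

lemma dot_smul: "dot (smul c a) b = c * dot a b" "dot a (smul c b) = c * dot a b"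
  by (cases a; cases b; simp add: algebra_simps)+

lemma dot_0 [simp]: "dot 0 b = 0" "dot b 0 = 0"
  by (cases b; simp add: zero_vec3_def)+

lemma smul_0_right [simp]: "smul c 0 = (0 :: 'k::comm_ring_1 vec3)"
  by (simp add: zero_vec3_def)

lemma smul_0_left [simp]: "smul 0 x = (0 :: 'k::comm_ring_1 vec3)"
  by (cases x) (simp add: zero_vec3_def)

lemma smul_1 [simp]: "smul 1 x = (x :: 'k::comm_ring_1 vec3)"
  by (cases x) simp

lemma smul_smul: "smul c (smul d x) = smul (c * d) (x :: 'k::comm_ring_1 vec3)"
  by (cases x) (simp add: mult.assoc)

lemma smul_add: "smul c (x + y) = smul c x + smul c (y :: 'k::comm_ring_1 vec3)"
  by (cases x; cases y) (simp add: algebra_simps)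

lemma smul_add_left: "smul (c + d) x = smul c x + smul d (x :: 'k::comm_ring_1 vec3)"
  by (cases x) (simp add: algebra_simps)

lemma smul_uminus: "smul (- c) x = - smul c x" "smul c (- x) = - smul c (x :: 'k::comm_ring_1 vec3)"
  by (cases x; simp)+

lemma smul_eq_0_iff: "smul c x = 0 \<longleftrightarrow> c = 0 \<or> x = (0 :: 'k::field vec3)"
  by (cases x) (auto simp: zero_vec3_def)

lemma smul_cancel: "c \<noteq> 0 \<Longrightarrow> smul c x = smul c y \<longleftrightarrow> x = (y :: 'k::field vec3)"
  by (cases x; cases y) auto

lemma tri_commute: "tri a b c = tri b a c" "tri a b c = tri a c b"
  by (cases a; cases b; cases c; simp add: tri_def algebra_simps)+

lemma tri_smul: "tri (smul t a) b c = t * tri a b c" "tri a (smul t b) c = t * tri a b c"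
    "tri a b (smul t c) = t * tri a b c"
  by (simp_all add: tri_def phi_smul dot_smul)

lemma tri_add: "tri (a + a') b c = tri a b c + tri a' b c" "tri a (b + b') c = tri a b c + tri a b' c"
    "tri a b (c + c') = tri a b c + tri a b c'"
  by (simp_all add: tri_def phi_add_left phi_add_right dot_add_left dot_add_right)

lemma tri_0 [simp]: "tri 0 b c = 0" "tri a 0 c = 0" "tri a b 0 = 0"
  by (simp_all add: tri_def)

lemma dot_eqI: assumes "\<And>x. dot a x = dot b x" shows "a = b"
  using assms[of e1] assms[of e2] assms[of e3] by (cases a; cases b) simp

text \<open>The vector \<open>phi a e1\<close> is a permutation of the coordinates of
  \<open>a\<close>, so the form has no kernel. This makes every map that preserves the form up to a
  nonzero factor injective.\<close>

lemma tri_eqI: assumes "\<And>y z. tri a y z = tri b y z" shows "a = b"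
  using assms[of e1 e2] assms[of e1 e1] assms[of e1 e3] by (cases a; cases b) (simp add: tri_def)

lemma det3_eqI: assumes "\<And>x y. det3 a x y = det3 b x y" shows "a = b"
  using assms[of e1 e2] assms[of e2 e3] assms[of e1 e3] by (cases a; cases b) (simp)

lemma det3_add: "det3 (a + a') b c = det3 a b c + det3 a' b c" "det3 a (b + b') c = det3 a b c + det3 a b' c"
    "det3 a b (c + c') = det3 a b c + det3 a b c'"
  subgoal by (cases a; cases a'; cases b; cases c) (simp add: algebra_simps)
  subgoal by (cases a; cases b; cases b'; cases c) (simp add: algebra_simps)
  subgoal by (cases a; cases b; cases c; cases c') (simp add: algebra_simps)
  done

lemma det3_smul: "det3 (smul t a) b c = t * det3 a b c" "det3 a (smul t b) c = t * det3 a b c"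
    "det3 a b (smul t c) = t * det3 a b c"
  by (cases a; cases b; cases c; simp add: algebra_simps)+

lemma det3_0 [simp]: "det3 0 b c = 0" "det3 a 0 c = 0" "det3 a b 0 = 0"
  by (cases a; cases b; cases c; simp add: zero_vec3_def)+

lemma det3_self [simp]: "det3 a b b = 0" "det3 a b a = 0" "det3 a a b = 0"
  by (cases a; cases b; simp add: algebra_simps)+

lemma det3_swap: "det3 a b c = - det3 a c b" "det3 a b c = - det3 b a c"
  by (cases a; cases b; cases c; simp add: algebra_simps)+

text \<open>Every scalar is a sum of ones, so induction turns additivity into homogeneity. Group
  homomorphisms only provide additive maps, and over a prime field this is enough.\<close>

lemma additive_mult:
  fixes f :: "'k::prime_field \<Rightarrow> 'k"
  assumes "additive f"
  shows "f c = c * f 1"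
proof -
  interpret additive f by fact
  obtain n where n: "c = of_nat n" using of_nat_onto by blast
  have "f (of_nat n) = of_nat n * f 1" by (induction n) (simp_all add: zero add algebra_simps)
  then show ?thesis using n by simp
qed

lemma additive_smul:
  fixes f :: "'k::prime_field vec3 \<Rightarrow> 'k vec3"
  assumes "additive f"
  shows "f (smul c x) = smul c (f x)"
proof -
  interpret additive f by fact
  obtain n where n: "c = of_nat n" using of_nat_onto by blast
  have "f (smul (of_nat n) x) = smul (of_nat n) (f x)"
    by (induction n) (simp_all add: zero add smul_add_left)
  then show ?thesis using n by simp
qed

lemma additive_dot:
  fixes f :: "'k::prime_field vec3 \<Rightarrow> 'k"
  assumes "additive f"
  shows "f x = dot x (Vec (f e1) (f e2) (f e3))"
proof -
  interpret additive f by fact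
  have *: "f (smul c x) = c * f x" for c x
  proof -
    obtain n where n: "c = of_nat n" using of_nat_onto by blast
    have "f (smul (of_nat n) x) = of_nat n * (f x)"
      by (induction n) (simp_all add: zero add smul_add_left algebra_simps)
    then show ?thesis using n by simp
  qed
  obtain a b c where x: "x = Vec a b c" by (cases x)
  then have "f x = f (smul a e1 + smul b e2 + smul c e3)" by simp
  also have "\<dots> = a * f e1 + b * f e2 + c * f e3"
    by (simp only: add *)
  finally show ?thesis by (simp add: x)
qed

lemma additive_expand:
  fixes f :: "'k::prime_field vec3 \<Rightarrow> 'k vec3"
  assumes "additive f"
  shows "f (Vec x y z) = smul x (f e1) + smul y (f e2) + smul z (f e3)"
proof -
  interpret additive f by fact
  have "f (Vec x y z) = f (smul x e1 + smul y e2 + smul z e3)" by simp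
  then show ?thesis by (simp only: add additive_smul[OF assms])
qed

text \<open>Eight values on unit vectors give linear equations that leave one free matrix entry: the
  centre of the cubic form is trivial. This rigidity serves twice, to identify the triple
  commutators in a descendant and to compare the two maps induced by an isomorphism.\<close>

lemma self_adjoint_scalar:
  fixes N :: "'k::prime_field vec3 \<Rightarrow> 'k vec3"
  assumes N: "additive N" and sa: "\<And>x y z. tri (N x) y z = tri x (N y) z"
  shows "\<exists>c. \<forall>x. N x = smul c x"
proof -
  obtain a1 a2 a3 where a: "N e1 = (Vec a1 a2 a3)" by (cases "N e1")
  obtain b1 b2 b3 where b: "N e2 = (Vec b1 b2 b3)" by (cases "N e2")
  obtain c1 c2 c3 where c: "N e3 = (Vec c1 c2 c3)" by (cases "N e3")
  note s = sa[of e1 e2 e2] sa[of e1 e3 e2] sa[of e2 e3 e2] sa[of e1 e2 e3] sa[of e1 e3 e3]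
    sa[of e2 e3 e3] sa[of e1 e2 e1] sa[of e1 e3 e1]
  have "a2 = b1" "0 = c1" "0 = c2" "0 = b3" "a1 = c3" "b1 = 0" "a1 = b2" "a3 = c2"
    using s[unfolded a b c tri_def] by simp_all
  then have eqs: "a2 = 0" "a3 = 0" "b1 = 0" "b3 = 0" "c1 = 0" "c2 = 0" "b2 = a1" "c3 = a1"
    by simp_all
  have "N x = smul a1 x" for x
    by (cases x) (simp add: additive_expand[OF N, unfolded a b c] eqs)
  then show ?thesis by blast
qed

text \<open>Over the prime field additive maps are linear, so these are the similarities of the plane
  cubic \<open>tri x x x = 0\<close>.\<close>

definition cubic_group :: "('k::prime_field vec3 \<Rightarrow> 'k vec3) set" where
  "cubic_group = {R. additive R \<and> (\<exists>m. m \<noteq> 0 \<and> (\<forall>x y z. tri (R x) (R y) (R z) = m * tri x y z))}"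

lemma cubic_groupI:
  assumes "additive R" "m \<noteq> 0" "\<And>x y z. tri (R x) (R y) (R z) = m * tri x y z"
  shows "R \<in> cubic_group"
  using assms unfolding cubic_group_def by blast

lemma cubic_group_additive: "R \<in> cubic_group \<Longrightarrow> additive R"
  by (simp add: cubic_group_def)

lemma cubic_group_bij:
  assumes R: "R \<in> cubic_group" shows "bij R"
proof -
  interpret additive R using R by (rule cubic_group_additive)
  obtain m where m: "m \<noteq> 0" "\<And>x y z. tri (R x) (R y) (R z) = m * tri x y z"
    using R by (auto simp: cubic_group_def)
  have "inj R"
  proof (rule injI)
    fix x y assume e: "R x = R y"
    have "tri x u v = tri y u v" for u v
      using m(2)[of x u v] m(2)[of y u v] m(1) e by simp
    then show "x = y" by (rule tri_eqI)
  qed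
  then show ?thesis by (simp add: bij_def finite_UNIV_inj_surj)
qed

lemma cubic_group_smul: "c \<noteq> 0 \<Longrightarrow> smul c \<in> cubic_group"
  by (rule cubic_groupI[of _ "c * (c * c)"]) (simp_all add: additive_def smul_add tri_smul mult.assoc)

lemma cubic_group_comp:
  assumes "R \<in> cubic_group" "S \<in> cubic_group" shows "R \<circ> S \<in> cubic_group"
proof -
  obtain m where m: "m \<noteq> 0" "\<And>x y z. tri (R x) (R y) (R z) = m * tri x y z"
    using assms(1) by (auto simp: cubic_group_def)
  obtain n where n: "n \<noteq> 0" "\<And>x y z. tri (S x) (S y) (S z) = n * tri x y z"
    using assms(2) by (auto simp: cubic_group_def)
  have "additive (R \<circ> S)" using assms by (simp add: cubic_group_def additive_def)
  moreover have "tri ((R \<circ> S) x) ((R \<circ> S) y) ((R \<circ> S) z) = (m * n) * tri x y z" for x y z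
    by (simp add: m n)
  ultimately show ?thesis using m(1) n(1) by (intro cubic_groupI[of _ "m * n"]) auto
qed

lemma additive_inv: assumes "additive R" "bij R" shows "additive (inv_into UNIV R)"
  using assms unfolding additive_def by (metis bij_inv_eq_iff)

lemma cubic_group_inv:
  assumes R: "R \<in> cubic_group" shows "inv_into UNIV R \<in> cubic_group"
proof -
  obtain m where m: "m \<noteq> 0" "\<And>x y z. tri (R x) (R y) (R z) = m * tri x y z"
    using R by (auto simp: cubic_group_def)
  have b: "bij R" by (rule cubic_group_bij[OF R])
  then have i: "R (inv_into UNIV R x) = x" for x by (simp add: bij_is_surj surj_f_inv_f)
  have "tri (inv_into UNIV R x) (inv_into UNIV R y) (inv_into UNIV R z) = inverse m * tri x y z" for x y z
    using m(2)[of "inv_into UNIV R x" "inv_into UNIV R y" "inv_into UNIV R z"] m(1) by (simp add: i)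
  moreover have "inverse m \<noteq> 0" using m(1) by simp
  ultimately show ?thesis using additive_inv[OF cubic_group_additive[OF R] b]
    unfolding cubic_group_def by blast
qed

lemma cubic_group_id: "id \<in> cubic_group"
  by (auto simp: cubic_group_def additive_def intro!: exI[of _ 1])

lemma det3_additive:
  fixes R :: "'k::prime_field vec3 \<Rightarrow> 'k vec3"
  assumes R: "additive R" "surj R"
  obtains D where "D \<noteq> 0" "\<And>x y z. det3 (R x) (R y) (R z) = D * det3 x y z"
proof -
  obtain a1 a2 a3 where a: "R e1 = (Vec a1 a2 a3)" by (cases "R e1")
  obtain b1 b2 b3 where b: "R e2 = (Vec b1 b2 b3)" by (cases "R e2")
  obtain c1 c2 c3 where c: "R e3 = (Vec c1 c2 c3)" by (cases "R e3")
  define D where "D = det3 (Vec a1 a2 a3) (Vec b1 b2 b3) (Vec c1 c2 c3)"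
  have D: "det3 (R x) (R y) (R z) = D * det3 x y z" for x y z
  proof -
    obtain x1 x2 x3 y1 y2 y3 z1 z2 z3 where xyz: "x = Vec x1 x2 x3" "y = Vec y1 y2 y3" "z = Vec z1 z2 z3"
      by (cases x; cases y; cases z)
    show ?thesis by (simp only: xyz additive_expand[OF R(1), unfolded a b c] D_def det3.simps smul.simps
          plus_vec3.simps) Groebner_Basis.algebra
  qed
  obtain u v w where "R u = e1" "R v = e2" "R w = e3" using R(2) by (metis surjD)
  then have "D \<noteq> 0" using D[of u v w] by auto
  then show ?thesis using D that by blast
qed

section \<open>Coordinates on the group and its descendants\<close>

lemma of_nat_CARD: "of_nat CARD('k::prime_field) = (0::'k)"
  using CHAR_dvd_CARD[where 'a = 'k] by (simp add: of_nat_eq_0_iff_char_dvd)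

lemma CARD_eq_CHAR: "CARD('k::prime_field) = CHAR('k)"
proof -
  have "(UNIV :: 'k set) \<subseteq> of_nat ` {..<CHAR('k)}"
  proof
    fix x :: 'k
    obtain n where n: "x = of_nat n" using of_nat_onto by blast
    have "CHAR('k) > 0" using CHAR_dvd_CARD[where 'a = 'k] by (intro Nat.gr0I) auto
    then have "x = of_nat (n mod CHAR('k))" "n mod CHAR('k) < CHAR('k)"
      by (simp_all add: n of_nat_eq_iff_cong_CHAR cong_def)
    then show "x \<in> of_nat ` {..<CHAR('k)}" by blast
  qed
  then have "CARD('k) \<le> CHAR('k)"
    by (metis card_lessThan finite_lessThan surj_card_le)
  then show ?thesis using CHAR_dvd_CARD[where 'a = 'k]
    by (simp add: dvd_imp_le le_antisym)
qed

lemma prime_CARD: "Factorial_Ring.prime CARD('k::prime_field)"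
  unfolding CARD_eq_CHAR
proof (rule prime_CHAR_semidom)
  show "CHAR('k) > 0" using CHAR_dvd_CARD[where 'a = 'k] by (intro Nat.gr0I) auto
qed

lemma of_int_eq_0_iff_CARD: "of_int i = (0::'k::prime_field) \<longleftrightarrow> int CARD('k) dvd i"
  by (simp add: CARD_eq_CHAR of_int_eq_0_iff_char_dvd)

lemma of_int_eq_iff_CARD: "of_int i = (of_int j::'k::prime_field) \<longleftrightarrow> i mod int CARD('k) = j mod int CARD('k)"
  using of_int_eq_0_iff_CARD[of "i - j", where 'k = 'k] by (simp add: mod_eq_dvd_iff)

text \<open>Reduction modulo the cardinality makes the value independent of the chosen
  \<open>n\<close> and puts it in the range that \<open>Gp\<close> demands of exponents.\<close>

definition rep :: "'k::prime_field \<Rightarrow> int" where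
  "rep c = int (SOME n. c = of_nat n) mod int CARD('k)"

lemma of_int_rep [simp]: "of_int (rep c) = c"
proof -
  have "c = of_nat (SOME n. c = of_nat n)" by (rule someI_ex) (rule of_nat_onto)
  then have "of_int (int (SOME n. c = of_nat n)) = c" by simp
  then show ?thesis unfolding rep_def
    using of_int_eq_iff_CARD[of "int (SOME n. c = of_nat n) mod int CARD('a)" "int (SOME n. c = of_nat n)", where 'k = 'a]
    by simp
qed

lemma rep_range: "rep (c::'k::prime_field) \<in> {0..<int CARD('k)}"
  by (simp add: rep_def)

lemma rep_of_int: "rep (of_int i :: 'k::prime_field) = i mod int CARD('k)"
proof -
  have "rep (of_int i :: 'k) mod int CARD('k) = i mod int CARD('k)"
    using of_int_rep[of "of_int i :: 'k"] of_int_eq_iff_CARD by blast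
  then show ?thesis using rep_range[of "of_int i :: 'k"] by simp
qed

lemma rep_0 [simp]: "rep 0 = 0" using rep_of_int[of 0] by simp

section \<open>Vector coordinates on the class two group\<close>

definition coordA :: "(nat \<Rightarrow> int) \<times> (nat \<Rightarrow> int) \<Rightarrow> 'k::prime_field vec3" where
  "coordA g = Vec (of_int (fst g 1)) (of_int (fst g 2)) (of_int (fst g 3))"

definition coordB :: "(nat \<Rightarrow> int) \<times> (nat \<Rightarrow> int) \<Rightarrow> 'k::prime_field vec3" where
  "coordB g = Vec (of_int (fst g 4)) (of_int (fst g 5)) (of_int (fst g 6))"

text \<open>The order \<open>y\<^sub>1, y\<^sub>3, y\<^sub>2\<close> turns the commutator pairing into the gradient of the cubic.\<close>

definition coordW :: "(nat \<Rightarrow> int) \<times> (nat \<Rightarrow> int) \<Rightarrow> 'k::prime_field vec3" where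
  "coordW g = Vec (of_int (snd g 1)) (of_int (snd g 3)) (of_int (snd g 2))"

fun gp_elem :: "'k::prime_field vec3 \<Rightarrow> 'k vec3 \<Rightarrow> 'k vec3 \<Rightarrow> (nat \<Rightarrow> int) \<times> (nat \<Rightarrow> int)" where
  "gp_elem (Vec a1 a2 a3) (Vec b1 b2 b3) (Vec w1 w2 w3) =
     ((\<lambda>_. 0)(1 := rep a1, 2 := rep a2, 3 := rep a3, 4 := rep b1, 5 := rep b2, 6 := rep b3),
      (\<lambda>_. 0)(1 := rep w1, 2 := rep w3, 3 := rep w2))"

lemma coord_gp_elem [simp]:
  "coordA (gp_elem a b w) = a" "coordB (gp_elem a b w) = b" "coordW (gp_elem a b w) = w"
  by (cases a; cases b; cases w; simp add: coordA_def coordB_def coordW_def)+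

lemma gp_elem_carrier: "gp_elem a b (w :: 'k::prime_field vec3) \<in> carrier (Gp CARD('k))"
  using rep_range[where 'k = 'k] by (cases a; cases b; cases w) (auto simp: Gp_def)

lemma of_int_inj_on_residues:
  "(of_int i :: 'k::prime_field) = of_int j \<Longrightarrow> i \<in> {0..<int CARD('k)} \<Longrightarrow> j \<in> {0..<int CARD('k)} \<Longrightarrow> i = j"
  by (simp add: of_int_eq_iff_CARD)

lemma Gp_eqI:
  assumes g: "g \<in> carrier (Gp CARD('k::prime_field))" and h: "h \<in> carrier (Gp CARD('k))"
    and "coordA g = (coordA h :: 'k vec3)" "coordB g = (coordB h :: 'k vec3)" "coordW g = (coordW h :: 'k vec3)"
  shows "g = h"
proof -
  obtain a c where [simp]: "g = (a, c)" by (cases g)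
  obtain b d where [simp]: "h = (b, d)" by (cases h)
  have r: "a i \<in> {0..<int CARD('k)}" "b i \<in> {0..<int CARD('k)}" "c i \<in> {0..<int CARD('k)}"
     "d i \<in> {0..<int CARD('k)}" for i
    using g h by (auto simp: Gp_def)
  have "a i = b i" if "i \<in> {1..6}" for i
  proof -
    have "i = 1 \<or> i = 2 \<or> i = 3 \<or> i = 4 \<or> i = 5 \<or> i = 6" using that by auto
    moreover have "of_int (a i) = (of_int (b i) :: 'k) \<Longrightarrow> a i = b i"
      using of_int_inj_on_residues r by blast
    ultimately show ?thesis using assms(3,4) by (auto simp: coordA_def coordB_def)
  qed
  moreover have "a i = b i" if "i \<notin> {1..6}" for i using g h that by (auto simp: Gp_def)
  ultimately have "a = b" by blast
  have "c i = d i" if "i \<in> {1..3}" for i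
  proof -
    have "i = 1 \<or> i = 2 \<or> i = 3" using that by auto
    moreover have "of_int (c i) = (of_int (d i) :: 'k) \<Longrightarrow> c i = d i"
      using of_int_inj_on_residues r by blast
    ultimately show ?thesis using assms(5) by (auto simp: coordW_def)
  qed
  moreover have "c i = d i" if "i \<notin> {1..3}" for i using g h that by (auto simp: Gp_def)
  ultimately have "c = d" by blast
  then show ?thesis using \<open>a = b\<close> by simp
qed

lemma of_int_mod_CARD [simp]: "of_int (i mod int CARD('k)) = (of_int i :: 'k::prime_field)"
  by (simp add: of_int_eq_iff_CARD)

lemma coord_mult:
  fixes g h :: "(nat \<Rightarrow> int) \<times> (nat \<Rightarrow> int)"
  defines "gh \<equiv> g \<otimes>\<^bsub>Gp CARD('k::prime_field)\<^esub> h"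
  shows "coordA gh = (coordA g + coordA h :: 'k vec3)"
    and "coordB gh = (coordB g + coordB h :: 'k vec3)"
    and "coordW gh = (coordW g + coordW h + phi (coordA g) (coordB h) :: 'k vec3)"
  by (cases g; cases h; simp add: gh_def Gp_def coordA_def coordB_def coordW_def gp_beta_def algebra_simps)+

lemma Gp_mult_closed:
  assumes "g \<in> carrier (Gp p)" "h \<in> carrier (Gp p)" "p > 0"
  shows "g \<otimes>\<^bsub>Gp p\<^esub> h \<in> carrier (Gp p)"
  using assms by (auto simp: Gp_def gp_beta_def)

lemma gp_elem_mult:
  "gp_elem a b w \<otimes>\<^bsub>Gp CARD('k::prime_field)\<^esub> gp_elem a' b' (w' :: 'k vec3) =
     gp_elem (a + a') (b + b') (w + w' + phi a b')"
  by (rule Gp_eqI[where 'k = 'k]) (simp_all add: coord_mult gp_elem_carrier Gp_mult_closed)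

lemma gp_elem_coord:
  "g \<in> carrier (Gp CARD('k::prime_field)) \<Longrightarrow> gp_elem (coordA g) (coordB g) (coordW g :: 'k vec3) = g"
  by (rule Gp_eqI[where 'k = 'k]) (simp_all add: gp_elem_carrier)

lemma group_Gp: "group (Gp CARD('k::prime_field))"
proof (rule groupI)
  show "x \<otimes>\<^bsub>Gp CARD('k)\<^esub> y \<in> carrier (Gp CARD('k))"
    if "x \<in> carrier (Gp CARD('k))" "y \<in> carrier (Gp CARD('k))" for x y
    using that by (simp add: Gp_mult_closed)
  have one: "\<one>\<^bsub>Gp CARD('k)\<^esub> = gp_elem 0 0 (0 :: 'k vec3)"
    by (auto simp: Gp_def zero_vec3_def)
  show "\<one>\<^bsub>Gp CARD('k)\<^esub> \<in> carrier (Gp CARD('k))" unfolding one by (rule gp_elem_carrier)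
  fix x assume x: "x \<in> carrier (Gp CARD('k))"
  show "\<one>\<^bsub>Gp CARD('k)\<^esub> \<otimes>\<^bsub>Gp CARD('k)\<^esub> x = x"
    unfolding one by (rule Gp_eqI[where 'k = 'k]) (simp_all add: coord_mult gp_elem_carrier Gp_mult_closed x)
  let ?y = "gp_elem (- coordA x) (- coordB x) (phi (coordA x) (coordB x) - coordW x :: 'k vec3)"
  have "?y \<otimes>\<^bsub>Gp CARD('k)\<^esub> x = \<one>\<^bsub>Gp CARD('k)\<^esub>"
    unfolding one by (rule Gp_eqI[where 'k = 'k])
     (simp_all add: coord_mult gp_elem_carrier Gp_mult_closed x phi_uminus)
  then show "\<exists>y\<in>carrier (Gp CARD('k)). y \<otimes>\<^bsub>Gp CARD('k)\<^esub> x = \<one>\<^bsub>Gp CARD('k)\<^esub>"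
    using gp_elem_carrier by blast
  fix y z assume yz: "y \<in> carrier (Gp CARD('k))" "z \<in> carrier (Gp CARD('k))"
  show "x \<otimes>\<^bsub>Gp CARD('k)\<^esub> y \<otimes>\<^bsub>Gp CARD('k)\<^esub> z = x \<otimes>\<^bsub>Gp CARD('k)\<^esub> (y \<otimes>\<^bsub>Gp CARD('k)\<^esub> z)"
    by (rule Gp_eqI[where 'k = 'k])
      (simp_all add: coord_mult gp_elem_carrier Gp_mult_closed x yz phi_add_left phi_add_right add_ac)
qed

section \<open>Lower central series and the quotient of class two\<close>

lemma lower_central_subset:
  fixes G (structure)
  assumes "group G" shows "lower_central G n \<subseteq> carrier G"
proof -
  interpret group G by fact
  have "lower_central G (Suc n) \<subseteq> carrier G \<and> lower_central G n \<subseteq> carrier G"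
  proof (induction n)
    case (Suc n)
    have "{inv x \<otimes> inv y \<otimes> x \<otimes> y |x y. x \<in> lower_central G (Suc n) \<and> y \<in> carrier G} \<subseteq> carrier G"
      using Suc by auto
    then show ?case using Suc generate_incl by (simp add: commutator_subgroup_def)
  qed simp
  then show ?thesis by simp
qed

lemma lower_central_iso:
  assumes "group G" "group H" "h \<in> iso G H"
  shows "lower_central H n = h ` lower_central G n"
proof -
  interpret G: group G by fact
  interpret H: group H by fact
  interpret group_hom G H h using assms by unfold_locales (simp add: iso_def)
  have onto: "h ` carrier G = carrier H" using assms(3) by (simp add: iso_def bij_betw_def)
  have "lower_central H (Suc n) = h ` lower_central G (Suc n) \<and> lower_central H n = h ` lower_central G n"
  proof (induction n)
    case 0 then show ?case by (simp add: onto)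
  next
    case (Suc n)
    let ?c = "\<lambda>x y. inv\<^bsub>G\<^esub> x \<otimes>\<^bsub>G\<^esub> inv\<^bsub>G\<^esub> y \<otimes>\<^bsub>G\<^esub> x \<otimes>\<^bsub>G\<^esub> y"
    let ?d = "\<lambda>x y. inv\<^bsub>H\<^esub> x \<otimes>\<^bsub>H\<^esub> inv\<^bsub>H\<^esub> y \<otimes>\<^bsub>H\<^esub> x \<otimes>\<^bsub>H\<^esub> y"
    let ?L = "lower_central G (Suc n)"
    have sub: "?L \<subseteq> carrier G" by (rule lower_central_subset) fact
    have cd: "h (?c x y) = ?d (h x) (h y)" if "x \<in> ?L" "y \<in> carrier G" for x y
      using that sub by (simp add: subset_iff)
    have "{?d x y |x y. x \<in> h ` ?L \<and> y \<in> h ` carrier G} = h ` {?c x y |x y. x \<in> ?L \<and> y \<in> carrier G}"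
      using cd by (auto simp: image_iff) metis+
    moreover have "{?c x y |x y. x \<in> ?L \<and> y \<in> carrier G} \<subseteq> carrier G" using sub by auto
    ultimately show ?case using Suc generate_img by (simp add: commutator_subgroup_def onto)
  qed
  then show ?thesis by simp
qed

lemma (in group) commutator_eq_one_iff:
  assumes "x \<in> carrier G" "y \<in> carrier G"
  shows "inv x \<otimes> inv y \<otimes> x \<otimes> y = \<one> \<longleftrightarrow> x \<otimes> y = y \<otimes> x"
  using assms by (metis inv_closed inv_equality inv_mult_group m_assoc m_closed r_inv inv_inv)

lemma commutator_subgroup_trivialD:
  fixes G (structure)
  assumes "group G" "commutator_subgroup G H (carrier G) = {\<one>\<^bsub>G\<^esub>}" "H \<subseteq> carrier G" "x \<in> H" "y \<in> carrier G"
  shows "x \<otimes>\<^bsub>G\<^esub> y = y \<otimes>\<^bsub>G\<^esub> x"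
proof -
  interpret group G by fact
  have "inv x \<otimes> inv y \<otimes> x \<otimes> y \<in> commutator_subgroup G H (carrier G)"
    unfolding commutator_subgroup_def using assms(4,5) by (intro generate.incl) blast
  then show ?thesis using assms commutator_eq_one_iff by auto
qed

lemma lower_central_Suc3: "lower_central G (Suc 3) = commutator_subgroup G (lower_central G 3) (carrier G)"
  "lower_central G 3 = commutator_subgroup G (lower_central G 2) (carrier G)"
  "lower_central G 2 = commutator_subgroup G (carrier G) (carrier G)"
  by (simp_all add: eval_nat_numeral)

lemma lower_central_subgroup:
  fixes G (structure)
  assumes "group G" shows "subgroup (lower_central G 3) G"
proof -
  interpret group G by fact
  have "{inv x \<otimes> inv y \<otimes> x \<otimes> y |x y. x \<in> lower_central G 2 \<and> y \<in> carrier G} \<subseteq> carrier G"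
    using lower_central_subset[OF assms, of 2] by auto
  then show ?thesis
    unfolding lower_central_Suc3(2) commutator_subgroup_def by (rule generate_is_subgroup)
qed

text \<open>Functions on \<open>K\<close> itself replace an isomorphism of its quotient: they are
  the coordinates of the image in the class two group. Later arguments then compute in
  \<open>K\<close> and never with cosets.\<close>

definition desc_coords ::
  "('g, 'm) monoid_scheme \<Rightarrow> ('g \<Rightarrow> 'k::prime_field vec3) \<Rightarrow> ('g \<Rightarrow> 'k vec3) \<Rightarrow> ('g \<Rightarrow> 'k vec3) \<Rightarrow> bool" where
  "desc_coords K A B W \<longleftrightarrow>
     (\<forall>x\<in>carrier K. \<forall>y\<in>carrier K. A (x \<otimes>\<^bsub>K\<^esub> y) = A x + A y \<and> B (x \<otimes>\<^bsub>K\<^esub> y) = B x + B y \<and>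
        W (x \<otimes>\<^bsub>K\<^esub> y) = W x + W y + phi (A x) (B y)) \<and>
     (\<forall>a b w. \<exists>x\<in>carrier K. A x = a \<and> B x = b \<and> W x = w) \<and>
     lower_central K 3 = {x \<in> carrier K. A x = 0 \<and> B x = 0 \<and> W x = 0}"

lemma desc_coords_mult:
  assumes "desc_coords K A B W" "x \<in> carrier K" "y \<in> carrier K"
  shows "A (x \<otimes>\<^bsub>K\<^esub> y) = A x + A y" "B (x \<otimes>\<^bsub>K\<^esub> y) = B x + B y"
    "W (x \<otimes>\<^bsub>K\<^esub> y) = W x + W y + phi (A x) (B y)"
  using assms by (simp_all add: desc_coords_def)

lemma desc_coords_onto:
  assumes "desc_coords K A B W"
  obtains x where "x \<in> carrier K" "A x = a" "B x = b" "W x = w"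
  using assms unfolding desc_coords_def by blast

lemma desc_coords_kernel:
  "desc_coords K A B W \<Longrightarrow> lower_central K 3 = {x \<in> carrier K. A x = 0 \<and> B x = 0 \<and> W x = 0}"
  by (simp add: desc_coords_def)

lemma gp_elem_inject:
  fixes w :: "'k::prime_field vec3"
  shows "gp_elem a b w = gp_elem a' b' w' \<longleftrightarrow> a = a' \<and> b = b' \<and> w = w'"
proof
  assume *: "gp_elem a b w = gp_elem a' b' w'"
  show "a = a' \<and> b = b' \<and> w = w'"
    using arg_cong[OF *, of "coordA :: _ \<Rightarrow> 'k vec3"] arg_cong[OF *, of "coordB :: _ \<Rightarrow> 'k vec3"]
      arg_cong[OF *, of "coordW :: _ \<Rightarrow> 'k vec3"] by simp
qed simp

lemma one_Gp: "\<one>\<^bsub>Gp CARD('k::prime_field)\<^esub> = gp_elem 0 0 (0 :: 'k vec3)"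
  by (auto simp: Gp_def zero_vec3_def)

text \<open>The first isomorphism theorem, read in both directions. The trivial fourth term makes
  the third one central, hence normal, so that the quotient is a group.\<close>

lemma Mod_iso_Gp_iff:
  assumes K: "group K" and c4: "lower_central K (Suc 3) = {\<one>\<^bsub>K\<^esub>}"
  shows "(K Mod lower_central K 3 \<cong> Gp CARD('k::prime_field)) \<longleftrightarrow>
     (\<exists>A B W :: 'g \<Rightarrow> 'k vec3. desc_coords (K :: ('g, 'm) monoid_scheme) A B W)"
proof
  interpret group K by fact
  interpret Gp: group "Gp CARD('k)" by (rule group_Gp)
  let ?N = "lower_central K 3"
  have sub: "subgroup ?N K" by (rule lower_central_subgroup) fact
  have central: "x \<otimes>\<^bsub>K\<^esub> y = y \<otimes>\<^bsub>K\<^esub> x" if "x \<in> ?N" "y \<in> carrier K" for x y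
    using commutator_subgroup_trivialD[OF K c4[unfolded lower_central_Suc3] lower_central_subset[OF K, of 3, unfolded lower_central_Suc3]]
      that by (simp add: lower_central_Suc3)
  have normal: "?N \<lhd> K"
  proof (rule normal_invI[OF sub])
    fix x h assume "x \<in> carrier K" "h \<in> ?N"
    then show "x \<otimes>\<^bsub>K\<^esub> h \<otimes>\<^bsub>K\<^esub> inv\<^bsub>K\<^esub> x \<in> ?N"
      using central[of h x] subgroup.mem_carrier[OF sub, of h] by (simp add: m_assoc flip: central)
  qed
  then interpret N: normal ?N K .
  show "\<exists>A B W :: 'g \<Rightarrow> 'k vec3. desc_coords K A B W" if iso: "K Mod ?N \<cong> Gp CARD('k)"
  proof -
    obtain f where f: "f \<in> iso (K Mod ?N) (Gp CARD('k))" using iso unfolding Group.is_iso_def by blast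
    interpret Q: group "K Mod ?N" by (rule N.factorgroup_is_group)
    interpret f: group_hom "K Mod ?N" "Gp CARD('k)" f
      using f by unfold_locales (simp add: iso_def)
    have fbij: "bij_betw f (carrier (K Mod ?N)) (carrier (Gp CARD('k)))" using f by (simp add: iso_def)
    define g where "g x = f (?N #>\<^bsub>K\<^esub> x)" for x
    have cl: "?N #>\<^bsub>K\<^esub> x \<in> carrier (K Mod ?N)" if "x \<in> carrier K" for x
      using that by (auto simp: FactGroup_def RCOSETS_def)
    have gc: "g x \<in> carrier (Gp CARD('k))" if "x \<in> carrier K" for x
      using cl[OF that] by (simp add: g_def)
    have gm: "g (x \<otimes>\<^bsub>K\<^esub> y) = g x \<otimes>\<^bsub>Gp CARD('k)\<^esub> g y" if "x \<in> carrier K" "y \<in> carrier K" for x y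
      using hom_mult[OF N.r_coset_hom_Mod that] f.hom_mult[OF cl[OF that(1)] cl[OF that(2)]] by (simp only: g_def)
    have onto: "\<exists>x\<in>carrier K. g x = h" if h: "h \<in> carrier (Gp CARD('k))" for h
    proof -
      have "h \<in> f ` carrier (K Mod ?N)" using h by (simp only: bij_betw_imp_surj_on[OF fbij])
      then obtain Y where "h = f Y" "Y \<in> carrier (K Mod ?N)" by (rule imageE)
      then show ?thesis by (auto simp: g_def FactGroup_def RCOSETS_def)
    qed
    have ker: "g x = \<one>\<^bsub>Gp CARD('k)\<^esub> \<longleftrightarrow> x \<in> ?N" if "x \<in> carrier K" for x
    proof -
      have "g x = \<one>\<^bsub>Gp CARD('k)\<^esub> \<longleftrightarrow> f (?N #>\<^bsub>K\<^esub> x) = f \<one>\<^bsub>K Mod ?N\<^esub>"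
        unfolding f.hom_one by (simp only: g_def)
      also have "\<dots> \<longleftrightarrow> ?N #>\<^bsub>K\<^esub> x = \<one>\<^bsub>K Mod ?N\<^esub>"
        using fbij cl[OF that] Q.one_closed by (metis bij_betw_inv_into_left)
      also have "\<dots> \<longleftrightarrow> x \<in> ?N"
        using coset_join1[OF _ that sub] coset_join2[OF that sub] by auto
      finally show ?thesis .
    qed
    have "desc_coords K (\<lambda>x. coordA (g x) :: 'k vec3) (\<lambda>x. coordB (g x)) (\<lambda>x. coordW (g x))"
      unfolding desc_coords_def
    proof (intro conjI ballI allI)
      fix a b w :: "'k vec3"
      obtain x where "x \<in> carrier K" "g x = gp_elem a b w" using onto[OF gp_elem_carrier] by blast
      then show "\<exists>x\<in>carrier K. coordA (g x) = a \<and> coordB (g x) = b \<and> coordW (g x) = w" by force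
    next
      have "g x = \<one>\<^bsub>Gp CARD('k)\<^esub> \<longleftrightarrow> coordA (g x) = (0 :: 'k vec3) \<and> coordB (g x) = (0 :: 'k vec3) \<and> coordW (g x) = (0 :: 'k vec3)"
        if "x \<in> carrier K" for x
        using gp_elem_inject[of "coordA (g x)" "coordB (g x)" "coordW (g x) :: 'k vec3" 0 0 0]
        unfolding one_Gp gp_elem_coord[OF gc[OF that]] .
      then show "?N = {x \<in> carrier K. coordA (g x) = (0 :: 'k vec3) \<and> coordB (g x) = (0 :: 'k vec3) \<and> coordW (g x) = (0 :: 'k vec3)}"
        using ker subgroup.mem_carrier[OF sub] by blast
    qed (simp_all add: gm coord_mult)
    then show ?thesis by blast
  qed
  assume "\<exists>A B W :: 'g \<Rightarrow> 'k vec3. desc_coords K A B W"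
  then obtain A B W :: "'g \<Rightarrow> 'k vec3" where D: "desc_coords K A B W" by blast
  define g where "g x = gp_elem (A x) (B x) (W x)" for x
  have hom: "g \<in> hom K (Gp CARD('k))"
    by (rule homI) (simp_all add: g_def gp_elem_carrier gp_elem_mult desc_coords_mult[OF D])
  interpret g: group_hom K "Gp CARD('k)" g by unfold_locales (rule hom)
  have "g ` carrier K = carrier (Gp CARD('k))"
  proof
    show "carrier (Gp CARD('k)) \<subseteq> g ` carrier K"
    proof
      fix h assume h: "h \<in> carrier (Gp CARD('k))"
      obtain x where "x \<in> carrier K" "A x = coordA h" "B x = coordB h" "W x = coordW h"
        using D by (rule desc_coords_onto)
      then have "g x = h" using gp_elem_coord[OF h] by (simp add: g_def)
      then show "h \<in> g ` carrier K" using \<open>x \<in> carrier K\<close> by blast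
    qed
  qed auto
  moreover have "kernel K (Gp CARD('k)) g = ?N"
  proof -
    have "g x = \<one>\<^bsub>Gp CARD('k)\<^esub> \<longleftrightarrow> A x = 0 \<and> B x = 0 \<and> W x = 0" for x
      unfolding one_Gp g_def gp_elem_inject ..
    then show ?thesis unfolding kernel_def desc_coords_kernel[OF D] by simp
  qed
  ultimately show "K Mod ?N \<cong> Gp CARD('k)" using g.FactGroup_iso by simp
qed

text \<open>A nontrivial element killed by a prime has that prime as its order, so no smaller
  positive exponent can work for the whole group.\<close>

lemma has_exponent_prime_iff:
  fixes G (structure)
  assumes "group G" "Factorial_Ring.prime p" "x \<in> carrier G" "x \<noteq> \<one>\<^bsub>G\<^esub>"
  shows "has_exponent G p \<longleftrightarrow> (\<forall>y\<in>carrier G. y [^]\<^bsub>G\<^esub> p = \<one>\<^bsub>G\<^esub>)"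
proof
  interpret group G by fact
  let ?P = "\<lambda>n::nat. n > 0 \<and> (\<forall>y\<in>carrier G. y [^] n = \<one>)"
  show "has_exponent G p \<Longrightarrow> \<forall>y\<in>carrier G. y [^] p = \<one>"
  proof -
    assume e: "has_exponent G p"
    obtain n where "?P n" using e unfolding has_exponent_def by (elim conjE exE) (rule that, rule conjI)
    then have "?P (LEAST n. ?P n)" by (rule LeastI)
    then have "?P p" by (rule ssubst[where P = ?P, OF e[unfolded has_exponent_def, THEN conjunct1]])
    then show ?thesis by (rule conjunct2)
  qed
  assume all: "\<forall>y\<in>carrier G. y [^] p = \<one>"
  have "ord x = p"
  proof -
    have "ord x dvd p" using all assms(3) by (simp add: pow_eq_id)
    moreover have "ord x \<noteq> 1" using assms(3,4) ord_eq_1 by auto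
    ultimately show ?thesis using assms(2) by (metis prime_nat_iff)
  qed
  have "(LEAST n. ?P n) = p"
  proof (rule Least_equality)
    show "?P p" using all assms(2) prime_gt_0_nat by simp
    fix n assume "?P n"
    then have "p dvd n" using assms(3) pow_eq_id[of x n] \<open>ord x = p\<close> by auto
    then show "p \<le> n" using \<open>?P n\<close> dvd_imp_le by blast
  qed
  then show "has_exponent G p" unfolding has_exponent_def using all assms(2) prime_gt_0_nat by metis
qed

text \<open>The condition counted by \<open>Dp\<close>, for an arbitrary type of elements, so that
  it also applies to the model groups.\<close>

definition is_desc :: "nat \<Rightarrow> ('g, 'm) monoid_scheme \<Rightarrow> bool" where
  "is_desc p K \<longleftrightarrow> immediate_descendant_Gp p K \<and> Coset.order K = p ^ 10 \<and> has_exponent K p"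

lemma is_desc_iff:
  fixes K :: "('g, 'm) monoid_scheme"
  assumes K: "group K"
  shows "is_desc CARD('k::prime_field) K \<longleftrightarrow> Coset.order K = CARD('k) ^ 10 \<and>
     lower_central K (Suc 3) = {\<one>\<^bsub>K\<^esub>} \<and> lower_central K 3 \<noteq> {\<one>\<^bsub>K\<^esub>} \<and>
     (\<exists>A B W :: 'g \<Rightarrow> 'k vec3. desc_coords K A B W) \<and> (\<forall>x\<in>carrier K. x [^]\<^bsub>K\<^esub> CARD('k) = \<one>\<^bsub>K\<^esub>)"
proof (cases "Coset.order K = CARD('k) ^ 10 \<and> lower_central K (Suc 3) = {\<one>\<^bsub>K\<^esub>} \<and> lower_central K 3 \<noteq> {\<one>\<^bsub>K\<^esub>}")
  case True
  interpret group K by fact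
  have "\<one>\<^bsub>K\<^esub> \<in> lower_central K 3" using lower_central_subgroup[OF K] by (rule subgroup.one_closed)
  then obtain x where "x \<in> lower_central K 3" "x \<noteq> \<one>\<^bsub>K\<^esub>" using True by blast
  then have "has_exponent K CARD('k) \<longleftrightarrow> (\<forall>x\<in>carrier K. x [^]\<^bsub>K\<^esub> CARD('k) = \<one>\<^bsub>K\<^esub>)"
    using has_exponent_prime_iff[OF K prime_CARD, of x] lower_central_subset[OF K] by blast
  moreover have "finite (carrier K)"
    using True by (intro card_ge_0_finite) (simp add: Coset.order_def)
  ultimately show ?thesis using True Mod_iso_Gp_iff[OF K, where 'k = 'k] K
    by (auto simp: is_desc_def immediate_descendant_Gp_def nilpotent_class_exactly_def)
qed (auto simp: is_desc_def immediate_descendant_Gp_def nilpotent_class_exactly_def)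

lemma is_desc_iso:
  fixes K :: "('g, 'm) monoid_scheme" and L :: "('h, 'n) monoid_scheme"
  assumes K: "group K" and L: "group L" and "K \<cong> L" and D: "is_desc CARD('k::prime_field) K"
  shows "is_desc CARD('k) L"
proof -
  interpret K: group K by fact
  interpret L: group L by fact
  obtain h where h: "h \<in> iso K L" using assms(3) by (auto simp: is_iso_def)
  interpret h: group_hom K L h using h by unfold_locales (simp add: iso_def)
  have bij: "bij_betw h (carrier K) (carrier L)" using h by (simp add: iso_def)
  let ?g = "inv_into (carrier K) h"
  have g: "?g \<in> iso L K" using h by (simp add: K.iso_set_sym)
  then have gm: "?g (x \<otimes>\<^bsub>L\<^esub> y) = ?g x \<otimes>\<^bsub>K\<^esub> ?g y" if "x \<in> carrier L" "y \<in> carrier L" for x y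
    using that by (simp add: iso_def hom_def)
  have gc: "?g x \<in> carrier K" if "x \<in> carrier L" for x
    using g that by (auto simp: iso_def hom_def)
  have gh: "?g (h x) = x" if "x \<in> carrier K" for x using bij that by (simp add: bij_betw_inv_into_left)
  have hg: "h (?g x) = x" if "x \<in> carrier L" for x using bij that by (simp add: bij_betw_inv_into_right)
  note lc = lower_central_iso[OF K L h]
  have sub: "lower_central K n \<subseteq> carrier K" for n by (rule lower_central_subset[OF K])
  obtain A B W :: "'g \<Rightarrow> 'k vec3" where d: "desc_coords K A B W" using D is_desc_iff[OF K, where 'k = 'k] by blast
  have "desc_coords L (A \<circ> ?g) (B \<circ> ?g) (W \<circ> ?g)"
    unfolding desc_coords_def
  proof (intro conjI ballI allI)
    fix a b w :: "'k vec3"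
    obtain x where "x \<in> carrier K" "A x = a" "B x = b" "W x = w" using d by (rule desc_coords_onto)
    then show "\<exists>x\<in>carrier L. (A \<circ> ?g) x = a \<and> (B \<circ> ?g) x = b \<and> (W \<circ> ?g) x = w"
      by (intro bexI[of _ "h x"]) (auto simp: gh)
  next
    show "lower_central L 3 = {x \<in> carrier L. (A \<circ> ?g) x = 0 \<and> (B \<circ> ?g) x = 0 \<and> (W \<circ> ?g) x = 0}"
      (is "_ = ?R")
    proof -
      have l3: "lower_central K 3 = {x \<in> carrier K. A x = 0 \<and> B x = 0 \<and> W x = 0}"
        by (rule desc_coords_kernel[OF d])
      have "y \<in> ?R" if "y \<in> h ` lower_central K 3" for y using that l3 gh by auto
      moreover have "y \<in> h ` lower_central K 3" if "y \<in> ?R" for y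
      proof (rule image_eqI)
        show "y = h (?g y)" "?g y \<in> lower_central K 3" using that by (auto simp: hg l3 gc)
      qed
      ultimately show ?thesis unfolding lc by blast
    qed
  qed (simp_all add: desc_coords_mult[OF d] gm gc)
  moreover have "Coset.order L = CARD('k) ^ 10"
    using D is_desc_iff[OF K, where 'k = 'k] bij_betw_same_card[OF bij] by (simp add: Coset.order_def)
  moreover have "lower_central L (Suc 3) = {\<one>\<^bsub>L\<^esub>}"
    using D is_desc_iff[OF K, where 'k = 'k] unfolding lc by simp
  moreover have "lower_central L 3 \<noteq> {\<one>\<^bsub>L\<^esub>}"
  proof
    assume "lower_central L 3 = {\<one>\<^bsub>L\<^esub>}"
    then have "?g ` h ` lower_central K 3 = ?g ` {h \<one>\<^bsub>K\<^esub>}" unfolding lc by simp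
    moreover have "?g ` h ` lower_central K 3 = lower_central K 3"
    proof -
      have "?g ` h ` lower_central K 3 = (\<lambda>x. x) ` lower_central K 3"
        unfolding image_image using sub[of 3] gh by (intro image_cong) auto
      then show ?thesis by simp
    qed
    ultimately show False using D is_desc_iff[OF K, where 'k = 'k] gh[OF K.one_closed] by simp
  qed
  moreover have "\<forall>x\<in>carrier L. x [^]\<^bsub>L\<^esub> CARD('k) = \<one>\<^bsub>L\<^esub>"
  proof
    fix x assume x: "x \<in> carrier L"
    have "x [^]\<^bsub>L\<^esub> CARD('k) = h (?g x [^]\<^bsub>K\<^esub> CARD('k))" using x gc hg by (simp add: h.hom_nat_pow)
    then show "x [^]\<^bsub>L\<^esub> CARD('k) = \<one>\<^bsub>L\<^esub>" using D is_desc_iff[OF K, where 'k = 'k] gc[OF x] by simp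
  qed
  ultimately show ?thesis using is_desc_iff[OF L] by blast
qed

text \<open>Brings the model groups into the type over which isomorphism classes are
  counted.\<close>

lemma nat_copy:
  fixes G :: "('g, 'm) monoid_scheme" (structure)
  assumes "group G" "finite (carrier G)"
  obtains L :: "nat monoid" where "group L" "G \<cong> L"
proof -
  interpret group G by fact
  obtain f :: "'g \<Rightarrow> nat" where f: "inj_on f (carrier G)"
    using assms(2) finite_imp_inj_to_nat_seg by metis
  let ?g = "inv_into (carrier G) f"
  \<comment> \<open>\<open>H\<close> need not be a group, as its product is arbitrary outside the
    image of \<open>f\<close>. Only the restriction to that image is used.\<close>
  define H :: "nat monoid" where "H = \<lparr>carrier = UNIV, monoid.mult = (\<lambda>x y. f (?g x \<otimes> ?g y)), one = f \<one>\<rparr>"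
  have hom: "f \<in> hom G H" using f by (simp add: hom_def H_def)
  let ?L = "H\<lparr>carrier := f ` carrier G, one := f \<one>\<rparr>"
  have "group ?L" by (rule hom_imp_img_group[OF hom])
  moreover have "f \<in> iso G ?L" using f by (auto simp: iso_def hom_def H_def bij_betw_def)
  ultimately show ?thesis using that by (auto simp: is_iso_def)
qed

text \<open>With the commutator as a correction factor in \<open>x y = y x c\<close>, its
  coordinates follow by comparing both sides, and no inverse has to be computed.\<close>

lemma (in group) commutator_mult:
  assumes "x \<in> carrier G" "y \<in> carrier G"
  shows "y \<otimes> x \<otimes> (inv x \<otimes> inv y \<otimes> x \<otimes> y) = x \<otimes> y"
proof -
  have "x \<otimes> (inv x \<otimes> (inv y \<otimes> (x \<otimes> y))) = inv y \<otimes> (x \<otimes> y)"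
    and "y \<otimes> (inv y \<otimes> (x \<otimes> y)) = x \<otimes> y"
    using assms by (simp_all flip: m_assoc)
  then show ?thesis using assms by (simp add: m_assoc)
qed

lemma desc_coords_one:
  assumes "group K" "desc_coords K A B W"
  shows "A \<one>\<^bsub>K\<^esub> = 0" "B \<one>\<^bsub>K\<^esub> = 0" "W \<one>\<^bsub>K\<^esub> = 0"
proof -
  interpret group K by fact
  note m = desc_coords_mult[OF assms(2) one_closed one_closed, unfolded l_one[OF one_closed]]
  show "A \<one>\<^bsub>K\<^esub> = 0" "B \<one>\<^bsub>K\<^esub> = 0" using m by simp_all
  then show "W \<one>\<^bsub>K\<^esub> = 0" using m(3) by simp
qed

lemma desc_coords_inv:
  assumes "group K" "desc_coords K A B W" "x \<in> carrier K"
  shows "A (inv\<^bsub>K\<^esub> x) = - A x" "B (inv\<^bsub>K\<^esub> x) = - B x" "W (inv\<^bsub>K\<^esub> x) = phi (A x) (B x) - W x"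
proof -
  interpret group K by fact
  note m = desc_coords_mult[OF assms(2) assms(3) inv_closed[OF assms(3)], unfolded r_inv[OF assms(3)]
      desc_coords_one[OF assms(1,2)]]
  show A: "A (inv\<^bsub>K\<^esub> x) = - A x" and B: "B (inv\<^bsub>K\<^esub> x) = - B x" using m by (simp_all add: eq_neg_iff_add_eq_0 add.commute)
  show "W (inv\<^bsub>K\<^esub> x) = phi (A x) (B x) - W x"
    using m(3) by (simp add: B phi_uminus algebra_simps eq_neg_iff_add_eq_0)
qed

lemma desc_coords_commutator:
  assumes "group K" "desc_coords K A B W" "x \<in> carrier K" "y \<in> carrier K"
  defines "c \<equiv> inv\<^bsub>K\<^esub> x \<otimes>\<^bsub>K\<^esub> inv\<^bsub>K\<^esub> y \<otimes>\<^bsub>K\<^esub> x \<otimes>\<^bsub>K\<^esub> y"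
  shows "A c = 0" "B c = 0" "W c = phi (A x) (B y) - phi (A y) (B x)"
proof -
  interpret group K by fact
  have c: "c \<in> carrier K" using assms by simp
  have e: "y \<otimes>\<^bsub>K\<^esub> x \<otimes>\<^bsub>K\<^esub> c = x \<otimes>\<^bsub>K\<^esub> y" unfolding c_def by (rule commutator_mult) fact+
  note m = desc_coords_mult[OF assms(2)]
  show A: "A c = 0" using arg_cong[OF e, of A] assms(3,4) c by (simp add: m)
  show B: "B c = 0" using arg_cong[OF e, of B] assms(3,4) c by (simp add: m)
  have "W y + W x + phi (A y) (B x) + W c = W x + W y + phi (A x) (B y)"
    using arg_cong[OF e, of W] assms(3,4) c by (simp add: m B)
  then show "W c = phi (A x) (B y) - phi (A y) (B x)" by (simp add: algebra_simps)
qed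

lemma lower_central_2_subgroup:
  assumes "group G" shows "subgroup (lower_central G 2) G"
proof -
  interpret group G by fact
  have "{inv\<^bsub>G\<^esub> x \<otimes>\<^bsub>G\<^esub> inv\<^bsub>G\<^esub> y \<otimes>\<^bsub>G\<^esub> x \<otimes>\<^bsub>G\<^esub> y |x y. x \<in> carrier G \<and> y \<in> carrier G} \<subseteq> carrier G"
    by auto
  then show ?thesis
    unfolding lower_central_Suc3(3) commutator_subgroup_def by (rule generate_is_subgroup)
qed

text \<open>Commutators have no \<open>A\<close> and \<open>B\<close> part. Conversely
  \<open>phi e1\<close> is invertible, so a single commutator realizes any prescribed
  \<open>W\<close> part, and what is left over lies in the third term.\<close>

lemma lower_central_2:
  assumes K: "group K" and D: "desc_coords K A B W"
  shows "lower_central K 2 = {x \<in> carrier K. A x = 0 \<and> B x = 0}" (is "_ = ?N")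
proof -
  interpret group K by fact
  have sub: "subgroup ?N K"
    by unfold_locales (auto simp: desc_coords_mult[OF D] desc_coords_one[OF K D] desc_coords_inv[OF K D])
  have sub2: "subgroup (lower_central K 2) K" by (rule lower_central_2_subgroup[OF K])
  show ?thesis
  proof
    show "lower_central K 2 \<subseteq> ?N"
      unfolding lower_central_Suc3 commutator_subgroup_def
      by (rule generate_subgroup_incl[OF _ sub]) (auto simp: desc_coords_commutator[OF K D])
    have "lower_central K 3 \<subseteq> lower_central K 2"
      unfolding lower_central_Suc3(2) commutator_subgroup_def
    proof (rule generate_subgroup_incl[OF _ sub2], safe)
      fix x y assume "x \<in> lower_central K 2" "y \<in> carrier K"
      then show "inv\<^bsub>K\<^esub> x \<otimes>\<^bsub>K\<^esub> inv\<^bsub>K\<^esub> y \<otimes>\<^bsub>K\<^esub> x \<otimes>\<^bsub>K\<^esub> y \<in> lower_central K 2"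
        unfolding lower_central_Suc3(3) commutator_subgroup_def
        using lower_central_subset[OF K, of 2, unfolded lower_central_Suc3(3) commutator_subgroup_def]
        by (intro generate.incl) blast
    qed
    show "?N \<subseteq> lower_central K 2"
    proof
      fix x assume x: "x \<in> ?N"
      obtain w1 w2 w3 where w: "W x = Vec w1 w2 w3" by (cases "W x")
      obtain k where k: "k \<in> carrier K" "A k = e1" "B k = 0" "W k = 0" by (rule desc_coords_onto[OF D])
      \<comment> \<open>\<open>phi e1\<close> exchanges the first two coordinates, whence the order
        \<open>w2, w1, w3\<close>.\<close>
      obtain y where y: "y \<in> carrier K" "A y = 0" "B y = Vec w2 w1 w3" "W y = 0" by (rule desc_coords_onto[OF D])
      define c where "c = inv\<^bsub>K\<^esub> k \<otimes>\<^bsub>K\<^esub> inv\<^bsub>K\<^esub> y \<otimes>\<^bsub>K\<^esub> k \<otimes>\<^bsub>K\<^esub> y"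
      have c: "c \<in> lower_central K 2"
        unfolding lower_central_Suc3(3) commutator_subgroup_def c_def using k(1) y(1) by (intro generate.incl) blast
      have cc: "c \<in> carrier K" using k y by (simp add: c_def)
      have co: "A c = 0" "B c = 0" "W c = W x"
        using desc_coords_commutator[OF K D k(1) y(1), folded c_def] k y by (simp_all add: w)
      have xc: "x \<otimes>\<^bsub>K\<^esub> inv\<^bsub>K\<^esub> c \<in> lower_central K 3"
        unfolding desc_coords_kernel[OF D] using x cc co
        by (simp add: desc_coords_mult[OF D] desc_coords_inv[OF K D])
      then have "x \<otimes>\<^bsub>K\<^esub> inv\<^bsub>K\<^esub> c \<otimes>\<^bsub>K\<^esub> c \<in> lower_central K 2"
        using \<open>lower_central K 3 \<subseteq> lower_central K 2\<close> c subgroup.m_closed[OF sub2] by blast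
      then show "x \<in> lower_central K 2" using x cc by (simp add: m_assoc)
    qed
  qed
qed

section \<open>The model groups\<close>

datatype 'k elt = Elt (pA: "'k vec3") (pB: "'k vec3") (pW: "'k vec3") (pZ: 'k)

text \<open>The semidirect product of the class two group on the triples \<open>(b, w, z)\<close> with cocycle
  \<open>det3 v b b' / 2\<close> by the vector group of the \<open>a\<close>, where \<open>a\<close> acts as the exponential of its
  adjoint map.\<close>

definition desc_group :: "'k::prime_field vec3 \<Rightarrow> 'k elt monoid" where
  "desc_group v = \<lparr>carrier = UNIV,
     monoid.mult = (\<lambda>x y. Elt (pA x + pA y) (pB x + pB y) (pW x + pW y + phi (pA x) (pB y))
        (pZ x + pZ y + dot (pW y) (pA x) + (tri (pA x) (pA x) (pB y) + det3 v (pB x) (pB y)) / 2)),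
     one = Elt 0 0 0 0\<rparr>"

lemma carrier_desc_group [simp]: "carrier (desc_group v) = UNIV"
  by (simp add: desc_group_def)

lemma one_desc_group: "\<one>\<^bsub>desc_group v\<^esub> = Elt 0 0 0 0"
  by (simp add: desc_group_def)

lemma mult_desc_group: "x \<otimes>\<^bsub>desc_group v\<^esub> y =
   Elt (pA x + pA y) (pB x + pB y) (pW x + pW y + phi (pA x) (pB y))
        (pZ x + pZ y + dot (pW y) (pA x) + (tri (pA x) (pA x) (pB y) + det3 v (pB x) (pB y)) / 2)"
  by (simp add: desc_group_def)

lemma tri_square_add: "tri (a + a') (a + a') b = tri a a b + 2 * tri a a' b + tri a' a' b"
  using tri_commute(1)[of a' a b] by (simp add: tri_add)

lemma dot_phi: "dot (phi a b) c = tri c a b"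
  using tri_commute(1)[of c a b] tri_commute(2)[of a c b] by (simp add: tri_def)

lemma group_desc_group: "group (desc_group v)"
proof (rule groupI)
  fix x y z :: "'a elt"
  show "x \<otimes>\<^bsub>desc_group v\<^esub> y \<otimes>\<^bsub>desc_group v\<^esub> z = x \<otimes>\<^bsub>desc_group v\<^esub> (y \<otimes>\<^bsub>desc_group v\<^esub> z)"
    by (simp add: mult_desc_group phi_add_left phi_add_right dot_add_left dot_add_right tri_square_add
        tri_add(3) det3_add dot_phi add_divide_distrib algebra_simps)
  show "\<one>\<^bsub>desc_group v\<^esub> \<otimes>\<^bsub>desc_group v\<^esub> x = x"
    by (simp add: mult_desc_group one_desc_group)
  \<comment> \<open>The last entry is the negative of everything else in the last coordinate of the
    product, so that it cancels by construction.\<close>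
  let ?y = "Elt (- pA x) (- pB x) (phi (pA x) (pB x) - pW x) (- (pZ x + dot (pW x) (- pA x) +
     (tri (- pA x) (- pA x) (pB x) + det3 v (- pB x) (pB x)) / 2))"
  have "?y \<otimes>\<^bsub>desc_group v\<^esub> x = \<one>\<^bsub>desc_group v\<^esub>"
    by (simp add: mult_desc_group one_desc_group phi_uminus)
  then show "\<exists>y\<in>carrier (desc_group v). y \<otimes>\<^bsub>desc_group v\<^esub> x = \<one>\<^bsub>desc_group v\<^esub>" by force
qed simp_all

lemma bij_Elt: "bij (\<lambda>(a, b, w, z). Elt a b w z)"
  by (rule bijI') (auto split: prod.splits, metis elt.exhaust)

lemma CARD_elt: "CARD('k::finite elt) = CARD('k) ^ 10"
  using bij_betw_same_card[OF bij_Elt[where 'a = 'k]] by (simp add: CARD_vec3 eval_nat_numeral ac_simps)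

lemma finite_elt: "finite (UNIV :: 'k::finite elt set)"
  by (rule card_ge_0_finite) (simp add: CARD_elt)

text \<open>These two sums are the coefficients in the power formula. They vanish modulo
  \<open>p\<close> because \<open>2\<close> and \<open>6\<close> are invertible there, which gives
  the model groups exponent \<open>p\<close>.\<close>

lemma sum_ids: "2 * (\<Sum>k<n. k) + n = n * (n::nat)" "6 * (\<Sum>k<n. k * k) + 3 * (n * n) = 2 * (n * n * n) + (n::nat)"
  by (induction n) (simp_all add: algebra_simps)

lemma desc_group_pow:
  "x [^]\<^bsub>desc_group v\<^esub> n = Elt (smul (of_nat n) (pA x)) (smul (of_nat n) (pB x))
     (smul (of_nat n) (pW x) + smul (of_nat (\<Sum>k<n. k)) (phi (pA x) (pB x)))
     (of_nat n * pZ x + of_nat (\<Sum>k<n. k) * dot (pW x) (pA x) + of_nat (\<Sum>k<n. k * k) * tri (pA x) (pA x) (pB x) / 2)"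
proof (induction n)
  case 0
  then show ?case by (simp add: one_desc_group)
next
  case (Suc n)
  then show ?case
    by (simp add: mult_desc_group smul_add_left phi_smul dot_smul tri_smul det3_smul algebra_simps add_divide_distrib)
qed

lemma desc_group_pow_CARD:
  fixes x :: "'k::prime_field elt"
  shows "x [^]\<^bsub>desc_group v\<^esub> CARD('k) = \<one>\<^bsub>desc_group v\<^esub>"
proof -
  let ?p = "CARD('k)"
  have "2 * (of_nat (\<Sum>k<?p. k) :: 'k) = 0"
    using arg_cong[OF sum_ids(1)[of ?p], of "of_nat :: nat \<Rightarrow> 'k"] by (simp only: of_nat_add of_nat_mult of_nat_CARD) simp
  then have s1: "(of_nat (\<Sum>k<?p. k) :: 'k) = 0" by (simp only: mult_eq_0_iff two_neq_0 simp_thms)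
  have "2 * 3 * (of_nat (\<Sum>k<?p. k * k) :: 'k) = 0"
    using arg_cong[OF sum_ids(2)[of ?p], of "of_nat :: nat \<Rightarrow> 'k"] by (simp only: of_nat_add of_nat_mult of_nat_CARD) simp
  then have s2: "(of_nat (\<Sum>k<?p. k * k) :: 'k) = 0" by (simp only: mult_eq_0_iff two_neq_0 three_neq_0 simp_thms)
  show ?thesis unfolding desc_group_pow s1 s2 of_nat_CARD by (simp add: one_desc_group)
qed

lemma pZ_commutator:
  fixes x y :: "'k::prime_field elt" and v :: "'k vec3"
  assumes "pA x = 0" "pB x = 0"
  defines "c \<equiv> inv\<^bsub>desc_group v\<^esub> x \<otimes>\<^bsub>desc_group v\<^esub> inv\<^bsub>desc_group v\<^esub> y \<otimes>\<^bsub>desc_group v\<^esub> x \<otimes>\<^bsub>desc_group v\<^esub> y"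
  shows "c = Elt 0 0 0 (- dot (pW x) (pA y))"
proof -
  interpret group "desc_group v" by (rule group_desc_group)
  have "y \<otimes>\<^bsub>desc_group v\<^esub> x \<otimes>\<^bsub>desc_group v\<^esub> c = x \<otimes>\<^bsub>desc_group v\<^esub> y"
    unfolding c_def by (rule commutator_mult) simp_all
  also have "\<dots> = y \<otimes>\<^bsub>desc_group v\<^esub> x \<otimes>\<^bsub>desc_group v\<^esub> Elt 0 0 0 (- dot (pW x) (pA y))"
    by (simp add: mult_desc_group assms(1,2))
  finally show ?thesis by (simp only: l_cancel carrier_desc_group UNIV_I)
qed

lemma desc_group_class:
  fixes v :: "'k::prime_field vec3"
  shows "lower_central (desc_group v) 3 = {x. pA x = 0 \<and> pB x = 0 \<and> pW x = 0}" (is ?A)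
    and "lower_central (desc_group v) (Suc 3) = {\<one>\<^bsub>desc_group v\<^esub>}" (is ?B)
proof -
  let ?K = "desc_group v"
  interpret group ?K by (rule group_desc_group)
  let ?c = "\<lambda>x y. inv\<^bsub>?K\<^esub> x \<otimes>\<^bsub>?K\<^esub> inv\<^bsub>?K\<^esub> y \<otimes>\<^bsub>?K\<^esub> x \<otimes>\<^bsub>?K\<^esub> y"
  have inv: "inv\<^bsub>?K\<^esub> x = Elt (- pA x) (- pB x) (phi (pA x) (pB x) - pW x) (pZ (inv\<^bsub>?K\<^esub> x))" for x
  proof -
    have e: "x \<otimes>\<^bsub>?K\<^esub> inv\<^bsub>?K\<^esub> x = Elt 0 0 0 0" using r_inv[of x] by (simp add: one_desc_group)
    obtain a b w z where y: "inv\<^bsub>?K\<^esub> x = Elt a b w z" by (cases "inv\<^bsub>?K\<^esub> x")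
    have "a = - pA x" "b = - pB x" using e unfolding mult_desc_group y by (simp_all add: eq_neg_iff_add_eq_0 add.commute)
    moreover have "w = phi (pA x) (pB x) - pW x"
      using e unfolding mult_desc_group y \<open>b = - pB x\<close> by (simp add: phi_uminus algebra_simps eq_neg_iff_add_eq_0)
    ultimately show ?thesis by (simp add: y)
  qed
  have sel: "pA (inv\<^bsub>?K\<^esub> x) = - pA x" "pB (inv\<^bsub>?K\<^esub> x) = - pB x" "pW (inv\<^bsub>?K\<^esub> x) = phi (pA x) (pB x) - pW x" for x
    by (subst inv, simp)+
  have sub2: "subgroup {x. pA x = 0 \<and> pB x = 0} ?K"
    by unfold_locales (auto simp: mult_desc_group one_desc_group sel)
  have "lower_central ?K 2 \<subseteq> {x. pA x = 0 \<and> pB x = 0}"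
    unfolding lower_central_Suc3 commutator_subgroup_def
    by (rule generate_subgroup_incl[OF _ sub2]) (auto simp: mult_desc_group sel)
  then have c2: "?c x y = Elt 0 0 0 (- dot (pW x) (pA y))" if "x \<in> lower_central ?K 2" for x y
    using pZ_commutator that by blast
  have sub3: "subgroup {x. pA x = 0 \<and> pB x = 0 \<and> pW x = 0} ?K"
    by unfold_locales (auto simp: mult_desc_group one_desc_group sel)
  show A: ?A
  proof
    show "lower_central ?K 3 \<subseteq> {x. pA x = 0 \<and> pB x = 0 \<and> pW x = 0}"
      unfolding lower_central_Suc3(2) commutator_subgroup_def
      by (rule generate_subgroup_incl[OF _ sub3]) (auto simp: c2)
    show "{x. pA x = 0 \<and> pB x = 0 \<and> pW x = 0} \<subseteq> lower_central ?K 3"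
    proof
      fix x :: "'k elt" assume "x \<in> {x. pA x = 0 \<and> pB x = 0 \<and> pW x = 0}"
      then obtain z where x: "x = Elt 0 0 0 z" by (cases x) auto
      \<comment> \<open>Since \<open>phi e1 e1 = e2\<close>, this commutator has \<open>W\<close>
        part \<open>e2\<close>, and commuting it with multiples of \<open>e2\<close> in the first
        space fills the centre.\<close>
      define n where "n = ?c (Elt e1 0 0 0) (Elt 0 e1 0 0)"
      have n: "n \<in> lower_central ?K 2"
        unfolding lower_central_Suc3 commutator_subgroup_def n_def by (intro generate.incl) auto
      have "pW n = e2" unfolding n_def by (simp add: mult_desc_group sel zero_vec3_def)
      then have "?c n (Elt (Vec 0 (- z) 0) 0 0 0) = x" by (simp add: c2[OF n] x)
      moreover have "?c n (Elt (Vec 0 (- z) 0) 0 0 0) \<in> lower_central ?K 3"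
        unfolding lower_central_Suc3(2) commutator_subgroup_def using n by (intro generate.incl) auto
      ultimately show "x \<in> lower_central ?K 3" by simp
    qed
  qed
  show ?B
  proof
    show "lower_central ?K (Suc 3) \<subseteq> {\<one>\<^bsub>?K\<^esub>}"
      unfolding lower_central_Suc3(1) commutator_subgroup_def
      by (rule generate_subgroup_incl[OF _ triv_subgroup]) (auto simp: A pZ_commutator one_desc_group)
    show "{\<one>\<^bsub>?K\<^esub>} \<subseteq> lower_central ?K (Suc 3)"
      unfolding lower_central_Suc3(1) commutator_subgroup_def using generate.one by auto
  qed
qed

lemma desc_coords_desc_group: "desc_coords (desc_group v) pA pB pW"
  unfolding desc_coords_def desc_group_class(1)
proof (intro conjI ballI allI)
  fix a b w :: "'a vec3"
  show "\<exists>x\<in>carrier (desc_group v). pA x = a \<and> pB x = b \<and> pW x = w"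
    by (intro bexI[of _ "Elt a b w 0"]) simp_all
qed (simp_all add: mult_desc_group)

lemma is_desc_desc_group: "is_desc CARD('k::prime_field) (desc_group (v :: 'k vec3))"
  unfolding is_desc_iff[OF group_desc_group]
proof (intro conjI)
  show "Coset.order (desc_group v) = CARD('k) ^ 10"
    by (simp add: Coset.order_def CARD_elt)
  have "Elt 0 0 0 1 \<in> lower_central (desc_group v) 3" unfolding desc_group_class by simp
  then show "lower_central (desc_group v) 3 \<noteq> {\<one>\<^bsub>desc_group v\<^esub>}" by (auto simp: one_desc_group)
  show "\<exists>A B W :: 'k elt \<Rightarrow> 'k vec3. desc_coords (desc_group v) A B W" using desc_coords_desc_group by blast
qed (simp_all only: desc_group_pow_CARD desc_group_class ball_simps carrier_desc_group simp_thms)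

section \<open>Isomorphisms between model groups\<close>

text \<open>An isomorphism preserves the lower central terms and the centralizer of the second one,
  so it induces maps \<open>R\<close>, \<open>P\<close>, \<open>S\<close>, \<open>t\<close> on the
  four coordinates. Comparing commutators gives
  \<open>tri (R a) (P b) (R c) = t 1 * tri a b c\<close>. Hence \<open>P\<close> is a multiple of
  \<open>R\<close>, \<open>R\<close> is a similarity, and the commutators of elements with zero
  \<open>A\<close> part relate \<open>v'\<close> to \<open>v\<close>.\<close>

lemma desc_group_iso_imp_orbit:
  fixes v v' :: "'k::prime_field vec3"
  assumes "desc_group v \<cong> desc_group v'"
  shows "\<exists>R\<in>cubic_group. v' = R v"
proof -
  let ?K = "desc_group v" and ?L = "desc_group v'"
  interpret K: group ?K by (rule group_desc_group)
  interpret L: group ?L by (rule group_desc_group)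
  obtain f where f: "f \<in> Group.iso ?K ?L" using assms unfolding Group.is_iso_def by blast
  have fm: "f (x \<otimes>\<^bsub>?K\<^esub> y) = f x \<otimes>\<^bsub>?L\<^esub> f y" for x y using f by (simp add: iso_def hom_def)
  have bij: "bij f" using f by (simp add: iso_def)
  note lc = lower_central_iso[OF group_desc_group group_desc_group f]
  have N: "{x. pA x = 0 \<and> pB x = 0} = f ` {x. pA x = 0 \<and> pB x = 0}"
    using lc[of 2] unfolding lower_central_2[OF group_desc_group desc_coords_desc_group] by simp
  have Z: "{x. pA x = 0 \<and> pB x = 0 \<and> pW x = 0} = f ` {x. pA x = 0 \<and> pB x = 0 \<and> pW x = 0}"
    using lc[of 3] unfolding desc_group_class by simp
  have fN: "pA (f x) = 0" "pB (f x) = 0" if "pA x = 0" "pB x = 0" for x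
  proof -
    have "f x \<in> f ` {x. pA x = 0 \<and> pB x = 0}" using that by blast
    then show "pA (f x) = 0" "pB (f x) = 0" unfolding N[symmetric] by simp_all
  qed
  have fZ: "pW (f x) = 0" if "pA x = 0" "pB x = 0" "pW x = 0" for x
  proof -
    have "f x \<in> f ` {x. pA x = 0 \<and> pB x = 0 \<and> pW x = 0}" using that by blast
    then show "pW (f x) = 0" unfolding Z[symmetric] by simp
  qed
  \<comment> \<open>Commuting with the whole second term forces a zero \<open>A\<close> part,
    because \<open>dot\<close> is nondegenerate; the hypothesis gives this commuting and
    \<open>f\<close> carries it over.\<close>
  have fC: "pA (f x) = 0" if "pA x = 0" for x
  proof (rule dot_eqI)
    fix w :: "'k vec3"
    have "Elt 0 0 w 0 \<in> f ` {x. pA x = 0 \<and> pB x = 0}"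
      by (rule subsetD[OF equalityD1[OF N]]) simp
    then obtain n where n: "f n = Elt 0 0 w 0" "pA n = 0" "pB n = 0" by (auto dest: sym)
    have "x \<otimes>\<^bsub>?K\<^esub> n = n \<otimes>\<^bsub>?K\<^esub> x" using that n by (simp add: mult_desc_group add_ac)
    then have "f x \<otimes>\<^bsub>?L\<^esub> f n = f n \<otimes>\<^bsub>?L\<^esub> f x" by (simp flip: fm)
    then show "dot (pA (f x)) w = dot 0 w" by (simp add: n mult_desc_group dot_commute)
  qed
  define R where "R a = pA (f (Elt a 0 0 0))" for a
  define P where "P b = pB (f (Elt 0 b 0 0))" for b
  define S where "S w = pW (f (Elt 0 0 w 0))" for w
  define t where "t z = pZ (f (Elt 0 0 0 z))" for z
  have S: "pW (f (Elt 0 0 w z)) = S w" for w z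
  proof -
    have "f (Elt 0 0 w z) = f (Elt 0 0 w 0) \<otimes>\<^bsub>?L\<^esub> f (Elt 0 0 0 z)"
      unfolding fm[symmetric] by (simp add: mult_desc_group)
    then show ?thesis by (simp add: mult_desc_group fN fZ S_def)
  qed
  have P: "pB (f (Elt 0 b 0 z)) = P b" for b z
  proof -
    have "f (Elt 0 b 0 z) = f (Elt 0 b 0 0) \<otimes>\<^bsub>?L\<^esub> f (Elt 0 0 0 z)"
      unfolding fm[symmetric] by (simp add: mult_desc_group)
    then show ?thesis by (simp add: mult_desc_group fN fZ P_def)
  qed
  have addR: "additive R"
  proof
    fix a a'
    have "f (Elt (a + a') 0 0 0) = f (Elt a 0 0 0) \<otimes>\<^bsub>?L\<^esub> f (Elt a' 0 0 0)"
      unfolding fm[symmetric] by (simp add: mult_desc_group)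
    then show "R (a + a') = R a + R a'" by (simp add: R_def mult_desc_group)
  qed
  have addP: "additive P"
  proof
    fix b b'
    have "f (Elt 0 (b + b') 0 (det3 v b b' / 2)) = f (Elt 0 b 0 0) \<otimes>\<^bsub>?L\<^esub> f (Elt 0 b' 0 0)"
      unfolding fm[symmetric] by (simp add: mult_desc_group)
    then have "pB (f (Elt 0 (b + b') 0 (det3 v b b' / 2))) = P b + P b'" by (simp add: mult_desc_group P_def)
    then show "P (b + b') = P b + P b'" by (simp only: P)
  qed
  have addt: "additive t"
  proof
    fix z z'
    have "f (Elt 0 0 0 (z + z')) = f (Elt 0 0 0 z) \<otimes>\<^bsub>?L\<^esub> f (Elt 0 0 0 z')"
      unfolding fm[symmetric] by (simp add: mult_desc_group)
    then show "t (z + z') = t z + t z'" by (simp add: t_def mult_desc_group fN fZ)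
  qed
  note t_mult = additive_mult[OF addt]
  have one: "f (Elt 0 0 0 0) = Elt 0 0 0 0"
    using hom_one[OF _ group_desc_group group_desc_group, of f v v'] f by (simp add: iso_def one_desc_group)
  have t1: "t 1 \<noteq> 0"
  proof
    assume "t 1 = 0"
    have "f (Elt 0 0 0 1) = f (Elt 0 0 0 0)" unfolding one
      using \<open>t 1 = 0\<close> by (intro elt.expand) (simp add: fN fZ t_def)
    then show False using bij by (simp add: bij_is_inj inj_eq)
  qed
  have rel1: "phi (R a) (P b) = S (phi a b)" for a b
  proof -
    have "Elt a 0 0 0 \<otimes>\<^bsub>?K\<^esub> Elt 0 b 0 0 =
        Elt 0 0 (phi a b) (tri a a b / 2) \<otimes>\<^bsub>?K\<^esub> (Elt 0 b 0 0 \<otimes>\<^bsub>?K\<^esub> Elt a 0 0 0)"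
      by (simp add: mult_desc_group)
    from arg_cong[OF this, of "\<lambda>x. pW (f x)"] show ?thesis
      by (simp only: fm) (simp add: mult_desc_group fN fC S R_def P_def)
  qed
  have rel2: "dot (S w) (R a) = t (dot w a)" for w a
  proof -
    have "Elt a 0 0 0 \<otimes>\<^bsub>?K\<^esub> Elt 0 0 w 0 = Elt 0 0 0 (dot w a) \<otimes>\<^bsub>?K\<^esub> (Elt 0 0 w 0 \<otimes>\<^bsub>?K\<^esub> Elt a 0 0 0)"
      by (simp add: mult_desc_group)
    from arg_cong[OF this, of "\<lambda>x. pZ (f x)"] show ?thesis
      by (simp only: fm) (simp add: mult_desc_group fN fC fZ S R_def t_def)
  qed
  have rel3: "det3 v' (P b) (P b') = t (det3 v b b')" for b b'
  proof -
    have "Elt 0 b 0 0 \<otimes>\<^bsub>?K\<^esub> Elt 0 b' 0 0 = Elt 0 0 0 (det3 v b b') \<otimes>\<^bsub>?K\<^esub> (Elt 0 b' 0 0 \<otimes>\<^bsub>?K\<^esub> Elt 0 b 0 0)"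
      using det3_swap(1)[of v b' b] by (simp add: mult_desc_group add_ac)
    from arg_cong[OF this, of "\<lambda>x. pZ (f x)"] have
      "det3 v' (P b) (P b') / 2 = t (det3 v b b') + det3 v' (P b') (P b) / 2"
      by (simp only: fm) (simp add: mult_desc_group fN fC fZ P_def t_def)
    then show ?thesis using det3_swap(1)[of v' "P b'" "P b"] by (simp add: field_simps)
  qed
  have rel: "tri (R a) (P b) (R c) = t 1 * tri a b c" for a b c
    using rel2[of "phi a b" c] t_mult[of "dot (phi a b) c"] by (simp add: tri_def rel1 mult.commute)
  have inj: "inj R"
  proof (rule injI)
    fix x y assume "R x = R y"
    have "tri b a x = tri b a y" for a b
      using rel[of b a x] rel[of b a y] \<open>R x = R y\<close> t1 by simp
    then have "tri x a b = tri y a b" for a b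
      using tri_commute(1)[of x a b] tri_commute(1)[of y a b] tri_commute(2)[of a x b] tri_commute(2)[of a y b] by simp
    then show "x = y" by (rule tri_eqI)
  qed
  then have bijR: "bij R" by (simp add: bij_def finite_UNIV_inj_surj)
  let ?Q = "inv_into UNIV R"
  have RQ [simp]: "R (?Q x) = x" for x using bijR by (simp add: bij_is_surj surj_f_inv_f)
  have "additive (P \<circ> ?Q)"
    using addP additive_inv[OF addR bijR] by (simp add: additive_def)
  \<comment> \<open>The right side of \<open>rel\<close> is symmetric in \<open>a\<close> and
    \<open>b\<close>, so on the left \<open>P\<close> may be moved from one argument to the other.
    After substituting the inverse of \<open>R\<close>, this is self-adjointness.\<close>
  moreover have "tri ((P \<circ> ?Q) x) y z = tri x ((P \<circ> ?Q) y) z" for x y z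
    using rel[of "?Q x" "?Q y" "?Q z"] rel[of "?Q y" "?Q x" "?Q z"]
      tri_commute(1)[of "P (?Q x)" y z] tri_commute(1)[of "?Q x" "?Q y" "?Q z"] by simp
  ultimately obtain n where n: "\<And>x. (P \<circ> ?Q) x = smul n x" using self_adjoint_scalar by blast
  have PR: "P b = smul n (R b)" for b using n[of "R b"] bijR by (simp add: bij_is_inj)
  have relR: "n * tri (R a) (R b) (R c) = t 1 * tri a b c" for a b c
    using rel[of a b c] by (simp add: PR tri_smul)
  have n0: "n \<noteq> 0"
    using relR[of e1 e1 e2] t1 by (auto simp: tri_def)
  have RG: "R \<in> cubic_group"
  proof (rule cubic_groupI[OF addR])
    show "t 1 / n \<noteq> 0" using t1 n0 by simp
    show "tri (R x) (R y) (R z) = t 1 / n * tri x y z" for x y z using relR[of x y z] n0 by (simp add: field_simps)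
  qed
  obtain D where D: "D \<noteq> 0" "\<And>x y z. det3 (R x) (R y) (R z) = D * det3 x y z"
    using det3_additive[OF addR bij_is_surj[OF bijR]] by blast
  \<comment> \<open>An alternating form on three dimensions is \<open>det3\<close> with a unique
    vector. Pulling the form of \<open>v'\<close> back along \<open>P = n R\<close> costs
    \<open>n\<^sup>2\<close> and the determinant \<open>D\<close> of \<open>R\<close>. The remaining
    factor is absorbed, since scalars are similarities.\<close>
  have "smul (n * n * D) (?Q v') = smul (t 1) v"
  proof (rule det3_eqI)
    fix x y
    show "det3 (smul (n * n * D) (?Q v')) x y = det3 (smul (t 1) v) x y"
      using rel3[of x y] D(2)[of "?Q v'" x y] t_mult[of "det3 v x y"] by (simp add: PR det3_smul mult_ac)
  qed
  then have "smul (inverse (n * n * D)) (smul (n * n * D) (?Q v')) = smul (inverse (n * n * D)) (smul (t 1) v)" by simp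
  then have "?Q v' = smul (inverse (n * n * D) * t 1) v"
    unfolding smul_smul using n0 D(1) by (simp only: left_inverse mult_eq_0_iff de_Morgan_disj simp_thms smul_1)
  then have "v' = (R \<circ> smul (inverse (n * n * D) * t 1)) v" by (metis RQ comp_apply)
  moreover have "R \<circ> smul (inverse (n * n * D) * t 1) \<in> cubic_group"
    by (rule cubic_group_comp[OF RG cubic_group_smul]) (use n0 D(1) t1 in simp)
  ultimately show ?thesis by blast
qed

lemma orbit_imp_desc_group_iso:
  fixes v :: "'k::prime_field vec3"
  assumes R: "R \<in> cubic_group"
  shows "desc_group v \<cong> desc_group (R v)"
proof -
  obtain m where m: "m \<noteq> 0" "\<And>x y z. tri (R x) (R y) (R z) = m * tri x y z"
    using R by (auto simp: cubic_group_def)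
  have bij: "bij R" by (rule cubic_group_bij[OF R])
  interpret additive R by (rule cubic_group_additive[OF R])
  obtain D where D: "D \<noteq> 0" "\<And>x y z. det3 (R x) (R y) (R z) = D * det3 x y z"
    using det3_additive[OF cubic_group_additive[OF R] bij_is_surj[OF bij]] by blast
  \<comment> \<open>The map on the second space will be \<open>n R\<close>. The trilinear form then
    scales the centre by \<open>n * m\<close> and the alternating form scales it by
    \<open>n\<^sup>2 * D\<close>. Equating the two determines \<open>n\<close>, and the target
    vector is exactly \<open>R v\<close>.\<close>
  define n where "n = m / D"
  define t where "t = n * m"
  have nt: "n \<noteq> 0" "t \<noteq> 0" "n * (n * D) = t" using m(1) D(1) by (simp_all add: n_def t_def)
  let ?Q = "inv_into UNIV R"
  have addQ: "additive ?Q" by (rule additive_inv[OF cubic_group_additive[OF R] bij])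
  have QR [simp]: "?Q (R x) = x" for x using bij by (simp add: bij_is_inj)
  have RQ [simp]: "R (?Q x) = x" for x using bij by (simp add: bij_is_surj surj_f_inv_f)
  \<comment> \<open>The map on the \<open>W\<close> coordinate is forced by compatibility with
    \<open>dot\<close>: it is \<open>t\<close> times the transpose of the inverse of
    \<open>R\<close>.\<close>
  define S where "S w = smul t (Vec (dot w (?Q e1)) (dot w (?Q e2)) (dot w (?Q e3)))" for w
  have S: "dot (S w) x = t * dot w (?Q x)" for w x
  proof -
    have "additive (\<lambda>x. dot w (?Q x))" using addQ by (simp add: additive_def dot_add_right)
    from additive_dot[OF this, of x] show ?thesis
      unfolding S_def dot_smul dot_commute[of _ x] by simp
  qed
  have S_add: "S (w + w') = S w + S w'" for w w'
    by (rule dot_eqI) (simp add: S dot_add_left algebra_simps)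
  have S_phi: "S (phi a b) = phi (R a) (smul n (R b))" for a b
  proof (rule dot_eqI)
    fix x
    have "dot (phi (R a) (smul n (R b))) x = n * tri (R a) (R b) (R (?Q x))"
      by (simp add: tri_def phi_smul dot_smul)
    also have "\<dots> = t * dot (phi a b) (?Q x)" unfolding m(2) by (simp add: t_def tri_def)
    finally show "dot (S (phi a b)) x = dot (phi (R a) (smul n (R b))) x" by (simp add: S)
  qed
  define f where "f x = Elt (R (pA x)) (smul n (R (pB x))) (S (pW x)) (t * pZ x)" for x
  have "f \<in> hom (desc_group v) (desc_group (R v))"
  proof (rule homI)
    fix x y :: "'k elt"
    have "dot (S (pW y)) (R (pA x)) = t * dot (pW y) (pA x)" by (simp add: S)
    moreover have "tri (R (pA x)) (R (pA x)) (smul n (R (pB y))) = t * tri (pA x) (pA x) (pB y)"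
      by (simp add: tri_smul m t_def)
    moreover have "det3 (R v) (smul n (R (pB x))) (smul n (R (pB y))) = t * det3 v (pB x) (pB y)"
      unfolding nt(3)[symmetric] by (simp add: det3_smul D)
    ultimately show "f (x \<otimes>\<^bsub>desc_group v\<^esub> y) = f x \<otimes>\<^bsub>desc_group (R v)\<^esub> f y"
      by (simp add: f_def mult_desc_group add smul_add S_add S_phi algebra_simps add_divide_distrib)
  qed simp
  moreover have "bij f"
  proof -
    have "inj f"
    proof (rule injI)
      fix x y assume e: "f x = f y"
      have "R (pA x) = R (pA y)" "smul n (R (pB x)) = smul n (R (pB y))" "S (pW x) = S (pW y)" "t * pZ x = t * pZ y"
        using e by (simp_all add: f_def)
      moreover have "w = w'" if "S w = S w'" for w w'
      proof (rule dot_eqI)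
        fix z show "dot w z = dot w' z" using S[of w "R z"] S[of w' "R z"] that nt(2) by simp
      qed
      ultimately show "x = y" using nt bij by (intro elt.expand) (simp add: smul_cancel bij_is_inj inj_eq)
    qed
    then show ?thesis using finite_UNIV_inj_surj[OF finite_elt] by (simp add: bij_def)
  qed
  ultimately show ?thesis unfolding Group.is_iso_def iso_def by auto
qed

section \<open>Descendants as central extensions\<close>

text \<open>The coordinate maps present \<open>K\<close> as a central extension; \<open>sc t\<close> is multiplication by the
  element with parameter \<open>t\<close> of the kernel, which is the third term of the lower central series.\<close>

locale central_ext = group K for K (structure) +
  fixes A B W :: "'a \<Rightarrow> 'k::prime_field vec3" and sc :: "'k \<Rightarrow> 'a \<Rightarrow> 'a"
  assumes coords: "desc_coords K A B W"
    and sc_closed [simp]: "x \<in> carrier K \<Longrightarrow> sc t x \<in> carrier K"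
    and sc_mult_left [simp]: "x \<in> carrier K \<Longrightarrow> y \<in> carrier K \<Longrightarrow> sc t x \<otimes> y = sc t (x \<otimes> y)"
    and sc_mult_right [simp]: "x \<in> carrier K \<Longrightarrow> y \<in> carrier K \<Longrightarrow> x \<otimes> sc t y = sc t (x \<otimes> y)"
    and sc_sc [simp]: "x \<in> carrier K \<Longrightarrow> sc s (sc t x) = sc (s + t) x"
    and sc_0 [simp]: "x \<in> carrier K \<Longrightarrow> sc 0 x = x"
    and sc_inj: "x \<in> carrier K \<Longrightarrow> sc s x = sc t x \<Longrightarrow> s = t"
    and sc_coords [simp]: "x \<in> carrier K \<Longrightarrow> A (sc t x) = A x" "x \<in> carrier K \<Longrightarrow> B (sc t x) = B x"
      "x \<in> carrier K \<Longrightarrow> W (sc t x) = W x"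
    and same_coords: "x \<in> carrier K \<Longrightarrow> y \<in> carrier K \<Longrightarrow> A x = A y \<Longrightarrow> B x = B y \<Longrightarrow> W x = W y \<Longrightarrow>
      \<exists>t. x = sc t y"
    and expo: "x \<in> carrier K \<Longrightarrow> x [^] CARD('k) = \<one>"
begin

section \<open>Central factors, powers and ordered products\<close>

lemmas coords_mult [simp] = desc_coords_mult[OF coords]
lemmas coords_one [simp] = desc_coords_one[OF is_group coords]
lemmas coords_inv [simp] = desc_coords_inv[OF is_group coords]

lemma sc_eq_iff [simp]: "x \<in> carrier K \<Longrightarrow> sc s x = sc t x \<longleftrightarrow> s = t"
  by (rule iffI, erule (1) sc_inj, simp)

lemma sc_eq_self [simp]: "x \<in> carrier K \<Longrightarrow> sc s x = x \<longleftrightarrow> s = 0"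
  using sc_eq_iff[of x s 0] by simp

lemma swap_left:
  assumes "x \<otimes> y = sc t (y \<otimes> x)" "x \<in> carrier K" "y \<in> carrier K" "r \<in> carrier K"
  shows "x \<otimes> (y \<otimes> r) = sc t (y \<otimes> (x \<otimes> r))"
  using assms by (simp flip: m_assoc)

text \<open>Exponents are taken in the field itself, which exponent \<open>p\<close> permits. Words
  in generators thereby become functions of coordinate vectors.\<close>

definition pw :: "'a \<Rightarrow> 'k \<Rightarrow> 'a" where
  "pw x c = x [^] nat (rep c)"

lemma pow_mod: "x \<in> carrier K \<Longrightarrow> x [^] (n mod CARD('k)) = x [^] (n::nat)"
proof -
  assume x: "x \<in> carrier K"
  have "x [^] n = x [^] (CARD('k) * (n div CARD('k)) + n mod CARD('k))" by simp
  also have "\<dots> = (x [^] CARD('k)) [^] (n div CARD('k)) \<otimes> x [^] (n mod CARD('k))"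
    using x by (simp only: nat_pow_mult[symmetric] nat_pow_pow[symmetric])
  finally show ?thesis using x by (simp add: expo)
qed

lemma pw_of_nat: "x \<in> carrier K \<Longrightarrow> pw x (of_nat n) = x [^] n"
proof -
  assume x: "x \<in> carrier K"
  have "rep (of_nat n :: 'k) = int (n mod CARD('k))" using rep_of_int[of "int n", where 'k = 'k] by (simp add: zmod_int)
  then show ?thesis by (simp add: pw_def pow_mod[OF x])
qed

lemma pw_induct:
  assumes "x \<in> carrier K" "Q 0 \<one>" "\<And>c u. u \<in> carrier K \<Longrightarrow> Q c u \<Longrightarrow> Q (c + 1) (u \<otimes> x)"
  shows "Q c (pw x c)"
proof -
  obtain n where n: "c = of_nat n" using of_nat_onto by blast
  have "Q (of_nat n) (x [^] n)"
  proof (induction n)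
    case (Suc n)
    then show ?case using assms(3)[of "x [^] n" "of_nat n"] assms(1) by (simp add: add.commute)
  qed (simp add: assms)
  then show ?thesis using pw_of_nat[OF assms(1)] by (simp add: n)
qed

lemma pw_closed [simp]: "x \<in> carrier K \<Longrightarrow> pw x c \<in> carrier K"
  by (simp add: pw_def)

lemma pw_0 [simp]: "x \<in> carrier K \<Longrightarrow> pw x 0 = \<one>"
  using pw_of_nat[of x 0] by simp

lemma pw_1 [simp]: "x \<in> carrier K \<Longrightarrow> pw x 1 = x"
  using pw_of_nat[of x 1] by simp

lemma pw_add: "x \<in> carrier K \<Longrightarrow> pw x (c + d) = pw x c \<otimes> pw x d"
proof -
  assume x: "x \<in> carrier K"
  obtain n where n: "c = of_nat n" using of_nat_onto by blast
  obtain m where m: "d = of_nat m" using of_nat_onto by blast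
  have "pw x (of_nat (n + m)) = pw x (of_nat n) \<otimes> pw x (of_nat m)"
    using x by (simp only: pw_of_nat[OF x] nat_pow_mult)
  then show ?thesis by (simp only: n m of_nat_add)
qed

lemma pw_coords: 
  assumes x: "x \<in> carrier K"
  shows "A (pw x c) = smul c (A x)" "B (pw x c) = smul c (B x)"
    "A x = 0 \<Longrightarrow> W (pw x c) = smul c (W x)"
proof -
  show "A (pw x c) = smul c (A x)" by (rule pw_induct[OF x]) (simp_all add: x smul_add_left)
  show "B (pw x c) = smul c (B x)" by (rule pw_induct[OF x]) (simp_all add: x smul_add_left)
  assume a: "A x = 0"
  have "A (pw x c) = 0 \<and> W (pw x c) = smul c (W x)" by (rule pw_induct[OF x]) (simp_all add: x smul_add_left a)
  then show "W (pw x c) = smul c (W x)" ..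
qed

lemma commute_pw:
  assumes "x \<otimes> y = sc h (y \<otimes> x)" "x \<in> carrier K" "y \<in> carrier K"
  shows "pw x c \<otimes> pw y d = sc (c * d * h) (pw y d \<otimes> pw x c)"
proof -
  have 1: "pw x c \<otimes> y = sc (c * h) (y \<otimes> pw x c)"
    by (rule pw_induct[OF assms(2)]) (use assms in \<open>simp_all add: m_assoc swap_left[OF assms(1)] algebra_simps\<close>,
      simp flip: m_assoc)
  show ?thesis
  proof (rule pw_induct[where Q = "\<lambda>d u. pw x c \<otimes> u = sc (c * d * h) (u \<otimes> pw x c)", OF assms(3)])
    fix d u assume u: "u \<in> carrier K" and IH: "pw x c \<otimes> u = sc (c * d * h) (u \<otimes> pw x c)"
    have "pw x c \<otimes> (u \<otimes> y) = sc (c * d * h) (u \<otimes> (pw x c \<otimes> y))"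
      using swap_left[OF IH] u assms by simp
    then show "pw x c \<otimes> (u \<otimes> y) = sc (c * (d + 1) * h) (u \<otimes> y \<otimes> pw x c)"
      using u assms by (simp add: 1 m_assoc algebra_simps)
  qed (use assms in simp)
qed

definition prod3 :: "'a \<Rightarrow> 'a \<Rightarrow> 'a \<Rightarrow> 'k vec3 \<Rightarrow> 'a" where
  "prod3 x y z u = (case u of Vec a b c \<Rightarrow> pw x a \<otimes> (pw y b \<otimes> pw z c))"

lemma prod3_closed [simp]: "x \<in> carrier K \<Longrightarrow> y \<in> carrier K \<Longrightarrow> z \<in> carrier K \<Longrightarrow> prod3 x y z u \<in> carrier K"
  by (cases u) (simp add: prod3_def)

text \<open>Collection into normal order: each exchange of two powers contributes a central factor
  that is bilinear in the exponents.\<close>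

lemma prod3_mult:
  assumes c: "x \<in> carrier K" "y \<in> carrier K" "z \<in> carrier K"
    and h: "x \<otimes> y = sc h12 (y \<otimes> x)" "x \<otimes> z = sc h13 (z \<otimes> x)" "y \<otimes> z = sc h23 (z \<otimes> y)"
  shows "prod3 x y z (Vec a b d) \<otimes> prod3 x y z (Vec a' b' d') =
    sc (- (a' * b * h12 + a' * d * h13 + b' * d * h23)) (prod3 x y z (Vec (a + a') (b + b') (d + d')))"
proof -
  have rev: "v \<otimes> u = sc (- t) (u \<otimes> v)" if "u \<otimes> v = sc t (v \<otimes> u)" "u \<in> carrier K" "v \<in> carrier K" for u v t
    using that by simp
  note s12 = rev[OF commute_pw[OF h(1)]] and s13 = rev[OF commute_pw[OF h(2)]] and s23 = rev[OF commute_pw[OF h(3)]]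
  note l12 = swap_left[OF s12[OF c(1,2) pw_closed pw_closed]] and l13 = swap_left[OF s13[OF c(1,3) pw_closed pw_closed]]
    and l23 = swap_left[OF s23[OF c(2,3) pw_closed pw_closed]]
  have "prod3 x y z (Vec a b d) \<otimes> prod3 x y z (Vec a' b' d') =
     pw x a \<otimes> (pw y b \<otimes> (pw z d \<otimes> (pw x a' \<otimes> (pw y b' \<otimes> pw z d'))))"
    using c by (simp add: prod3_def m_assoc)
  also have "\<dots> = sc (- (a' * d * h13)) (pw x a \<otimes> (pw y b \<otimes> (pw x a' \<otimes> (pw z d \<otimes> (pw y b' \<otimes> pw z d')))))"
    using c by (simp add: l13)
  also have "\<dots> = sc (- (a' * d * h13) - a' * b * h12) (pw x a \<otimes> (pw x a' \<otimes> (pw y b \<otimes> (pw z d \<otimes> (pw y b' \<otimes> pw z d')))))"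
    using c by (simp add: l12)
  also have "\<dots> = sc (- (a' * d * h13) - a' * b * h12 - b' * d * h23)
      (pw x a \<otimes> (pw x a' \<otimes> (pw y b \<otimes> (pw y b' \<otimes> (pw z d \<otimes> pw z d')))))"
    using c by (simp add: l23)
  also have "\<dots> = sc (- (a' * b * h12 + a' * d * h13 + b' * d * h23)) (prod3 x y z (Vec (a + a') (b + b') (d + d')))"
    using c by (simp add: prod3_def pw_add m_assoc algebra_simps)
  finally show ?thesis .
qed

lemma prod3_add:
  assumes c: "x \<in> carrier K" "y \<in> carrier K" "z \<in> carrier K"
    and h: "x \<otimes> y = y \<otimes> x" "x \<otimes> z = z \<otimes> x" "y \<otimes> z = z \<otimes> y"
  shows "prod3 x y z (u + v) = prod3 x y z u \<otimes> prod3 x y z v"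
proof -
  have h': "x \<otimes> y = sc 0 (y \<otimes> x)" "x \<otimes> z = sc 0 (z \<otimes> x)" "y \<otimes> z = sc 0 (z \<otimes> y)" using c h by simp_all
  show ?thesis using prod3_mult[OF c h'] c by (cases u; cases v) simp
qed

lemma prod3_coords:
  assumes c: "x \<in> carrier K" "y \<in> carrier K" "z \<in> carrier K"
  shows "A (prod3 x y z (Vec a b d)) = smul a (A x) + (smul b (A y) + smul d (A z))"
    "B (prod3 x y z (Vec a b d)) = smul a (B x) + (smul b (B y) + smul d (B z))"
    "A x = 0 \<Longrightarrow> A y = 0 \<Longrightarrow> A z = 0 \<Longrightarrow> W (prod3 x y z (Vec a b d)) = smul a (W x) + (smul b (W y) + smul d (W z))"
  using c by (simp_all add: prod3_def pw_coords)

end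

text \<open>In the form \<open>g w a = dot w (N a)\<close>, the symmetry assumed of \<open>g\<close>
  says that \<open>N\<close> is self-adjoint for \<open>tri\<close>.\<close>

lemma pairing_scalar:
  fixes g :: "'k::prime_field vec3 \<Rightarrow> 'k vec3 \<Rightarrow> 'k"
  assumes add1: "\<And>w w' a. g (w + w') a = g w a + g w' a"
    and add2: "\<And>w a a'. g w (a + a') = g w a + g w a'"
    and sym: "\<And>x y z. g (phi y z) x = g (phi x z) y"
  shows "\<exists>s. \<forall>w a. g w a = s * dot w a"
proof -
  define N where "N a = Vec (g e1 a) (g e2 a) (g e3 a)" for a
  have g: "g w a = dot w (N a)" for w a
    unfolding N_def by (rule additive_dot) (simp add: additive_def add1)
  have "additive N" by (simp add: additive_def N_def add2)
  moreover have "tri (N x) y z = tri x (N y) z" for x y z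
    using sym[of y z x] tri_commute(1)[of x "N y" z] by (simp add: g dot_phi)
  ultimately obtain c where "\<forall>x. N x = smul c x" using self_adjoint_scalar by blast
  then show ?thesis by (auto simp: g dot_smul)
qed

lemma (in group) commutator_cancel:
  assumes "x \<in> carrier G" "y \<in> carrier G"
  shows "x \<otimes> y \<otimes> inv x \<otimes> inv y \<otimes> (y \<otimes> x) = x \<otimes> y"
proof -
  have "inv y \<otimes> (y \<otimes> x) = x" using assms by (simp flip: m_assoc)
  then show ?thesis using assms by (simp add: m_assoc)
qed

section \<open>Commutators with the second term of the lower central series\<close>

context central_ext
begin

text \<open>Meaningful for pairs that commute up to a factor \<open>sc t\<close>; this factor is
  unique by \<open>sc_inj\<close>.\<close>

definition br :: "'a \<Rightarrow> 'a \<Rightarrow> 'k" where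
  "br x y = (THE t. x \<otimes> y = sc t (y \<otimes> x))"

lemma br_eqI:
  assumes "x \<in> carrier K" "y \<in> carrier K" "x \<otimes> y = sc t (y \<otimes> x)"
  shows "br x y = t"
  unfolding br_def
proof (rule the_equality)
  show "x \<otimes> y = sc t (y \<otimes> x)" by fact
  fix s assume "x \<otimes> y = sc s (y \<otimes> x)"
  then have "sc s (y \<otimes> x) = sc t (y \<otimes> x)" using assms(3) by (rule trans[OF sym])
  then show "s = t" using assms(1,2) by (intro sc_inj[of "y \<otimes> x"]) simp_all
qed

lemma br:
  assumes "x \<in> carrier K" "y \<in> carrier K" "phi (A x) (B y) = phi (A y) (B x)"
  shows "x \<otimes> y = sc (br x y) (y \<otimes> x)"
proof -
  obtain t where t: "x \<otimes> y = sc t (y \<otimes> x)"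
    using same_coords[of "x \<otimes> y" "y \<otimes> x"] assms by (auto simp: add_ac)
  then show ?thesis using br_eqI[OF assms(1,2) t] by simp
qed

lemma br_N:
  assumes "k \<in> carrier K" "n \<in> carrier K" "A n = 0" "B n = 0"
  shows "k \<otimes> n = sc (br k n) (n \<otimes> k)"
  using assms by (intro br) simp_all

lemma br_mult_left:
  assumes "k \<in> carrier K" "k' \<in> carrier K" "n \<in> carrier K" "A n = 0" "B n = 0"
  shows "br (k \<otimes> k') n = br k n + br k' n"
proof (rule br_eqI)
  show "k \<otimes> k' \<otimes> n = sc (br k n + br k' n) (n \<otimes> (k \<otimes> k'))"
    using assms swap_left[OF br_N[of k n]] by (simp add: m_assoc br_N[of k' n] add.commute)
qed (use assms in simp_all)

lemma br_mult_right:
  assumes "k \<in> carrier K" "n \<in> carrier K" "A n = 0" "B n = 0" "n' \<in> carrier K" "A n' = 0" "B n' = 0"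
  shows "br k (n \<otimes> n') = br k n + br k n'"
proof (rule br_eqI)
  show "k \<otimes> (n \<otimes> n') = sc (br k n + br k n') (n \<otimes> n' \<otimes> k)"
    using assms swap_left[OF br_N[of k n]] by (simp add: m_assoc br_N[of k n'])
qed (use assms in simp_all)

lemma br_inv_left:
  assumes "k \<in> carrier K" "n \<in> carrier K" "A n = 0" "B n = 0"
  shows "br (inv k) n = - br k n"
proof -
  have "br \<one> n = 0" by (rule br_eqI) (use assms in simp_all)
  then show ?thesis using br_mult_left[of "inv k" k n] assms by (simp add: eq_neg_iff_add_eq_0)
qed

text \<open>The second term is abelian: its generators are commutators, and \<open>br\<close> is
  additive in its left argument, so the contributions of \<open>inv x\<close>, \<open>inv y\<close>,
  \<open>x\<close>, \<open>y\<close> cancel.\<close>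

lemma br_NN:
  assumes k: "k \<in> carrier K" "A k = 0" "B k = 0" and n: "n \<in> carrier K" "A n = 0" "B n = 0"
  shows "br k n = 0"
proof -
  have "k \<in> lower_central K 2" unfolding lower_central_2[OF is_group coords] using k by simp
  then have "k \<in> generate K {inv x \<otimes> inv y \<otimes> x \<otimes> y |x y. x \<in> carrier K \<and> y \<in> carrier K}"
    unfolding lower_central_Suc3(3) commutator_subgroup_def .
  then have "k \<in> carrier K \<and> br k n = 0"
  proof (induction rule: generate.induct)
    case one
    have "br \<one> n = 0" by (rule br_eqI) (use n in simp_all)
    then show ?case by simp
  next
    case (incl h)
    then show ?case using n by (auto simp: br_mult_left br_inv_left)
  next
    case (inv h)
    then show ?case using n by (auto simp: br_mult_left br_inv_left)
  next
    case (eng h1 h2)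
    then show ?case using n by (simp add: br_mult_left)
  qed
  then show ?thesis by simp
qed

lemma br_coords_left:
  assumes "k \<in> carrier K" "k' \<in> carrier K" "A k = A k'" "B k = B k'" "n \<in> carrier K" "A n = 0" "B n = 0"
  shows "br k n = br k' n"
proof -
  have "br (k \<otimes> inv k') n = 0" by (rule br_NN) (use assms in simp_all)
  then show ?thesis using assms by (simp add: br_mult_left br_inv_left)
qed

lemma br_coords_right:
  assumes "k \<in> carrier K" "n \<in> carrier K" "A n = 0" "B n = 0" "n' \<in> carrier K" "A n' = 0" "B n' = 0" "W n = W n'"
  shows "br k n = br k n'"
proof -
  obtain t where t: "n = sc t n'" using same_coords[of n n'] assms by auto
  show ?thesis
    by (rule br_eqI) (use assms br_N[of k n'] in \<open>simp_all add: t add.commute\<close>)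
qed

definition lift :: "'k vec3 \<Rightarrow> 'k vec3 \<Rightarrow> 'k vec3 \<Rightarrow> 'a" where
  "lift a b w = (SOME x. x \<in> carrier K \<and> A x = a \<and> B x = b \<and> W x = w)"

lemma lift [simp]: "lift a b w \<in> carrier K" "A (lift a b w) = a" "B (lift a b w) = b" "W (lift a b w) = w"
proof -
  have "\<exists>x. x \<in> carrier K \<and> A x = a \<and> B x = b \<and> W x = w"
    using desc_coords_onto[OF coords, of a b w] by blast
  from someI_ex[OF this, folded lift_def]
  show "lift a b w \<in> carrier K" "A (lift a b w) = a" "B (lift a b w) = b" "W (lift a b w) = w" by simp_all
qed

text \<open>The Hall-Witt identity for a pair \<open>x, x'\<close> commuting modulo the centre: conjugation by
  \<open>x\<close> and by \<open>x'\<close> commute, and they send \<open>y\<close> to \<open>n y\<close> and \<open>n' y\<close>.\<close>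

lemma br_jacobi:
  assumes c: "x \<in> carrier K" "x' \<in> carrier K" "y \<in> carrier K"
    and n: "n \<in> carrier K" "A n = 0" "B n = 0" and n': "n' \<in> carrier K" "A n' = 0" "B n' = 0"
    and xx: "x \<otimes> x' = sc t (x' \<otimes> x)"
    and xy: "x \<otimes> y = n \<otimes> (y \<otimes> x)" and xy': "x' \<otimes> y = n' \<otimes> (y \<otimes> x')"
  shows "br x n' = br x' n"
proof -
  have nn: "n' \<otimes> n = n \<otimes> n'" using br_N[of n' n] br_NN[of n' n] n n' by simp
  let ?r = "n \<otimes> (n' \<otimes> (y \<otimes> (x' \<otimes> x)))"
  have "x \<otimes> (x' \<otimes> y) = x \<otimes> (n' \<otimes> (y \<otimes> x'))" by (simp only: xy')
  also have "\<dots> = sc (br x n') (n' \<otimes> (x \<otimes> (y \<otimes> x')))"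
    using swap_left[OF br_N[of x n']] c n' by simp
  also have "x \<otimes> (y \<otimes> x') = n \<otimes> (y \<otimes> (x \<otimes> x'))" using xy c n by (simp flip: m_assoc)
  also have "\<dots> = sc t (n \<otimes> (y \<otimes> (x' \<otimes> x)))" using c n by (simp add: xx)
  also have "sc (br x n') (n' \<otimes> \<dots>) = sc (br x n' + t) (n' \<otimes> n \<otimes> (y \<otimes> (x' \<otimes> x)))"
    using c n n' by (simp add: m_assoc)
  also have "\<dots> = sc (br x n' + t) ?r" using c n n' by (simp add: nn m_assoc)
  finally have 1: "x \<otimes> (x' \<otimes> y) = sc (br x n' + t) ?r" .
  have "x' \<otimes> (x \<otimes> y) = x' \<otimes> (n \<otimes> (y \<otimes> x))" by (simp only: xy)
  also have "\<dots> = sc (br x' n) (n \<otimes> (x' \<otimes> (y \<otimes> x)))"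
    using swap_left[OF br_N[of x' n]] c n by simp
  also have "x' \<otimes> (y \<otimes> x) = n' \<otimes> (y \<otimes> (x' \<otimes> x))" using xy' c n' by (simp flip: m_assoc)
  finally have 2: "x' \<otimes> (x \<otimes> y) = sc (br x' n) ?r" .
  have "x \<otimes> (x' \<otimes> y) = sc t (x' \<otimes> (x \<otimes> y))" by (rule swap_left[OF xx c(1,2,3)])
  then have "sc (br x n' + t) ?r = sc (t + br x' n) ?r" using 1 2 c n n' by simp
  moreover have "?r \<in> carrier K" using c n n' by simp
  ultimately have "br x n' + t = t + br x' n" by (intro sc_inj)
  then show ?thesis by simp
qed

text \<open>Lifts from one coordinate space commute up to a central factor, so Hall-Witt applies to
  two of them and a lift from the other space. It yields exactly the symmetry of
  \<open>pairing_scalar\<close>, once for each space. If both scalars vanished, the second term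
  would be central and the third one trivial.\<close>

lemma br_form:
  obtains s u where "s \<noteq> 0 \<or> u \<noteq> 0"
    "\<And>k n. k \<in> carrier K \<Longrightarrow> n \<in> carrier K \<Longrightarrow> A n = 0 \<Longrightarrow> B n = 0 \<Longrightarrow>
       br k n = s * dot (W n) (A k) + u * dot (W n) (B k)"
proof -
  define gA where "gA w a = br (lift a 0 0) (lift 0 0 w)" for w a
  define gB where "gB w b = br (lift 0 b 0) (lift 0 0 w)" for w b
  have gA: "gA w a = br k n" if "k \<in> carrier K" "A k = a" "B k = 0" "n \<in> carrier K" "A n = 0" "B n = 0" "W n = w" for w a k n
    unfolding gA_def using that br_coords_left[of "lift a 0 0" k n] br_coords_right[of "lift a 0 0" "lift 0 0 w" n] by simp
  have gB: "gB w b = br k n" if "k \<in> carrier K" "A k = 0" "B k = b" "n \<in> carrier K" "A n = 0" "B n = 0" "W n = w" for w b k n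
    unfolding gB_def using that br_coords_left[of "lift 0 b 0" k n] br_coords_right[of "lift 0 b 0" "lift 0 0 w" n] by simp
  have br_g: "br k n = gA (W n) (A k) + gB (W n) (B k)"
    if "k \<in> carrier K" "n \<in> carrier K" "A n = 0" "B n = 0" for k n
  proof -
    have "br k n = br (lift (A k) 0 0 \<otimes> lift 0 (B k) 0) n"
      by (rule br_coords_left) (use that in simp_all)
    also have "\<dots> = br (lift (A k) 0 0) n + br (lift 0 (B k) 0) n"
      by (rule br_mult_left) (use that in simp_all)
    finally show ?thesis using gA[of "lift (A k) 0 0" "A k" n "W n"] gB[of "lift 0 (B k) 0" "B k" n "W n"] that by simp
  qed
  have "\<exists>s. \<forall>w a. gA w a = s * dot w a"
  proof (rule pairing_scalar)
    fix w w' a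
    have "gA (w + w') a = br (lift a 0 0) (lift 0 0 w \<otimes> lift 0 0 w')" by (rule gA) simp_all
    then show "gA (w + w') a = gA w a + gA w' a" by (simp add: br_mult_right gA_def)
  next
    fix w a a'
    have "gA w (a + a') = br (lift a 0 0 \<otimes> lift a' 0 0) (lift 0 0 w)" by (rule gA) simp_all
    then show "gA w (a + a') = gA w a + gA w a'" by (simp add: br_mult_left gA_def)
  next
    fix a a' b
    let ?x = "lift a 0 0" and ?x' = "lift a' 0 0" and ?y = "lift 0 b 0"
    let ?n = "?x \<otimes> ?y \<otimes> inv ?x \<otimes> inv ?y" and ?n' = "?x' \<otimes> ?y \<otimes> inv ?x' \<otimes> inv ?y"
    have n: "?n \<in> carrier K" "A ?n = 0" "B ?n = 0" "W ?n = phi a b" by (simp_all add: phi_uminus)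
    have n': "?n' \<in> carrier K" "A ?n' = 0" "B ?n' = 0" "W ?n' = phi a' b" by (simp_all add: phi_uminus)
    have "br ?x ?n' = br ?x' ?n"
    proof (rule br_jacobi[OF _ _ _ n(1-3) n'(1-3)])
      show "?x \<otimes> ?x' = sc (br ?x ?x') (?x' \<otimes> ?x)" by (rule br) simp_all
      show "?x \<otimes> ?y = ?n \<otimes> (?y \<otimes> ?x)" "?x' \<otimes> ?y = ?n' \<otimes> (?y \<otimes> ?x')" by (simp_all add: commutator_cancel)
    qed simp_all
    then show "gA (phi a' b) a = gA (phi a b) a'" using gA[of ?x a ?n' "phi a' b"] gA[of ?x' a' ?n "phi a b"] n n' by simp
  qed
  then obtain s where s: "\<And>w a. gA w a = s * dot w a" by blast
  have "\<exists>s. \<forall>w b. gB w b = s * dot w b"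
  proof (rule pairing_scalar)
    fix w w' b
    have "gB (w + w') b = br (lift 0 b 0) (lift 0 0 w \<otimes> lift 0 0 w')" by (rule gB) simp_all
    then show "gB (w + w') b = gB w b + gB w' b" by (simp add: br_mult_right gB_def)
  next
    fix w b b'
    have "gB w (b + b') = br (lift 0 b 0 \<otimes> lift 0 b' 0) (lift 0 0 w)" by (rule gB) simp_all
    then show "gB w (b + b') = gB w b + gB w b'" by (simp add: br_mult_left gB_def)
  next
    fix b b' a
    \<comment> \<open>The sign compensates for the order of the spaces: the commutator of a lift of
      \<open>b\<close> with a lift of \<open>a\<close> has \<open>W\<close> part
      \<open>- phi a b\<close>.\<close>
    let ?x = "lift 0 b 0" and ?x' = "lift 0 b' 0" and ?y = "lift (- a) 0 0"
    let ?n = "?x \<otimes> ?y \<otimes> inv ?x \<otimes> inv ?y" and ?n' = "?x' \<otimes> ?y \<otimes> inv ?x' \<otimes> inv ?y"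
    have n: "?n \<in> carrier K" "A ?n = 0" "B ?n = 0" "W ?n = phi b a" by (simp_all add: phi_uminus phi_commute)
    have n': "?n' \<in> carrier K" "A ?n' = 0" "B ?n' = 0" "W ?n' = phi b' a" by (simp_all add: phi_uminus phi_commute)
    have "br ?x ?n' = br ?x' ?n"
    proof (rule br_jacobi[OF _ _ _ n(1-3) n'(1-3)])
      show "?x \<otimes> ?x' = sc (br ?x ?x') (?x' \<otimes> ?x)" by (rule br) simp_all
      show "?x \<otimes> ?y = ?n \<otimes> (?y \<otimes> ?x)" "?x' \<otimes> ?y = ?n' \<otimes> (?y \<otimes> ?x')" by (simp_all add: commutator_cancel)
    qed simp_all
    then show "gB (phi b' a) b = gB (phi b a) b'" using gB[of ?x b ?n' "phi b' a"] gB[of ?x' b' ?n "phi b a"] n n' by simp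
  qed
  then obtain u where u: "\<And>w b. gB w b = u * dot w b" by blast
  have form: "br k n = s * dot (W n) (A k) + u * dot (W n) (B k)"
    if "k \<in> carrier K" "n \<in> carrier K" "A n = 0" "B n = 0" for k n
    using br_g[OF that] by (simp add: s u)
  have "s \<noteq> 0 \<or> u \<noteq> 0"
  proof (rule ccontr)
    assume "\<not> (s \<noteq> 0 \<or> u \<noteq> 0)"
    then have comm: "k \<otimes> n = n \<otimes> k" if "k \<in> carrier K" "n \<in> carrier K" "A n = 0" "B n = 0" for k n
      using br_N[OF that] form[OF that] that by simp
    have "{inv x \<otimes> inv y \<otimes> x \<otimes> y |x y. x \<in> lower_central K 2 \<and> y \<in> carrier K} \<subseteq> {\<one>}"
      unfolding lower_central_2[OF is_group coords] using commutator_eq_one_iff comm by fastforce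
    then have "lower_central K 3 \<subseteq> {\<one>}"
      unfolding lower_central_Suc3(2) commutator_subgroup_def by (rule generate_subgroup_incl[OF _ triv_subgroup])
    moreover have "sc 1 \<one> \<in> lower_central K 3" unfolding desc_coords_kernel[OF coords] by simp
    ultimately show False by auto
  qed
  then show ?thesis using form that by blast
qed

end

section \<open>Normalized coordinates and adapted generators\<close>

locale normal_ext = central_ext K A B W sc
  for K :: "('a, 'm) monoid_scheme" (structure) and A B W :: "'a \<Rightarrow> 'k::prime_field vec3" and sc +
  assumes normal: "k \<in> carrier K \<Longrightarrow> n \<in> carrier K \<Longrightarrow> A n = 0 \<Longrightarrow> B n = 0 \<Longrightarrow>
    k \<otimes> n = sc (dot (W n) (A k)) (n \<otimes> k)"

text \<open>The combination \<open>s A + u B\<close>, which alone acts on the second term, becomes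
  the first coordinate. The symmetry of \<open>phi\<close> makes this compatible with the cocycle:
  the change is a coboundary and can be absorbed into \<open>W\<close>. When \<open>s = 0\<close>
  the two spaces are exchanged, with a sign.\<close>

lemma (in central_ext) normalize: "\<exists>A' B' W'. normal_ext K A' B' W' sc"
proof -
  obtain s u where su: "s \<noteq> 0 \<or> u \<noteq> 0" and form: "\<And>k n. k \<in> carrier K \<Longrightarrow> n \<in> carrier K \<Longrightarrow> A n = 0 \<Longrightarrow> B n = 0 \<Longrightarrow>
       br k n = s * dot (W n) (A k) + u * dot (W n) (B k)" using br_form by blast
  have ker: "lower_central K 3 = {x \<in> carrier K. A x = 0 \<and> B x = 0 \<and> W x = 0}" by (rule desc_coords_kernel[OF coords])
  have ext: "normal_ext K A' B' W' sc"
    if m: "\<And>x y. x \<in> carrier K \<Longrightarrow> y \<in> carrier K \<Longrightarrow> A' (x \<otimes> y) = A' x + A' y"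
        "\<And>x y. x \<in> carrier K \<Longrightarrow> y \<in> carrier K \<Longrightarrow> B' (x \<otimes> y) = B' x + B' y"
        "\<And>x y. x \<in> carrier K \<Longrightarrow> y \<in> carrier K \<Longrightarrow> W' (x \<otimes> y) = W' x + W' y + phi (A' x) (B' y)"
      and onto: "\<And>a b w. \<exists>x\<in>carrier K. A' x = a \<and> B' x = b \<and> W' x = w"
      and sc: "\<And>x t. x \<in> carrier K \<Longrightarrow> A' (sc t x) = A' x \<and> B' (sc t x) = B' x \<and> W' (sc t x) = W' x"
      and eqs: "\<And>x y. A' x = A' y \<Longrightarrow> B' x = B' y \<Longrightarrow> A x = A y \<and> B x = B y \<and> (W' x = W' y \<longrightarrow> W x = W y)"
      and n0: "\<And>n. A n = 0 \<Longrightarrow> B n = 0 \<Longrightarrow> A' n = 0 \<and> B' n = 0 \<and> W' n = W n"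
      and nf: "\<And>k w. s * dot w (A k) + u * dot w (B k) = dot w (A' k)"
    for A' B' W' :: "'a \<Rightarrow> 'k vec3"
  proof
    have z: "A' x = 0 \<and> B' x = 0 \<longleftrightarrow> A x = 0 \<and> B x = 0" for x
      using eqs[of x "\<one>"] n0[of x] n0[of "\<one>"] by auto
    have "A x = 0 \<and> B x = 0 \<and> W x = 0 \<longleftrightarrow> A' x = 0 \<and> B' x = 0 \<and> W' x = 0" for x
      using z[of x] n0[of x] by auto
    then have "{x \<in> carrier K. A x = 0 \<and> B x = 0 \<and> W x = 0} = {x \<in> carrier K. A' x = 0 \<and> B' x = 0 \<and> W' x = 0}"
      by simp
    then show "desc_coords K A' B' W'" unfolding desc_coords_def ker using m onto by simp
    show "A' (sc t x) = A' x" "B' (sc t x) = B' x" "W' (sc t x) = W' x" if "x \<in> carrier K" for x t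
      using sc[OF that] by simp_all
    show "\<exists>t. x = sc t y" if "x \<in> carrier K" "y \<in> carrier K" "A' x = A' y" "B' x = B' y" "W' x = W' y" for x y
      using same_coords[OF that(1,2)] eqs[OF that(3,4)] that(5) by blast
    show "k \<otimes> n = sc (dot (W' n) (A' k)) (n \<otimes> k)" if "k \<in> carrier K" "n \<in> carrier K" "A' n = 0" "B' n = 0" for k n
    proof -
      have "A n = 0" "B n = 0" using z[of n] that by simp_all
      then show ?thesis using br_N[OF that(1,2)] form[OF that(1,2)] n0[of n] by (simp add: nf)
    qed
  qed (simp_all add: expo sc_inj)
  show ?thesis
  proof (cases "s = 0")
    case False
    define A' where "A' x = smul s (A x) + smul u (B x)" for x
    define B' where "B' x = smul (inverse s) (B x)" for x
    \<comment> \<open>Half the diagonal of a symmetric bilinear map has that map as its coboundary;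
      this produces the extra term \<open>(u / s) phi (B x) (B y)\<close>.\<close>
    define W' where "W' x = W x + smul (u / (2 * s)) (phi (B x) (B x))" for x
    have 1: "smul (u / (2 * s)) (phi (b + b') (b + b')) =
       smul (u / (2 * s)) (phi b b) + smul (u / (2 * s)) (phi b' b') + smul (u / s) (phi b b')" for b b'
    proof -
      have "phi (b + b') (b + b') = phi b b + phi b' b' + smul 2 (phi b b')"
        by (cases b; cases b') (simp add: algebra_simps)
      then show ?thesis by (simp add: smul_add smul_smul)
    qed
    have "normal_ext K A' B' W' sc"
    proof (rule ext)
      fix x y assume xy: "x \<in> carrier K" "y \<in> carrier K"
      show "A' (x \<otimes> y) = A' x + A' y" "B' (x \<otimes> y) = B' x + B' y"
        using xy by (simp_all add: A'_def B'_def smul_add algebra_simps)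
      have "phi (A' x) (B' y) = phi (A x) (B y) + smul (u / s) (phi (B x) (B y))"
        using False by (simp add: A'_def B'_def phi_add_left phi_smul smul_add smul_smul divide_inverse mult.commute)
      then show "W' (x \<otimes> y) = W' x + W' y + phi (A' x) (B' y)"
        unfolding W'_def coords_mult[OF xy] 1 by (simp add: add_ac)
    next
      fix a b w
      show "\<exists>x\<in>carrier K. A' x = a \<and> B' x = b \<and> W' x = w"
        using False
        by (intro bexI[of _ "lift (smul (inverse s) (a - smul u (smul s b))) (smul s b) (w - smul (u / (2 * s)) (phi (smul s b) (smul s b)))"])
          (simp_all add: A'_def B'_def W'_def smul_smul)
    next
      fix x y assume "A' x = A' y" "B' x = B' y"
      then show "A x = A y \<and> B x = B y \<and> (W' x = W' y \<longrightarrow> W x = W y)"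
        using False by (simp add: A'_def B'_def W'_def smul_cancel)
    next
      fix k w show "s * dot w (A k) + u * dot w (B k) = dot w (A' k)" by (simp add: A'_def dot_add_right dot_smul)
    qed (simp_all add: A'_def B'_def W'_def)
    then show ?thesis by blast
  next
    case True
    then have u: "u \<noteq> 0" using su by simp
    define A' where "A' x = smul u (B x)" for x
    define B' where "B' x = smul (- inverse u) (A x)" for x
    \<comment> \<open>Subtracting \<open>phi (A x) (B x)\<close> turns the cocycle
      \<open>phi (A x) (B y)\<close> into \<open>- phi (A y) (B x)\<close>, which is the pairing
      with the two spaces exchanged.\<close>
    define W' where "W' x = W x - phi (A x) (B x)" for x
    have "normal_ext K A' B' W' sc"
    proof (rule ext)
      fix x y assume xy: "x \<in> carrier K" "y \<in> carrier K"
      show "A' (x \<otimes> y) = A' x + A' y" "B' (x \<otimes> y) = B' x + B' y"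
        using xy by (simp_all add: A'_def B'_def smul_add)
      have "phi (smul u (B x)) (smul (- inverse u) (A y)) = - phi (A y) (B x)"
        using u phi_commute[of "A y" "B x"] by (simp add: phi_smul phi_uminus smul_smul smul_uminus)
      then show "W' (x \<otimes> y) = W' x + W' y + phi (A' x) (B' y)"
        using xy by (simp add: W'_def A'_def B'_def phi_add_left phi_add_right algebra_simps)
    next
      fix a b w
      show "\<exists>x\<in>carrier K. A' x = a \<and> B' x = b \<and> W' x = w"
        using u
        by (intro bexI[of _ "lift (smul (- u) b) (smul (inverse u) a) (w + phi (smul (- u) b) (smul (inverse u) a))"])
          (simp_all add: A'_def B'_def W'_def smul_smul)
    next
      fix x y assume "A' x = A' y" "B' x = B' y"
      then show "A x = A y \<and> B x = B y \<and> (W' x = W' y \<longrightarrow> W x = W y)"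
        using u by (simp add: A'_def B'_def W'_def smul_cancel)
    next
      fix k w show "s * dot w (A k) + u * dot w (B k) = dot w (A' k)" by (simp add: A'_def True dot_smul)
    qed (simp_all add: A'_def B'_def W'_def)
    then show ?thesis by blast
  qed
qed

lemma four_neq_0 [simp]: "4 \<noteq> (0 :: 'k::prime_field)"
proof
  assume "4 = (0 :: 'k)"
  then have "2 * 2 = (0 :: 'k)" by simp
  then show False by (simp only: mult_eq_0_iff two_neq_0 simp_thms)
qed

context normal_ext
begin

text \<open>Changing a lift by an element \<open>n\<close> of the second term shifts its commutator
  with \<open>k\<close> by \<open>dot (W n) (A k)\<close>. This is the freedom by which all lifts
  below are corrected; \<open>q\<close> carries the part of the commutator that is not
  central.\<close>

lemma adjust:
  assumes "x \<in> carrier K" "k \<in> carrier K" "n \<in> carrier K" "A n = 0" "B n = 0" "q \<in> carrier K" "A q = 0" "B q = 0"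
    and "k \<otimes> x = sc t (x \<otimes> (q \<otimes> k))"
  shows "k \<otimes> (x \<otimes> n) = sc (t + dot (W n) (A k)) (x \<otimes> n \<otimes> (q \<otimes> k))"
proof -
  have nq: "q \<otimes> n = n \<otimes> q" using normal[of q n] assms by simp
  have "k \<otimes> (x \<otimes> n) = sc t (x \<otimes> (q \<otimes> (k \<otimes> n)))" using assms by (simp flip: m_assoc)
  also have "\<dots> = sc (t + dot (W n) (A k)) (x \<otimes> (q \<otimes> n \<otimes> k))"
    using assms by (simp add: normal[of k n] m_assoc)
  finally show ?thesis using assms by (simp add: nq m_assoc)
qed

lemma N_commute:
  assumes "k \<in> carrier K" "A k = 0" "n \<in> carrier K" "A n = 0" "B n = 0"
  shows "k \<otimes> n = n \<otimes> k"
  using normal[of k n] assms by simp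

text \<open>The corrections are triangular: the first coordinate of a correcting vector shifts the
  commutator with \<open>x1\<close>, the second one the commutator with \<open>x2\<close>.\<close>

lemma commuting_lifts:
  obtains x1 x2 x3 where "x1 \<in> carrier K" "x2 \<in> carrier K" "x3 \<in> carrier K"
    "A x1 = e1" "A x2 = e2" "A x3 = e3" "B x1 = 0" "B x2 = 0" "B x3 = 0"
    "x1 \<otimes> x2 = x2 \<otimes> x1" "x1 \<otimes> x3 = x3 \<otimes> x1" "x2 \<otimes> x3 = x3 \<otimes> x2"
proof -
  let ?x1 = "lift e1 0 0"
  have fix2: "\<exists>t. k \<otimes> x = sc t (x \<otimes> (\<one> \<otimes> k))" if "k \<in> carrier K" "x \<in> carrier K" "B k = 0" "B x = 0" for k x
    using br[of k x] that by auto
  obtain t where t: "?x1 \<otimes> lift e2 0 0 = sc t (lift e2 0 0 \<otimes> (\<one> \<otimes> ?x1))"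
    using fix2[of ?x1 "lift e2 0 0"] by auto
  define x2 where "x2 = lift e2 0 0 \<otimes> lift 0 0 (Vec (- t) 0 0)"
  have x2: "x2 \<in> carrier K" "A x2 = e2" "B x2 = 0" by (simp_all add: x2_def)
  have c12: "?x1 \<otimes> x2 = x2 \<otimes> ?x1"
    unfolding x2_def by (subst adjust[OF _ _ _ _ _ _ _ _ t]) simp_all
  obtain t1 where t1: "?x1 \<otimes> lift e3 0 0 = sc t1 (lift e3 0 0 \<otimes> (\<one> \<otimes> ?x1))"
    using fix2[of ?x1 "lift e3 0 0"] by auto
  obtain t2 where t2: "x2 \<otimes> lift e3 0 0 = sc t2 (lift e3 0 0 \<otimes> (\<one> \<otimes> x2))"
    using fix2[of x2 "lift e3 0 0"] x2 by auto
  define x3 where "x3 = lift e3 0 0 \<otimes> lift 0 0 (Vec (- t1) (- t2) 0)"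
  have x3: "x3 \<in> carrier K" "A x3 = e3" "B x3 = 0" by (simp_all add: x3_def)
  have c13: "?x1 \<otimes> x3 = x3 \<otimes> ?x1"
    unfolding x3_def by (subst adjust[OF _ _ _ _ _ _ _ _ t1]) simp_all
  have c23: "x2 \<otimes> x3 = x3 \<otimes> x2"
    unfolding x3_def by (subst adjust[OF _ _ _ _ _ _ _ _ t2]) (simp_all add: x2)
  show ?thesis by (rule that[of ?x1 x2 x3]) (use x2 x3 c12 c13 c23 in simp_all)
qed

definition eta :: "'k vec3 \<Rightarrow> 'a" where
  "eta = prod3 (lift 0 0 e1) (lift 0 0 e2) (lift 0 0 e3)"

lemma eta [simp]: "eta w \<in> carrier K" "A (eta w) = 0" "B (eta w) = 0" "W (eta w) = w"
  by (cases w, simp add: eta_def prod3_coords)+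

lemma eta_add: "eta (w + w') = eta w \<otimes> eta w'"
  unfolding eta_def by (rule prod3_add) (simp_all add: N_commute)

lemma eta_0 [simp]: "eta 0 = \<one>"
  by (simp add: eta_def prod3_def zero_vec3_def)

text \<open>The relation satisfied in the model groups by an element with only coordinate
  \<open>a\<close> and one with only coordinate \<open>b\<close>. The half is the quadratic term of
  the exponential.\<close>

definition acts :: "'k vec3 \<Rightarrow> 'a \<Rightarrow> 'k vec3 \<Rightarrow> 'a \<Rightarrow> bool" where
  "acts a k b y \<longleftrightarrow> k \<otimes> y = sc (tri a a b / 2) (y \<otimes> (eta (phi a b) \<otimes> k))"

lemma acts_mult_right:
  assumes "acts a k b y" "acts a k b' y'" "k \<in> carrier K" "y \<in> carrier K" "y' \<in> carrier K" "A y' = 0"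
  shows "acts a k (b + b') (y \<otimes> y')"
proof -
  have c: "eta (phi a b) \<otimes> y' = y' \<otimes> eta (phi a b)" using N_commute[of y' "eta (phi a b)"] assms by simp
  have "k \<otimes> (y \<otimes> y') = sc (tri a a b / 2) (y \<otimes> (eta (phi a b) \<otimes> (k \<otimes> y')))"
    using assms(1) assms(3-5) unfolding acts_def by (simp flip: m_assoc)
  also have "\<dots> = sc (tri a a b / 2 + tri a a b' / 2) (y \<otimes> (eta (phi a b) \<otimes> y' \<otimes> (eta (phi a b') \<otimes> k)))"
    using assms(2) assms(3-5) unfolding acts_def by (simp add: m_assoc)
  also have "\<dots> = sc (tri a a (b + b') / 2) (y \<otimes> y' \<otimes> (eta (phi a (b + b')) \<otimes> k))"
    unfolding c using assms(3-5) by (simp add: m_assoc tri_add phi_add_right eta_add add_divide_distrib)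
  finally show ?thesis unfolding acts_def .
qed

text \<open>Moving \<open>k\<close> past \<open>eta (phi a' b)\<close> costs
  \<open>tri a a' b\<close>. This is the cross term that completes the two halves to half the square
  of \<open>a + a'\<close>.\<close>

lemma acts_mult_left:
  assumes "acts a k b y" "acts a' k' b y" "k \<in> carrier K" "k' \<in> carrier K" "y \<in> carrier K" "A k = a"
  shows "acts (a + a') (k \<otimes> k') b y"
proof -
  have c: "k \<otimes> eta (phi a' b) = sc (tri a a' b) (eta (phi a' b) \<otimes> k)"
    using normal[of k "eta (phi a' b)"] assms by (simp add: dot_phi)
  have "k \<otimes> k' \<otimes> y = sc (tri a' a' b / 2) (k \<otimes> y \<otimes> (eta (phi a' b) \<otimes> k'))"
    using assms(2-5) unfolding acts_def by (simp add: m_assoc)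
  also have "\<dots> = sc (tri a' a' b / 2 + tri a a b / 2) (y \<otimes> (eta (phi a b) \<otimes> (k \<otimes> eta (phi a' b) \<otimes> k')))"
    using assms(1) assms(3-5) unfolding acts_def by (simp add: m_assoc)
  also have "\<dots> = sc (tri (a + a') (a + a') b / 2) (y \<otimes> (eta (phi (a + a') b) \<otimes> (k \<otimes> k')))"
    unfolding c using assms(3-5)
    by (simp add: m_assoc tri_square_add phi_add_left eta_add add_divide_distrib add_ac)
  finally show ?thesis unfolding acts_def .
qed

lemma acts_one: "k \<in> carrier K \<Longrightarrow> acts a k 0 \<one>" "y \<in> carrier K \<Longrightarrow> acts 0 \<one> b y"
  by (simp_all add: acts_def)

lemma acts_sc: "acts a k b y \<Longrightarrow> k \<in> carrier K \<Longrightarrow> y \<in> carrier K \<Longrightarrow> acts a k b (sc t y)"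
  by (simp add: acts_def add.commute)

lemma acts_pw_right:
  assumes "acts a k b y" "k \<in> carrier K" "y \<in> carrier K" "A y = 0"
  shows "acts a k (smul c b) (pw y c)"
proof (rule pw_induct[where Q = "\<lambda>c u. acts a k (smul c b) u", OF assms(3)])
  show "acts a k (smul 0 b) \<one>" using assms by (simp add: acts_one)
  fix c u assume "u \<in> carrier K" "acts a k (smul c b) u"
  then show "acts a k (smul (c + 1) b) (u \<otimes> y)" using assms by (simp add: smul_add_left acts_mult_right)
qed

lemma acts_pw_left:
  assumes "acts a k b y" "k \<in> carrier K" "y \<in> carrier K" "A k = a"
  shows "acts (smul c a) (pw k c) b y"
proof -
  have "A (pw k c) = smul c a \<and> acts (smul c a) (pw k c) b y"
  proof (rule pw_induct[where Q = "\<lambda>c u. A u = smul c a \<and> acts (smul c a) u b y", OF assms(2)])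
    show "A \<one> = smul 0 a \<and> acts (smul 0 a) \<one> b y" using assms by (simp add: acts_one)
    fix c u assume "u \<in> carrier K" "A u = smul c a \<and> acts (smul c a) u b y"
    then show "A (u \<otimes> k) = smul (c + 1) a \<and> acts (smul (c + 1) a) (u \<otimes> k) b y"
      using assms by (simp add: smul_add_left acts_mult_left)
  qed
  then show ?thesis ..
qed

lemma acting_lift:
  assumes x: "x1 \<in> carrier K" "x2 \<in> carrier K" "x3 \<in> carrier K"
    "A x1 = e1" "A x2 = e2" "A x3 = e3" "B x1 = 0" "B x2 = 0" "B x3 = 0"
  obtains y where "y \<in> carrier K" "A y = 0" "B y = b" "acts e1 x1 b y" "acts e2 x2 b y" "acts e3 x3 b y"
proof -
  let ?y = "lift 0 b 0"
  have *: "\<exists>t. k \<otimes> ?y = sc t (?y \<otimes> (eta (phi a b) \<otimes> k))" if "k \<in> carrier K" "A k = a" "B k = 0" for k a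
    by (rule same_coords) (use that in \<open>simp_all add: add_ac\<close>)
  obtain t1 where t1: "x1 \<otimes> ?y = sc t1 (?y \<otimes> (eta (phi e1 b) \<otimes> x1))" using *[of x1 e1] x by blast
  obtain t2 where t2: "x2 \<otimes> ?y = sc t2 (?y \<otimes> (eta (phi e2 b) \<otimes> x2))" using *[of x2 e2] x by blast
  obtain t3 where t3: "x3 \<otimes> ?y = sc t3 (?y \<otimes> (eta (phi e3 b) \<otimes> x3))" using *[of x3 e3] x by blast
  \<comment> \<open>Three central factors have to be corrected by one vector. The
    \<open>i\<close>-th coordinate affects only the relation with \<open>x\<^sub>i\<close>, so the
    system is diagonal.\<close>
  define w where "w = Vec (tri e1 e1 b / 2 - t1) (tri e2 e2 b / 2 - t2) (tri e3 e3 b / 2 - t3)"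
  have d: "t1 + dot w e1 = tri e1 e1 b / 2" "t2 + dot w e2 = tri e2 e2 b / 2" "t3 + dot w e3 = tri e3 e3 b / 2"
    by (simp_all add: w_def)
  let ?z = "?y \<otimes> lift 0 0 w"
  have "acts e1 x1 b ?z" unfolding acts_def using adjust[OF _ _ _ _ _ _ _ _ t1, of "lift 0 0 w"] x
    by (simp only: lift eta d simp_thms)
  moreover have "acts e2 x2 b ?z" unfolding acts_def using adjust[OF _ _ _ _ _ _ _ _ t2, of "lift 0 0 w"] x
    by (simp only: lift eta d simp_thms)
  moreover have "acts e3 x3 b ?z" unfolding acts_def using adjust[OF _ _ _ _ _ _ _ _ t3, of "lift 0 0 w"] x
    by (simp only: lift eta d simp_thms)
  ultimately show ?thesis by (intro that[of ?z]) simp_all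
qed

text \<open>The lifts \<open>x1, x2, x3\<close> commute and act on \<open>y1, y2, y3\<close> as in
  the model groups. Nothing is left undetermined but the three commutators of the \<open>y\<close>,
  and these form the vector \<open>v\<close>. Writing elements in the order \<open>b\<close>,
  \<open>w\<close>, \<open>a\<close> gives an injective homomorphism from a model group, and the
  orders agree.\<close>

theorem iso_desc_group:
  assumes "Coset.order K = CARD('k) ^ 10"
  shows "\<exists>v :: 'k vec3. desc_group v \<cong> K"
proof -
  obtain x1 x2 x3 where x: "x1 \<in> carrier K" "x2 \<in> carrier K" "x3 \<in> carrier K"
    "A x1 = e1" "A x2 = e2" "A x3 = e3" "B x1 = 0" "B x2 = 0" "B x3 = 0"
    and xc: "x1 \<otimes> x2 = x2 \<otimes> x1" "x1 \<otimes> x3 = x3 \<otimes> x1" "x2 \<otimes> x3 = x3 \<otimes> x2"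
    by (rule commuting_lifts)
  obtain y1 where y1: "y1 \<in> carrier K" "A y1 = 0" "B y1 = e1" "acts e1 x1 e1 y1" "acts e2 x2 e1 y1" "acts e3 x3 e1 y1"
    by (rule acting_lift[OF x])
  obtain y2 where y2: "y2 \<in> carrier K" "A y2 = 0" "B y2 = e2" "acts e1 x1 e2 y2" "acts e2 x2 e2 y2" "acts e3 x3 e2 y2"
    by (rule acting_lift[OF x])
  obtain y3 where y3: "y3 \<in> carrier K" "A y3 = 0" "B y3 = e3" "acts e1 x1 e3 y3" "acts e2 x2 e3 y3" "acts e3 x3 e3 y3"
    by (rule acting_lift[OF x])
  define h12 where "h12 = br y1 y2"
  define h13 where "h13 = br y1 y3"
  define h23 where "h23 = br y2 y3"
  have h: "y1 \<otimes> y2 = sc h12 (y2 \<otimes> y1)" "y1 \<otimes> y3 = sc h13 (y3 \<otimes> y1)" "y2 \<otimes> y3 = sc h23 (y3 \<otimes> y2)"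
    unfolding h12_def h13_def h23_def using y1 y2 y3 by (auto intro!: br)
  \<comment> \<open>With these entries \<open>det3 v\<close> is the alternating form whose values on
    pairs of unit vectors are \<open>h12\<close>, \<open>h13\<close>, \<open>h23\<close>.\<close>
  define v where "v = Vec h23 (- h13) h12"
  define Y where "Y = prod3 y1 y2 y3"
  \<comment> \<open>Collection leaves the cocycle
    \<open>- (c1 b2 h12 + c1 b3 h13 + c2 b3 h23)\<close>, which is not alternating. This quadratic
    form has the difference from \<open>det3 v b b' / 2\<close> as its coboundary.\<close>
  define q where "q b = (case b of Vec b1 b2 b3 \<Rightarrow> (h12 * b1 * b2 + h13 * b1 * b3 + h23 * b2 * b3) / 2)" for b
  define io where "io b = sc (- q b) (Y b)" for b
  define ex where "ex = prod3 x1 x2 x3"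
  have Yc [simp]: "Y b \<in> carrier K" "A (Y b) = 0" "B (Y b) = b" for b
    using y1 y2 y3 by (cases b, simp add: Y_def prod3_coords)+
  have ioc [simp]: "io b \<in> carrier K" "A (io b) = 0" "B (io b) = b" for b
    by (simp_all add: io_def)
  have exc [simp]: "ex a \<in> carrier K" "A (ex a) = a" "B (ex a) = 0" for a
    using x by (cases a, simp add: ex_def prod3_coords)+
  have ex_add: "ex (a + a') = ex a \<otimes> ex a'" for a a'
    unfolding ex_def using x xc by (intro prod3_add) simp_all
  have io_mult: "io b \<otimes> io b' = sc (det3 v b b' / 2) (io (b + b'))" for b b'
  proof -
    obtain b1 b2 b3 c1 c2 c3 where b: "b = Vec b1 b2 b3" "b' = Vec c1 c2 c3" by (cases b; cases b')
    have "Y b \<otimes> Y b' = sc (- (c1 * b2 * h12 + c1 * b3 * h13 + c2 * b3 * h23)) (Y (b + b'))"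
      unfolding b Y_def plus_vec3.simps by (rule prod3_mult[OF y1(1) y2(1) y3(1) h])
    moreover have "- q b - q b' - (c1 * b2 * h12 + c1 * b3 * h13 + c2 * b3 * h23) = det3 v b b' / 2 - q (b + b')"
      by (simp add: q_def b v_def field_simps)
    ultimately show ?thesis by (simp add: io_def algebra_simps)
  qed
  have act_Y: "acts a k b (Y b)" if "acts a k e1 y1" "acts a k e2 y2" "acts a k e3 y3" "k \<in> carrier K" for a k b
  proof -
    obtain b1 b2 b3 where b: "b = Vec b1 b2 b3" by (cases b)
    have "acts a k (smul b1 e1 + (smul b2 e2 + smul b3 e3)) (pw y1 b1 \<otimes> (pw y2 b2 \<otimes> pw y3 b3))"
      using that y1 y2 y3 by (intro acts_mult_right acts_pw_right) (simp_all add: pw_coords)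
    then show ?thesis by (simp add: b Y_def prod3_def)
  qed
  have act_io: "acts a k b (io b)" if "acts a k e1 y1" "acts a k e2 y2" "acts a k e3 y3" "k \<in> carrier K" for a k b
    unfolding io_def using that by (intro acts_sc act_Y) simp_all
  have act: "acts a (ex a) b (io b)" for a b
  proof -
    obtain a1 a2 a3 where a: "a = Vec a1 a2 a3" by (cases a)
    have "acts (smul a1 e1 + (smul a2 e2 + smul a3 e3)) (pw x1 a1 \<otimes> (pw x2 a2 \<otimes> pw x3 a3)) b (io b)"
      using x y1 y2 y3 by (intro acts_mult_left acts_pw_left act_io) (simp_all add: pw_coords)
    then show ?thesis by (simp add: a ex_def prod3_def)
  qed
  define f where "f g = sc (pZ g) (io (pB g) \<otimes> (eta (pW g) \<otimes> ex (pA g)))" for g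
  have hom: "f \<in> hom (desc_group v) K"
  proof (rule homI)
    fix g g' :: "'k elt"
    show "f g \<in> carrier K" by (simp add: f_def)
    obtain a b w z where g: "g = Elt a b w z" by (cases g)
    obtain a' b' w' z' where g': "g' = Elt a' b' w' z'" by (cases g')
    have ne: "ex a \<otimes> eta w' = sc (dot w' a) (eta w' \<otimes> ex a)" using normal[of "ex a" "eta w'"] by simp
    have ec: "eta w'' \<otimes> io b' = io b' \<otimes> eta w''" for w'' using N_commute[of "io b'" "eta w''"] by simp
    have en: "eta w1 \<otimes> eta w2 = eta (w1 + w2)" for w1 w2 by (simp add: eta_add)
    have "io b \<otimes> (eta w \<otimes> ex a) \<otimes> (io b' \<otimes> (eta w' \<otimes> ex a')) =
       io b \<otimes> (eta w \<otimes> (ex a \<otimes> io b' \<otimes> (eta w' \<otimes> ex a')))" by (simp add: m_assoc)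
    also have "\<dots> = sc (tri a a b' / 2) (io b \<otimes> (eta w \<otimes> io b' \<otimes> (eta (phi a b') \<otimes> (ex a \<otimes> eta w' \<otimes> ex a'))))"
      using act[of a b'] unfolding acts_def by (simp add: m_assoc)
    also have "\<dots> = sc (tri a a b' / 2 + dot w' a) (io b \<otimes> io b' \<otimes> (eta w \<otimes> eta (phi a b') \<otimes> eta w' \<otimes> (ex a \<otimes> ex a')))"
      unfolding ne ec by (simp add: m_assoc)
    also have "\<dots> = sc (tri a a b' / 2 + dot w' a + det3 v b b' / 2)
        (io (b + b') \<otimes> (eta (w + w' + phi a b') \<otimes> ex (a + a')))"
      unfolding io_mult en ex_add by (simp add: add_ac)
    finally show "f (g \<otimes>\<^bsub>desc_group v\<^esub> g') = f g \<otimes> f g'"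
      by (simp add: f_def g g' mult_desc_group add_divide_distrib add_ac)
  qed
  interpret H: group "desc_group v" by (rule group_desc_group)
  interpret f: group_hom "desc_group v" K f by unfold_locales (rule hom)
  have Y0: "Y 0 = \<one>" using y1 y2 y3 by (simp add: Y_def prod3_def zero_vec3_def)
  have io0: "io 0 = \<one>" using Y0 by (simp add: io_def q_def zero_vec3_def)
  have ex0: "ex 0 = \<one>" using x by (simp add: ex_def prod3_def zero_vec3_def)
  have "g = \<one>\<^bsub>desc_group v\<^esub>" if "f g = \<one>" for g
  proof -
    obtain a b w z where g: "g = Elt a b w z" by (cases g)
    have e: "sc z (io b \<otimes> (eta w \<otimes> ex a)) = \<one>" using that by (simp add: f_def g)
    have a: "a = 0" using arg_cong[OF e, of A] by simp
    have b: "b = 0" using arg_cong[OF e, of B] by simp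
    have w: "w = 0" using arg_cong[OF e, of W] by (simp add: a b io0 ex0)
    have "z = 0" using e by (simp add: a b w io0 ex0)
    then show ?thesis by (simp add: g a b w one_desc_group)
  qed
  then have inj: "inj f" using f.inj_on_one_iff by simp
  have "card (f ` UNIV) = card (carrier K)"
    using assms card_image[OF inj] by (simp add: CARD_elt Coset.order_def)
  moreover have "finite (carrier K)" using assms by (intro card_ge_0_finite) (simp add: Coset.order_def)
  moreover have "f ` UNIV \<subseteq> carrier K" using f.hom_closed by auto
  ultimately have "f ` UNIV = carrier K" using card_subset_eq by blast
  then have "f \<in> Group.iso (desc_group v) K" using hom inj by (simp add: iso_def bij_betw_def)
  then show ?thesis unfolding Group.is_iso_def by blast
qed

end

text \<open>The three coordinate vectors take \<open>p\<^sup>9\<close> values, and each fibre is a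
  coset of the third term.\<close>

lemma card_lower_central_3:
  assumes K: "group K" and D: "desc_coords K A B (W :: 'g \<Rightarrow> 'k::prime_field vec3)"
    and ord: "Coset.order K = CARD('k) ^ 10"
  shows "card (lower_central K 3) = CARD('k)"
proof -
  interpret group K by fact
  define s where "s m = (SOME x. x \<in> carrier K \<and> A x = fst m \<and> B x = fst (snd m) \<and> W x = snd (snd m))" for m
  have s: "s m \<in> carrier K" "A (s m) = fst m" "B (s m) = fst (snd m)" "W (s m) = snd (snd m)" for m
  proof -
    obtain x where "x \<in> carrier K" "A x = fst m" "B x = fst (snd m)" "W x = snd (snd m)"
      by (rule desc_coords_onto[OF D])
    then have "\<exists>x. x \<in> carrier K \<and> A x = fst m \<and> B x = fst (snd m) \<and> W x = snd (snd m)"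
      by (intro exI[of _ x] conjI)
    from someI_ex[OF this, folded s_def]
    show "s m \<in> carrier K" "A (s m) = fst m" "B (s m) = fst (snd m)" "W (s m) = snd (snd m)" by simp_all
  qed
  note c = desc_coords_mult[OF D] desc_coords_inv[OF K D]
  note ker = desc_coords_kernel[OF D]
  have "bij_betw (\<lambda>(z, m). z \<otimes>\<^bsub>K\<^esub> s m) (lower_central K 3 \<times> UNIV) (carrier K)"
  proof (rule bij_betw_imageI)
    show "inj_on (\<lambda>(z, m). z \<otimes>\<^bsub>K\<^esub> s m) (lower_central K 3 \<times> UNIV)"
    proof (rule inj_onI, clarify)
      fix z z' m m' assume z: "z \<in> lower_central K 3" "z' \<in> lower_central K 3" and e: "z \<otimes>\<^bsub>K\<^esub> s m = z' \<otimes>\<^bsub>K\<^esub> s m'"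
      have "m = m'"
        using arg_cong[OF e, of A] arg_cong[OF e, of B] arg_cong[OF e, of W] z s[of m] s[of m']
        by (simp add: ker c prod_eq_iff)
      then show "z = z' \<and> m = m'" using e z s[of m] by (simp add: ker)
    qed
    show "(\<lambda>(z, m). z \<otimes>\<^bsub>K\<^esub> s m) ` (lower_central K 3 \<times> UNIV) = carrier K"
    proof
      show "(\<lambda>(z, m). z \<otimes>\<^bsub>K\<^esub> s m) ` (lower_central K 3 \<times> UNIV) \<subseteq> carrier K"
        using s by (auto simp: ker)
      show "carrier K \<subseteq> (\<lambda>(z, m). z \<otimes>\<^bsub>K\<^esub> s m) ` (lower_central K 3 \<times> UNIV)"
      proof
        fix x assume x: "x \<in> carrier K"
        let ?m = "(A x, B x, W x)"
        have "x \<otimes>\<^bsub>K\<^esub> inv\<^bsub>K\<^esub> s ?m \<in> lower_central K 3" using x s[of ?m] by (simp add: ker c phi_uminus)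
        moreover have "x = x \<otimes>\<^bsub>K\<^esub> inv\<^bsub>K\<^esub> s ?m \<otimes>\<^bsub>K\<^esub> s ?m" using x s[of ?m] by (simp add: m_assoc)
        ultimately show "x \<in> (\<lambda>(z, m). z \<otimes>\<^bsub>K\<^esub> s m) ` (lower_central K 3 \<times> UNIV)"
          by (intro image_eqI[of _ _ "(x \<otimes>\<^bsub>K\<^esub> inv\<^bsub>K\<^esub> s ?m, ?m)"]) simp_all
      qed
    qed
  qed
  then have "card (lower_central K 3) * CARD('k) ^ 9 = CARD('k) ^ 10"
    using ord bij_betw_same_card by (force simp: Coset.order_def card_cartesian_product CARD_vec3 eval_nat_numeral ac_simps)
  then have "card (lower_central K 3) * CARD('k) ^ 9 = CARD('k) * CARD('k) ^ 9" by (simp add: eval_nat_numeral)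
  then show ?thesis by (simp only: mult_cancel2 power_eq_0_iff) simp
qed

text \<open>The third term has order \<open>p\<close>, so it is the set of powers of any nontrivial
  element \<open>z0\<close>. Field elements serve as exponents of \<open>z0\<close>, and
  multiplication by such a power is \<open>sc\<close>.\<close>

lemma is_desc_imp_central_ext:
  fixes K :: "('g, 'm) monoid_scheme"
  assumes K: "group K" and D: "is_desc CARD('k::prime_field) K"
  obtains A B W and sc :: "'k::prime_field \<Rightarrow> 'g \<Rightarrow> 'g" where "central_ext K A B W sc"
proof -
  interpret group K by fact
  let ?Z = "lower_central K 3"
  obtain A B W :: "'g \<Rightarrow> 'k vec3" where d: "desc_coords K A B W" using D is_desc_iff[OF K, where 'k = 'k] by blast
  have ord: "Coset.order K = CARD('k) ^ 10" and c4: "lower_central K (Suc 3) = {\<one>\<^bsub>K\<^esub>}" and c3: "?Z \<noteq> {\<one>\<^bsub>K\<^esub>}"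
    and expo: "\<And>x. x \<in> carrier K \<Longrightarrow> x [^]\<^bsub>K\<^esub> CARD('k) = \<one>\<^bsub>K\<^esub>"
    using D is_desc_iff[OF K, where 'k = 'k] by simp_all
  have cardZ: "card ?Z = CARD('k)" by (rule card_lower_central_3[OF K d ord])
  have subZ: "subgroup ?Z K" by (rule lower_central_subgroup[OF K])
  have Zc: "?Z \<subseteq> carrier K" by (rule lower_central_subset[OF K])
  have central: "z \<otimes>\<^bsub>K\<^esub> x = x \<otimes>\<^bsub>K\<^esub> z" if "z \<in> ?Z" "x \<in> carrier K" for z x
    by (rule commutator_subgroup_trivialD[OF K c4[unfolded lower_central_Suc3(1)] Zc that])
  obtain z0 where z0: "z0 \<in> ?Z" "z0 \<noteq> \<one>\<^bsub>K\<^esub>" using c3 subgroup.one_closed[OF subZ] by blast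
  have z0c: "z0 \<in> carrier K" using z0 Zc by blast
  have ordz: "ord z0 = CARD('k)"
  proof -
    have "ord z0 dvd CARD('k)" using expo[OF z0c] z0c by (simp add: pow_eq_id)
    moreover have "ord z0 \<noteq> 1" using z0c z0 ord_eq_1 by auto
    ultimately show ?thesis using prime_CARD[where 'k = 'k] unfolding prime_nat_iff by blast
  qed
  define zt where "zt t = z0 [^]\<^bsub>K\<^esub> nat (rep t)" for t :: 'k
  have "z0 [^]\<^bsub>K\<^esub> (n::nat) \<in> ?Z" for n
    by (induction n) (simp_all add: subgroup.one_closed[OF subZ] subgroup.m_closed[OF subZ] z0(1))
  then have ztZ: "zt t \<in> ?Z" for t by (simp add: zt_def)
  have ztc [simp]: "zt t \<in> carrier K" for t using ztZ Zc by blast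
  have zt_nat: "zt (of_nat n) = z0 [^]\<^bsub>K\<^esub> n" for n
  proof -
    have "rep (of_nat n :: 'k) = int (n mod CARD('k))" using rep_of_int[of "int n", where 'k = 'k] by (simp add: zmod_int)
    then have "zt (of_nat n) = z0 [^]\<^bsub>K\<^esub> (n mod CARD('k))" by (simp add: zt_def)
    also have "\<dots> = (z0 [^]\<^bsub>K\<^esub> CARD('k)) [^]\<^bsub>K\<^esub> (n div CARD('k)) \<otimes>\<^bsub>K\<^esub> z0 [^]\<^bsub>K\<^esub> (n mod CARD('k))"
      using z0c by (simp add: expo)
    also have "\<dots> = z0 [^]\<^bsub>K\<^esub> (CARD('k) * (n div CARD('k)) + n mod CARD('k))"
      using z0c by (simp only: nat_pow_mult nat_pow_pow nat_pow_closed)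
    finally show ?thesis by simp
  qed
  have zt_add: "zt (s + t) = zt s \<otimes>\<^bsub>K\<^esub> zt t" for s t
  proof -
    obtain n where n: "s = of_nat n" using of_nat_onto by blast
    obtain m where m: "t = of_nat m" using of_nat_onto by blast
    show ?thesis using zt_nat[of "n + m"] z0c by (simp add: n m zt_nat nat_pow_mult)
  qed
  have zt_inj: "inj zt"
  proof (rule injI)
    fix s t assume e: "zt s = zt t"
    have "rep s \<in> {0..<int CARD('k)}" "rep t \<in> {0..<int CARD('k)}" by (rule rep_range)+
    moreover from this have "nat (rep s) = nat (rep t)"
      using inj_onD[OF ord_inj[OF z0c] e[unfolded zt_def]] by (simp add: ordz) linarith
    ultimately have "rep s = rep t" by (simp add: eq_nat_nat_iff)
    then have "of_int (rep s) = (of_int (rep t) :: 'k)" by (rule arg_cong)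
    then show "s = t" by (simp only: of_int_rep)
  qed
  have ztr: "range zt = ?Z"
  proof (rule card_subset_eq)
    show "finite ?Z" using cardZ by (intro card_ge_0_finite) simp
    show "card (range zt) = card ?Z" using cardZ card_image[OF zt_inj] by simp
  qed (use ztZ in blast)
  define sc where "sc t x = zt t \<otimes>\<^bsub>K\<^esub> x" for t x
  note ker = desc_coords_kernel[OF d]
  have zt0: "zt 0 = \<one>\<^bsub>K\<^esub>" using zt_nat[of 0] by simp
  have ztco: "A (zt t) = 0" "B (zt t) = 0" "W (zt t) = 0" for t using ztZ[of t] unfolding ker by simp_all
  have "central_ext K A B W sc"
  proof
    show "desc_coords K A B W" by (rule d)
    fix x y s t assume x: "x \<in> carrier K"
    show "sc t x \<in> carrier K" "sc 0 x = x" "sc s (sc t x) = sc (s + t) x"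
      using x by (simp_all add: sc_def zt0 zt_add m_assoc)
    show "A (sc t x) = A x" "B (sc t x) = B x" "W (sc t x) = W x"
      using x by (simp_all add: sc_def desc_coords_mult[OF d] ztco)
    show "x [^]\<^bsub>K\<^esub> CARD('k) = \<one>\<^bsub>K\<^esub>" using x by (rule expo)
    show "s = t" if "sc s x = sc t x" using that x zt_inj by (simp add: sc_def inj_eq)
    assume y: "y \<in> carrier K"
    show "sc t x \<otimes>\<^bsub>K\<^esub> y = sc t (x \<otimes>\<^bsub>K\<^esub> y)" using x y by (simp add: sc_def m_assoc)
    have "x \<otimes>\<^bsub>K\<^esub> (zt t \<otimes>\<^bsub>K\<^esub> y) = zt t \<otimes>\<^bsub>K\<^esub> x \<otimes>\<^bsub>K\<^esub> y"
      unfolding central[OF ztZ x] using x y by (simp add: m_assoc)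
    then show "x \<otimes>\<^bsub>K\<^esub> sc t y = sc t (x \<otimes>\<^bsub>K\<^esub> y)" using x y by (simp add: sc_def m_assoc)
    show "\<exists>t. x = sc t y" if "A x = A y" "B x = B y" "W x = W y"
    proof -
      have "x \<otimes>\<^bsub>K\<^esub> inv\<^bsub>K\<^esub> y \<in> range zt"
        unfolding ztr ker using x y that by (simp add: desc_coords_mult[OF d] desc_coords_inv[OF K d] phi_uminus)
      then obtain t where "x \<otimes>\<^bsub>K\<^esub> inv\<^bsub>K\<^esub> y = zt t" by blast
      then have "x = sc t y" using x y by (metis inv_solve_right' sc_def ztc)
      then show ?thesis by blast
    qed
  qed
  then show ?thesis by (rule that)
qed

theorem is_desc_imp_iso:
  assumes "group K" "is_desc CARD('k::prime_field) K"
  shows "\<exists>v :: 'k vec3. desc_group v \<cong> K"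
proof -
  obtain A B W and sc :: "'k \<Rightarrow> 'a \<Rightarrow> 'a" where c: "central_ext K A B W sc"
    using is_desc_imp_central_ext[OF assms] by blast
  obtain A' B' W' where "normal_ext K A' B' W' sc" using central_ext.normalize[OF c] by blast
  then show ?thesis using normal_ext.iso_desc_group is_desc_iff[OF assms(1), where 'k = 'k] assms(2) by blast
qed

section \<open>Orbits and rational flexes\<close>

text \<open>Pairs \<open>(f, x)\<close> with \<open>f x = x\<close> are counted twice. Within an
  orbit, composition with a \<open>g\<close> such that \<open>x = g y\<close> matches the maps
  sending \<open>x\<close> to \<open>y\<close> with the stabilizer of \<open>y\<close>, so the
  stabilizers along one orbit add up to \<open>card G\<close>.\<close>

lemma burnside:
  fixes G :: "('a::finite \<Rightarrow> 'a) set"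
  assumes id: "id \<in> G" and comp: "\<And>f g. f \<in> G \<Longrightarrow> g \<in> G \<Longrightarrow> f \<circ> g \<in> G"
    and inv: "\<And>f. f \<in> G \<Longrightarrow> inv_into UNIV f \<in> G" and bij: "\<And>f. f \<in> G \<Longrightarrow> bij f"
  shows "card (UNIV // {(x, y). \<exists>f\<in>G. y = f x}) * card G = (\<Sum>f\<in>G. card {x. f x = x})"
proof -
  let ?r = "{(x, y). \<exists>f\<in>G. y = f x}"
  have fin: "finite G" by simp
  have eq: "equiv UNIV ?r"
  proof (rule equivI)
    show "refl_on UNIV ?r" using id by (auto simp: refl_on_def intro!: bexI[of _ id])
    show "sym ?r"
    proof (rule symI, clarify)
      fix x f assume f: "f \<in> G"
      then show "\<exists>g\<in>G. x = g (f x)"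
        using inv[OF f] bij[OF f] by (intro bexI[of _ "inv_into UNIV f"]) (simp_all add: bij_is_inj)
    qed
    show "trans ?r"
    proof (rule transI, clarify)
      fix x f g assume "f \<in> G" "g \<in> G"
      then show "\<exists>h\<in>G. g (f x) = h x" using comp by (intro bexI[of _ "g \<circ> f"]) auto
    qed
  qed simp
  have orbit: "(\<Sum>x\<in>c. card {f \<in> G. f x = x}) = card G" if c: "c \<in> UNIV // ?r" for c
  proof -
    obtain x where x: "c = ?r `` {x}" using c by (rule quotientE)
    have "card G = card (\<Union>y\<in>c. {f \<in> G. f x = y})"
      by (rule arg_cong[of _ _ card]) (auto simp: x)
    also have "\<dots> = (\<Sum>y\<in>c. card {f \<in> G. f x = y})" by (rule card_UN_disjoint) auto
    also have "\<dots> = (\<Sum>y\<in>c. card {f \<in> G. f y = y})"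
    proof (rule sum.cong[OF refl])
      fix y assume "y \<in> c"
      then have xy: "(x, y) \<in> ?r" by (simp add: x)
      then have "(y, x) \<in> ?r" using eq by (meson equiv_def symE)
      then obtain g where g: "g \<in> G" "x = g y" by auto
      let ?i = "inv_into UNIV g"
      have gi: "?i (g z) = z" "g (?i z) = z" for z
        using bij[OF g(1)] by (simp_all add: bij_is_inj bij_is_surj surj_f_inv_f)
      have "bij_betw (\<lambda>f. f \<circ> g) {f \<in> G. f x = y} {f \<in> G. f y = y}"
      proof (rule bij_betwI[of _ _ _ "\<lambda>f. f \<circ> ?i"])
        show "(\<lambda>f. f \<circ> g) \<in> {f \<in> G. f x = y} \<rightarrow> {f \<in> G. f y = y}" using g comp by auto
        show "(\<lambda>f. f \<circ> ?i) \<in> {f \<in> G. f y = y} \<rightarrow> {f \<in> G. f x = y}" using g comp inv gi by auto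
      qed (auto simp: gi fun_eq_iff)
      then show "card {f \<in> G. f x = y} = card {f \<in> G. f y = y}" by (rule bij_betw_same_card)
    qed
    finally show ?thesis by simp
  qed
  have "(\<Sum>f\<in>G. card {x. f x = x}) = (\<Sum>f\<in>G. \<Sum>x\<in>UNIV. if f x = x then 1 else 0)"
    by (simp add: sum.If_cases)
  also have "\<dots> = (\<Sum>x\<in>UNIV. \<Sum>f\<in>G. if f x = x then 1 else 0)" by (rule sum.swap)
  also have "\<dots> = (\<Sum>x\<in>UNIV. card {f \<in> G. f x = x})" by (simp add: sum.If_cases Int_def)
  also have "\<dots> = (\<Sum>x\<in>\<Union> (UNIV // ?r). card {f \<in> G. f x = x})" by (simp add: Union_quotient[OF eq])
  also have "\<dots> = (\<Sum>c\<in>UNIV // ?r. \<Sum>x\<in>c. card {f \<in> G. f x = x})"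
    by (subst sum.Union_disjoint) (use quotient_disj[OF eq] in auto)
  also have "\<dots> = (\<Sum>c\<in>UNIV // ?r. card G)" by (intro sum.cong refl orbit)
  finally show ?thesis by simp
qed

text \<open>For \<open>d ^ 4 = 1\<close> these are the automorphisms of the curve that fix the
  origin \<open>e3\<close>: in the chart \<open>x = 1\<close>, the complex multiplication
  \<open>(u, v) \<mapsto> (d\<^sup>2 u, d v)\<close>.\<close>

fun diagm :: "'k::comm_ring_1 \<Rightarrow> 'k vec3 \<Rightarrow> 'k vec3" where
  "diagm d (Vec x y z) = Vec x (d * d * y) (d * z)"

text \<open>Parameters of the rational flexes other than \<open>e3\<close>: the flex reached from
  \<open>e3\<close> by \<open>reflm b\<close> is
  \<open>(1, - b\<^sup>2, (1 + b\<^sup>4) / (2 b))\<close> up to a factor. The equation says that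
  \<open>- b\<^sup>2\<close> is a root of \<open>u\<^sup>4 + 6 u\<^sup>2 - 3\<close>.\<close>

definition froots :: "'k::prime_field set" where
  "froots = {b. b ^ 8 + 6 * b ^ 4 = 3}"

fun lform :: "'k::comm_ring_1 \<Rightarrow> 'k vec3 \<Rightarrow> 'k" where
  "lform b (Vec x y z) = 2 * b * z - (b ^ 4 + 3) * x + 2 * b\<^sup>2 * y"

fun tform :: "'k::comm_ring_1 \<Rightarrow> 'k vec3 \<Rightarrow> 'k" where
  "tform b (Vec x y z) = 2 * b * z + (1 - b ^ 4) * x - 2 * b\<^sup>2 * y"

definition flexpt :: "'k::comm_ring_1 \<Rightarrow> 'k vec3" where
  "flexpt b = Vec (2 * b) (- 2 * b ^ 3) (- (1 + b ^ 4))"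

text \<open>Up to the scalar \<open>4 b (1 + b\<^sup>4)\<close> this is the reflection whose centre is the flex \<open>flexpt b\<close> and
  whose axis is the harmonic polar \<open>lform b = 0\<close> of that flex; \<open>tform b = 0\<close> is the flex tangent.\<close>

definition reflm :: "'k::comm_ring_1 \<Rightarrow> 'k vec3 \<Rightarrow> 'k vec3" where
  "reflm b x = smul (4 * b * (1 + b ^ 4)) x + smul (lform b x) (flexpt b)"

lemma frootsD:
  assumes "b \<in> froots" shows "b ^ 8 + 6 * b ^ 4 = 3" "b \<noteq> 0" "1 + b ^ 4 \<noteq> 0"
proof -
  show e: "b ^ 8 + 6 * b ^ 4 = 3" using assms by (simp add: froots_def)
  show "b \<noteq> 0"
  proof
    assume "b = 0"
    then have "0 = (3::'a)" using e by simp
    then show False using three_neq_0[where 'a = 'a] by metis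
  qed
  show "1 + b ^ 4 \<noteq> 0"
  proof
    assume *: "1 + b ^ 4 = 0"
    have b4: "b ^ 4 = - 1" using * by (simp add: eq_neg_iff_add_eq_0 add.commute)
    have "b ^ 8 = b ^ 4 * b ^ 4" by (simp flip: power_add)
    then have "1 + 6 * (- 1) = (3::'a)" using e unfolding b4 by simp
    moreover have "2 * 2 * 2 = (3::'a) - (1 + 6 * (- 1))" by simp
    ultimately have "2 * 2 * 2 = (0::'a)" by simp
    then show False by (simp only: mult_eq_0_iff two_neq_0 simp_thms)
  qed
qed

lemma lform_add: "lform b (x + y) = lform b x + lform b y"
  by (cases x; cases y) (simp add: algebra_simps)

lemma lform_smul: "lform b (smul c x) = c * lform b x"
  by (cases x) (simp add: algebra_simps)

lemma reflm_additive: "additive (reflm b)"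
  by (simp add: additive_def reflm_def lform_add smul_add smul_add_left add_ac)

lemma reflm_smul: "reflm b (smul c x) = smul c (reflm b x)"
  by (simp add: reflm_def lform_smul smul_add smul_smul mult.commute)

text \<open>Minus twice the scalar in \<open>reflm\<close>: the centre gets the opposite eigenvalue
  of the axis, so the square of \<open>reflm b\<close> is a scalar.\<close>

lemma lform_flexpt: "lform b (flexpt b) = - 2 * (4 * b * (1 + b ^ 4))"
  by (simp add: flexpt_def algebra_simps eval_nat_numeral)

lemma reflm_reflm: "reflm b (reflm b x) = smul ((4 * b * (1 + b ^ 4))\<^sup>2) x"
proof -
  let ?s = "4 * b * (1 + b ^ 4)"
  have "reflm b (reflm b x) = smul ?s (smul ?s x + smul (lform b x) (flexpt b))
     + smul (?s * lform b x + lform b x * (- 2 * ?s)) (flexpt b)"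
    by (simp only: reflm_def lform_add lform_smul lform_flexpt)
  also have "\<dots> = smul (?s * ?s) x + smul (?s * lform b x + (?s * lform b x + lform b x * (- 2 * ?s))) (flexpt b)"
    by (simp only: smul_add smul_smul smul_add_left add.assoc)
  also have "?s * lform b x + (?s * lform b x + lform b x * (- 2 * ?s)) = 0" by (simp add: algebra_simps)
  finally show ?thesis by (simp add: power2_eq_square)
qed

text \<open>The polar conic of a flex splits into the flex tangent and the harmonic polar. In
  general the defect is a multiple of \<open>b\<^sup>8 + 6 b\<^sup>4 - 3\<close>, and it vanishes on
  \<open>froots\<close>.\<close>

lemma tri_flexpt:
  fixes b :: "'k::prime_field"
  assumes "b \<in> froots"
  shows "4 * b * tri (flexpt b) x y = tform b x * lform b y + tform b y * lform b x"
proof -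
  obtain x1 x2 x3 where x: "x = Vec x1 x2 x3" by (cases x)
  obtain y1 y2 y3 where y: "y = Vec y1 y2 y3" by (cases y)
  have e: "b ^ 8 + 6 * b ^ 4 = 3" using frootsD[OF assms] by simp
  have "4 * b * tri (flexpt b) x y =
     tform b x * lform b y + tform b y * lform b x - 2 * x1 * y1 * (b ^ 8 + 6 * b ^ 4 - 3)"
    unfolding x y tri_def flexpt_def phi.simps dot.simps tform.simps lform.simps by Groebner_Basis.algebra
  then show ?thesis by (simp add: e)
qed

text \<open>In the expansion every term with a copy of the flex becomes, by
  \<open>tri_flexpt\<close> and after multiplication by \<open>4 b\<close>, a combination of values
  of \<open>tform\<close> and \<open>lform\<close>. These cancel, and only \<open>tri x y z\<close>
  survives.\<close>

lemma reflm_cubic_group: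
  fixes b :: "'k::prime_field"
  assumes b: "b \<in> froots"
  shows "reflm b \<in> cubic_group"
proof (rule cubic_groupI[OF reflm_additive])
  let ?s = "4 * b * (1 + b ^ 4)" and ?q = "flexpt b"
  note fD = frootsD[OF b]
  have four: "(4::'k) \<noteq> 0" using two_neq_0 by (metis mult_2 mult_eq_0_iff numeral_Bit0)
  show "?s ^ 3 \<noteq> 0" using fD four by simp
  have tq: "tform b ?q = 0" by (simp add: flexpt_def) Groebner_Basis.algebra
  note T = tri_flexpt[OF b]
  fix x y z
  define Lx Ly Lz tx ty tz s where d: "Lx = lform b x" "Ly = lform b y" "Lz = lform b z"
    "tx = tform b x" "ty = tform b y" "tz = tform b z" "s = ?s"
  have e: "4 * b * tri ?q x y = tx * Ly + ty * Lx" "4 * b * tri ?q x z = tx * Lz + tz * Lx"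
    "4 * b * tri ?q y z = ty * Lz + tz * Ly"
    using T[of x y] T[of x z] T[of y z] by (simp_all add: d)
  have e': "4 * b * tri ?q ?q x = tx * (- 2 * s)" "4 * b * tri ?q ?q y = ty * (- 2 * s)"
    "4 * b * tri ?q ?q z = tz * (- 2 * s)" "4 * b * tri ?q ?q ?q = 0"
    using T[of ?q x] T[of ?q y] T[of ?q z] T[of ?q ?q] by (simp_all add: d tq lform_flexpt)
  have sy: "tri x y ?q = tri ?q x y" "tri x ?q z = tri ?q x z" "tri x ?q ?q = tri ?q ?q x"
     "tri ?q y ?q = tri ?q ?q y"
    by (simp_all add: tri_def) (cases x; cases y; cases z; cases ?q; simp add: algebra_simps)+
  have "tri (reflm b x) (reflm b y) (reflm b z) =
     s * s * s * tri x y z + s * s * Lz * tri ?q x y + s * s * Ly * tri ?q x z + s * s * Lx * tri ?q y z +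
     s * Ly * Lz * tri ?q ?q x + s * Lx * Lz * tri ?q ?q y + s * Lx * Ly * tri ?q ?q z + Lx * Ly * Lz * tri ?q ?q ?q"
    unfolding reflm_def d(7)[symmetric] d(1-3)[symmetric] tri_add tri_smul sy by (simp add: algebra_simps)
  then have "4 * b * tri (reflm b x) (reflm b y) (reflm b z) = 4 * b * (s * s * s * tri x y z)"
    using e e' by Groebner_Basis.algebra
  then have "tri (reflm b x) (reflm b y) (reflm b z) = s * s * s * tri x y z" using fD(2) four by simp
  then show "tri (reflm b x) (reflm b y) (reflm b z) = ?s ^ 3 * tri x y z"
    unfolding d(7) by (simp only: power3_eq_cube)
qed

lemma diagm_additive: "additive (diagm d)"
proof
  fix x y :: "'a vec3"
  show "diagm d (x + y) = diagm d x + diagm d y" by (cases x; cases y) (simp add: algebra_simps)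
qed

lemma diagm_cubic_group:
  fixes d :: "'k::prime_field"
  assumes d: "d ^ 4 = 1"
  shows "diagm d \<in> cubic_group"
proof (rule cubic_groupI[OF diagm_additive])
  show "d * d \<noteq> 0" using d by (auto simp: zero_power)
  fix x y z :: "'k vec3"
  obtain x1 x2 x3 where x: "x = Vec x1 x2 x3" by (cases x)
  obtain y1 y2 y3 where y: "y = Vec y1 y2 y3" by (cases y)
  obtain z1 z2 z3 where z: "z = Vec z1 z2 z3" by (cases z)
  show "tri (diagm d x) (diagm d y) (diagm d z) = d * d * tri x y z"
    unfolding x y z tri_def diagm.simps phi.simps dot.simps using d by Groebner_Basis.algebra
qed

text \<open>Values of the form on unit vectors kill the matrix entries off the diagonal one by one.
  The diagonal \<open>a1, b2, c\<close> satisfies \<open>b2\<^sup>2 = a1\<^sup>2\<close> and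
  \<open>c\<^sup>2 = a1 b2\<close>, so \<open>d = c / a1\<close> is a fourth root of unity.\<close>

lemma cubic_group_stab:
  fixes R :: "'k::prime_field vec3 \<Rightarrow> 'k vec3"
  assumes R: "R \<in> cubic_group" and e3: "R e3 = Vec 0 0 c"
  shows "\<exists>r d. r \<noteq> 0 \<and> d ^ 4 = 1 \<and> R = smul r \<circ> diagm d"
proof -
  obtain m where m: "m \<noteq> 0" "\<And>x y z. tri (R x) (R y) (R z) = m * tri x y z"
    using R by (auto simp: cubic_group_def)
  obtain a1 a2 a3 where a: "R e1 = Vec a1 a2 a3" by (cases "R e1")
  obtain b1 b2 b3 where b: "R e2 = Vec b1 b2 b3" by (cases "R e2")
  have c2: "c * c * a1 = m" using m(2)[of e3 e3 e1] unfolding a e3 by (simp add: tri_def algebra_simps)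
  then have c0: "c \<noteq> 0" "a1 \<noteq> 0" using m(1) by auto
  have b1: "b1 = 0" using m(2)[of e3 e3 e2] c0 unfolding b e3 by (simp add: tri_def)
  have "2 * (a1 * a3 * c) = 0" using m(2)[of e1 e1 e3] unfolding a e3 by (simp add: tri_def algebra_simps)
  then have a3: "a3 = 0" using c0 by simp
  have b3: "b3 = 0" using m(2)[of e1 e2 e3] c0 unfolding a b e3 by (simp add: tri_def b1)
  have b2: "b2 * b2 * b2 = m" using m(2)[of e2 e2 e2] unfolding b by (simp add: tri_def b1 b3)
  then have b20: "b2 \<noteq> 0" using m(1) by auto
  have a2: "a2 = 0" using m(2)[of e1 e2 e2] b20 unfolding a b by (simp add: tri_def b1 b3 a3)
  have "a1 * a1 * b2 = m" using m(2)[of e1 e1 e2] unfolding a b by (simp add: tri_def b1 b3 a3 a2)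
  then have b2a: "b2 * b2 = a1 * a1" using b2 b20 by (metis mult.commute mult_cancel_left)
  have "c * c * a1 = a1 * b2 * a1" using c2 \<open>a1 * a1 * b2 = m\<close> by (simp add: mult_ac)
  then have cc: "c * c = a1 * b2" using c0(2) by simp
  define d where "d = c / a1"
  have dd: "d * d = b2 / a1" using c0(2) by (simp add: d_def cc)
  have "d ^ 4 = (d * d) * (d * d)" by (simp add: eval_nat_numeral)
  also have "\<dots> = 1" unfolding dd using c0(2) b2a by (simp add: field_simps)
  finally have d4: "d ^ 4 = 1" .
  have "R = smul a1 \<circ> diagm d"
  proof
    fix x :: "'k vec3"
    obtain x1 x2 x3 where x: "x = Vec x1 x2 x3" by (cases x)
    show "R x = (smul a1 \<circ> diagm d) x"
      unfolding x additive_expand[OF cubic_group_additive[OF R], unfolded a b e3] using c0(2)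
      by (simp add: dd) (simp add: d_def a2 a3 b1 b3 mult.commute)
  qed
  then show ?thesis using c0(2) d4 by blast
qed

lemma reflm_e3: "reflm b e3 = smul (4 * b\<^sup>2) (Vec 1 (- (b\<^sup>2)) ((1 + b ^ 4) / (2 * b)))" if "b \<noteq> (0::'k::prime_field)"
proof -
  have "4 * b\<^sup>2 * ((1 + b ^ 4) / (2 * b)) = 2 * b * (1 + b ^ 4)"
    using that by (simp add: field_simps power2_eq_square)
  then show ?thesis by (simp add: reflm_def flexpt_def) (simp add: algebra_simps eval_nat_numeral)
qed

text \<open>The vector \<open>e3\<close> is on the cubic, and on the Hessian because
  \<open>phi e3 e2 = 0\<close>. Both properties carry over to \<open>R e3\<close>, with
  \<open>R e2\<close> as the kernel vector. For a point \<open>(1, u, v)\<close> they are the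
  equations \<open>E1\<close> of the Hessian and \<open>E2\<close> of the cubic.\<close>

lemma cubic_group_flex:
  fixes R :: "'k::prime_field vec3 \<Rightarrow> 'k vec3"
  assumes R: "R \<in> cubic_group"
  shows "(\<exists>c. R e3 = Vec 0 0 c) \<or> (\<exists>b\<in>froots. \<exists>c. c \<noteq> 0 \<and> R e3 = smul c (reflm b e3))"
proof -
  obtain m where m: "m \<noteq> 0" "\<And>x y z. tri (R x) (R y) (R z) = m * tri x y z"
    using R by (auto simp: cubic_group_def)
  obtain q1 q2 q3 where q: "R e3 = Vec q1 q2 q3" by (cases "R e3")
  obtain k1 k2 k3 where k: "R e2 = Vec k1 k2 k3" by (cases "R e2")
  have qqq: "tri (Vec q1 q2 q3) (Vec q1 q2 q3) (Vec q1 q2 q3) = 0"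
    using m(2)[of e3 e3 e3] unfolding q by (simp add: tri_def)
  have "phi (Vec q1 q2 q3) (Vec k1 k2 k3) = 0"
  proof (rule dot_eqI)
    fix z
    obtain z' where "z = R z'" using cubic_group_bij[OF R] by (metis bij_is_surj surjD)
    then have "tri (Vec q1 q2 q3) (Vec k1 k2 k3) z = m * tri e3 e2 z'" using m(2)[of e3 e2 z'] unfolding q k by simp
    then show "dot (phi (Vec q1 q2 q3) (Vec k1 k2 k3)) z = dot 0 z" by (cases z') (simp add: tri_def)
  qed
  then have ph: "q1 * k2 + q2 * k1 + q3 * k3 = 0" "q1 * k1 + q2 * k2 = 0" "q1 * k3 + q3 * k1 = 0"
    by (simp_all add: zero_vec3_def)
  have k0: "Vec k1 k2 k3 \<noteq> 0"
  proof
    assume "Vec k1 k2 k3 = 0"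
    then have "R e2 = R 0" unfolding k using additive.zero[OF cubic_group_additive[OF R]] by simp
    then have "e2 = (0 :: 'k vec3)" using cubic_group_bij[OF R] by (metis bij_is_inj injD)
    then show False by (simp add: zero_vec3_def)
  qed
  show ?thesis
  proof (cases "q1 = 0")
    case True
    have "q2 * q2 * q2 = 0" using qqq by (simp add: tri_def True)
    then have "q2 = 0" by simp
    then show ?thesis using True q by simp
  next
    case False
    define u v where uv: "u = q2 / q1" "v = q3 / q1"
    have q23: "q2 = q1 * u" "q3 = q1 * v" using False by (simp_all add: uv)
    have p1: "k2 + u * k1 + v * k3 = 0" "k1 + u * k2 = 0" "k3 + v * k1 = 0"
    proof -
      have "q1 * (k2 + u * k1 + v * k3) = 0" "q1 * (k1 + u * k2) = 0" "q1 * (k3 + v * k1) = 0"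
        using ph unfolding q23 by (simp_all add: algebra_simps)
      then show "k2 + u * k1 + v * k3 = 0" "k1 + u * k2 = 0" "k3 + v * k1 = 0" using False by simp_all
    qed
    have k2: "k2 \<noteq> 0"
    proof
      assume "k2 = 0"
      then have "k1 = 0" using p1(2) by simp
      then have "k3 = 0" using p1(3) by simp
      then show False using k0 \<open>k1 = 0\<close> \<open>k2 = 0\<close> by (simp add: zero_vec3_def)
    qed
    have "k2 * (1 - u * u + u * v * v) = 0" using p1 by Groebner_Basis.algebra
    then have E1: "1 - u * u + u * v * v = 0" using k2 by simp
    have "q1 * q1 * q1 * (3 * u + u * u * u + 3 * v * v) = 0"
      using qqq unfolding q23 tri_def phi.simps dot.simps by Groebner_Basis.algebra
    then have E2: "3 * u + u * u * u + 3 * v * v = 0" using False by simp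
    have v0: "v \<noteq> 0"
    proof
      assume "v = 0"
      then have "2 * 2 * u = 0" "u * u = 1" using E1 E2 by Groebner_Basis.algebra+
      then show False using two_neq_0 by (simp only: mult_eq_0_iff simp_thms) simp
    qed
    \<comment> \<open>Solves the third coordinate \<open>v = (1 + b\<^sup>4) / (2 b)\<close> of the
      parametrized flex for \<open>b\<close>, given the intended
      \<open>b\<^sup>2 = - u\<close>.\<close>
    define b where "b = (1 + u * u) / (2 * v)"
    have bv: "2 * v * b = 1 + u * u" using v0 by (simp add: b_def)
    \<comment> \<open>Elimination of \<open>v\<^sup>2\<close> from \<open>E1\<close> and
      \<open>E2\<close>. This is the quartic in the definition of \<open>V\<^sub>p\<close>.\<close>
    have "u * u * u * u + 6 * (u * u) - 3 = u * (3 * u + u * u * u + 3 * v * v) - 3 * (1 - u * u + u * v * v)"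
      by Groebner_Basis.algebra
    then have u4: "u * u * u * u + 6 * (u * u) - 3 = 0" by (simp only: E1 E2 mult_zero_right diff_0_right)
    have "4 * (v * v) * (b * b + u) = (2 * v * b) * (2 * v * b) + 4 * (u * v * v)" by Groebner_Basis.algebra
    also have "\<dots> = (1 + u * u) * (1 + u * u) + 4 * (u * v * v)" by (simp only: bv)
    also have "\<dots> = (u * u * u * u + 6 * (u * u) - 3) + 4 * (1 - u * u + u * v * v)" by Groebner_Basis.algebra
    also have "\<dots> = 0" by (simp only: u4 E1 mult_zero_right add_0_right)
    finally have "4 * (v * v) * (b * b + u) = 0" .
    moreover have "(4::'k) \<noteq> 0" using two_neq_0 by (metis mult_2 mult_eq_0_iff numeral_Bit0)
    ultimately have bb: "b * b = - u" using v0 by (simp add: eq_neg_iff_add_eq_0)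
    have "b ^ 4 = (b * b) * (b * b)" by (simp add: eval_nat_numeral mult.assoc)
    then have b4: "b ^ 4 = u * u" unfolding bb by simp
    have "b ^ 8 = b ^ 4 * b ^ 4" by (simp flip: power_add)
    then have b8: "b ^ 8 = u * u * (u * u)" unfolding b4 .
    have "b \<in> froots" unfolding froots_def mem_Collect_eq b8 b4 using u4 by (simp add: algebra_simps)
    have b0: "b \<noteq> 0" using frootsD(2)[OF \<open>b \<in> froots\<close>] .
    have u0: "u \<noteq> 0" using bb b0 by auto
    have vb: "(1 + b ^ 4) / (2 * b) = v" using bv b0 unfolding b4 by (simp add: field_simps)
    have "R e3 = smul (q1 / (4 * b\<^sup>2)) (reflm b e3)"
      unfolding reflm_e3[OF b0] smul_smul vb q using b0 \<open>4 \<noteq> 0\<close> by (simp add: power2_eq_square bb q23 u0)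
    moreover have "q1 / (4 * b\<^sup>2) \<noteq> 0" using False b0 \<open>4 \<noteq> 0\<close> by simp
    ultimately show ?thesis using \<open>b \<in> froots\<close> by blast
  qed
qed

fun celt :: "'k::prime_field option \<Rightarrow> 'k \<Rightarrow> 'k vec3 \<Rightarrow> 'k vec3" where
  "celt None d = diagm d"
| "celt (Some b) d = reflm b \<circ> diagm d"

text \<open>The first component records the image of the flex \<open>e3\<close>: \<open>None\<close>
  keeps it, and \<open>Some b\<close> moves it to the flex with parameter \<open>b\<close>. The
  second component runs through the stabilizer.\<close>

definition cidx :: "('k::prime_field option \<times> 'k) set" where
  "cidx = insert None (Some ` froots) \<times> {d. d ^ 4 = 1}"

lemma celt_cubic_group: "(o', d) \<in> cidx \<Longrightarrow> celt o' d \<in> cubic_group"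
  by (cases o') (auto simp: cidx_def intro: diagm_cubic_group cubic_group_comp reflm_cubic_group)

text \<open>As \<open>reflm b\<close> is an involution up to a scalar, composing \<open>R\<close>
  with it brings the flex back to \<open>e3\<close> and leaves an element of the stabilizer.\<close>

lemma cubic_group_decomp:
  fixes R :: "'k::prime_field vec3 \<Rightarrow> 'k vec3"
  assumes R: "R \<in> cubic_group"
  shows "\<exists>c o' d. c \<noteq> 0 \<and> (o', d) \<in> cidx \<and> R = smul c \<circ> celt o' d"
  using cubic_group_flex[OF R]
proof
  assume "\<exists>c. R e3 = Vec 0 0 c"
  then obtain r d where "r \<noteq> 0" "d ^ 4 = 1" "R = smul r \<circ> diagm d" using cubic_group_stab[OF R] by blast
  then show ?thesis by (intro exI[of _ r] exI[of _ None] exI[of _ d]) (simp add: cidx_def)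
next
  assume "\<exists>b\<in>froots. \<exists>c. c \<noteq> 0 \<and> R e3 = smul c (reflm b e3)"
  then obtain b c where b: "b \<in> froots" and c: "c \<noteq> 0" "R e3 = smul c (reflm b e3)" by blast
  let ?s = "4 * b * (1 + b ^ 4)"
  have s: "?s \<noteq> 0" using frootsD[OF b] by simp
  have "(reflm b \<circ> R) e3 = Vec 0 0 (c * ?s\<^sup>2)"
    by (simp only: comp_apply c reflm_smul reflm_reflm smul_smul smul.simps mult_zero_right mult_1_right)
  from cubic_group_stab[OF cubic_group_comp[OF reflm_cubic_group[OF b] R] this]
  obtain r d where r: "r \<noteq> 0" "d ^ 4 = 1" "reflm b \<circ> R = smul r \<circ> diagm d" by blast
  have "R = smul (r / ?s\<^sup>2) \<circ> celt (Some b) d"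
  proof
    fix x
    have "smul (?s\<^sup>2) (R x) = smul r (reflm b (diagm d x))"
      using fun_cong[OF r(3), of x] reflm_reflm[of b "R x"] by (simp add: reflm_smul)
    then have "smul (inverse (?s\<^sup>2)) (smul (?s\<^sup>2) (R x)) = smul (inverse (?s\<^sup>2)) (smul r (reflm b (diagm d x)))" by simp
    then have "smul (inverse (?s\<^sup>2) * ?s\<^sup>2) (R x) = smul (inverse (?s\<^sup>2) * r) (reflm b (diagm d x))"
      unfolding smul_smul .
    moreover have "inverse (?s\<^sup>2) * ?s\<^sup>2 = 1" using s by (intro left_inverse) simp
    ultimately show "R x = (smul (r / ?s\<^sup>2) \<circ> celt (Some b) d) x"
      by (simp only: smul_1 comp_apply celt.simps divide_inverse mult.commute)
  qed
  moreover have "r / ?s\<^sup>2 \<noteq> 0" using r(1) s by (simp only: divide_eq_0_iff power_eq_0_iff) simp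
  ultimately show ?thesis using b r(2) by (intro exI[of _ "r / ?s\<^sup>2"] exI[of _ "Some b"] exI[of _ d]) (simp only: cidx_def, simp)
qed

lemma diag_decomp_unique:
  assumes "\<And>x. smul c (diagm d x) = smul c' (diagm d' x)" "c \<noteq> (0::'k::prime_field)"
  shows "c = c' \<and> d = d'"
  using assms(1)[of e1] assms(1)[of e3] assms(2) by simp

text \<open>The image of \<open>e3\<close> determines the first index: its second coordinate,
  relative to the first, gives \<open>b\<^sup>2\<close>, and the third one then gives the sign of
  \<open>b\<close>. What remains is diagonal.\<close>

lemma cubic_group_unique:
  fixes c :: "'k::prime_field"
  assumes e: "smul c \<circ> celt o1 d = smul c' \<circ> celt o2 d'" and c: "c \<noteq> 0" "c' \<noteq> 0"
    and i: "(o1, d) \<in> cidx" "(o2, d') \<in> cidx"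
  shows "c = c' \<and> o1 = o2 \<and> d = d'"
proof -
  have d0: "d \<noteq> 0" "d' \<noteq> 0" using i by (auto simp: cidx_def zero_power)
  have r3: "smul k (celt (Some b) f e3) = Vec (k * f * (4 * b\<^sup>2)) (k * f * (4 * b\<^sup>2) * (- (b\<^sup>2))) (k * f * (4 * b\<^sup>2) * ((1 + b ^ 4) / (2 * b)))"
    if "b \<noteq> 0" for k f b :: 'k
  proof -
    have "smul k (celt (Some b) f e3) = smul k (reflm b (smul f e3))" by simp
    also have "\<dots> = smul (k * f * (4 * b\<^sup>2)) (Vec 1 (- (b\<^sup>2)) ((1 + b ^ 4) / (2 * b)))"
      by (simp only: reflm_smul reflm_e3[OF that] smul_smul mult.assoc)
    finally show ?thesis by simp
  qed
  have e3: "smul c (celt o1 d e3) = smul c' (celt o2 d' e3)" using fun_cong[OF e, of e3] by simp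
  show ?thesis
  proof (cases o1)
    case None
    show ?thesis
    proof (cases o2)
      case None
      have "smul c (diagm d x) = smul c' (diagm d' x)" for x
        using fun_cong[OF e, of x] by (simp add: None \<open>o1 = None\<close>)
      then show ?thesis using diag_decomp_unique[OF _ c(1)] None \<open>o1 = None\<close> by blast
    next
      case (Some b)
      then have b: "b \<noteq> 0" using i frootsD(2) by (auto simp: cidx_def)
      then show ?thesis using e3 c d0 unfolding Some r3[OF b] None by simp
    qed
  next
    case (Some b)
    then have bf: "b \<in> froots" using i by (auto simp: cidx_def)
    note b = frootsD(2)[OF bf]
    show ?thesis
    proof (cases o2)
      case None
      then show ?thesis using e3 c d0 b unfolding Some r3[OF b] None by simp
    next
      case (Some b')
      then have b': "b' \<noteq> 0" using i frootsD(2) by (auto simp: cidx_def)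
      define k where "k = c * d * (4 * b\<^sup>2)"
      have k0: "k \<noteq> 0" using c d0 b by (simp add: k_def)
      have k: "k = c' * d' * (4 * b'\<^sup>2)" "k * (- (b\<^sup>2)) = c' * d' * (4 * b'\<^sup>2) * (- (b'\<^sup>2))"
        "k * ((1 + b ^ 4) / (2 * b)) = c' * d' * (4 * b'\<^sup>2) * ((1 + b' ^ 4) / (2 * b'))"
        using e3 unfolding Some \<open>o1 = Some b\<close> r3[OF b] r3[OF b'] k_def vec3.inject by blast+
      have b2: "b\<^sup>2 = b'\<^sup>2" using k(2) k0 unfolding k(1)[symmetric] by simp
      have b4: "b ^ 4 = b' ^ 4" using arg_cong[OF b2, of "\<lambda>x. x\<^sup>2"] by (simp flip: power_mult)
      have "(1 + b ^ 4) / (2 * b) = (1 + b ^ 4) / (2 * b')" using k(3) k0 unfolding k(1)[symmetric] b4 by simp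
      then have bb: "b = b'" using frootsD(3)[OF bf] b b' by (simp add: frac_eq_eq)
      have "smul c (diagm d x) = smul c' (diagm d' x)" for x
      proof -
        have "reflm b (smul c (diagm d x)) = reflm b (smul c' (diagm d' x))"
          using fun_cong[OF e, of x] unfolding Some \<open>o1 = Some b\<close> bb by (simp add: reflm_smul)
        then show ?thesis using cubic_group_bij[OF reflm_cubic_group[OF bf]] by (simp add: bij_is_inj inj_eq)
      qed
      then show ?thesis using diag_decomp_unique[OF _ c(1)] Some \<open>o1 = Some b\<close> bb by blast
    qed
  qed
qed

section \<open>Fixed points counted through eigenvectors\<close>

definition eig :: "('k::prime_field vec3 \<Rightarrow> 'k vec3) \<Rightarrow> nat" where
  "eig g = card {v. v \<noteq> 0 \<and> (\<exists>k. g v = smul k v)}"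

lemma CARD_minus: "card {c :: 'k::prime_field. c \<noteq> 0} = CARD('k) - 1"
proof -
  have "{c :: 'k. c \<noteq> 0} = UNIV - {0}" by auto
  then show ?thesis by (simp add: card_Diff_subset)
qed

lemma smul_right_inj: "v \<noteq> 0 \<Longrightarrow> smul c v = smul d v \<longleftrightarrow> c = (d :: 'k::prime_field)"
  by (cases v) (auto simp: zero_vec3_def)

text \<open>A nonzero eigenvector of \<open>g\<close> is fixed by exactly one scalar multiple of
  \<open>g\<close>, whereas the zero vector is fixed by all \<open>p - 1\<close> of them.\<close>

lemma fixed_points_sum:
  fixes g :: "'k::prime_field vec3 \<Rightarrow> 'k vec3"
  assumes g: "g \<in> cubic_group"
  shows "(\<Sum>c\<in>{c. c \<noteq> 0}. card {v. smul c (g v) = v}) = (CARD('k) - 1) + eig g"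
proof -
  let ?F = "\<lambda>c. {v. v \<noteq> 0 \<and> smul c (g v) = v}"
  have g0: "g 0 = 0" by (rule additive.zero[OF cubic_group_additive[OF g]])
  have "card {v. smul c (g v) = v} = 1 + card (?F c)" for c
  proof -
    have "{v. smul c (g v) = v} = insert 0 (?F c)" using g0 by auto
    then show ?thesis by simp
  qed
  then have "(\<Sum>c\<in>{c. c \<noteq> 0}. card {v. smul c (g v) = v}) = (CARD('k) - 1) + (\<Sum>c\<in>{c. c \<noteq> 0}. card (?F c))"
    by (simp only: sum.distrib) (simp add: CARD_minus)
  also have "(\<Sum>c\<in>{c. c \<noteq> 0}. card (?F c)) = card (\<Union>c\<in>{c. c \<noteq> 0}. ?F c)"
  proof (rule card_UN_disjoint[symmetric])
    show "\<forall>i\<in>{c. c \<noteq> 0}. \<forall>j\<in>{c. c \<noteq> 0}. i \<noteq> j \<longrightarrow> ?F i \<inter> ?F j = {}"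
    proof (intro ballI impI equals0I)
      fix i j v assume "i \<noteq> j" "v \<in> ?F i \<inter> ?F j"
      then have v: "v \<noteq> 0" "smul i (g v) = v" "smul j (g v) = v" by simp_all
      then have "g v \<noteq> 0" by auto
      then show False using smul_right_inj[of "g v" i j] v \<open>i \<noteq> j\<close> by simp
    qed
  qed auto
  also have "(\<Union>c\<in>{c. c \<noteq> 0}. ?F c) = {v. v \<noteq> 0 \<and> (\<exists>k. g v = smul k v)}"
  proof (intro Set.set_eqI iffI)
    fix v assume "v \<in> (\<Union>c\<in>{c. c \<noteq> 0}. ?F c)"
    then obtain c where c: "c \<noteq> 0" "v \<noteq> 0" "smul c (g v) = v" by blast
    have "g v = smul (inverse c) (smul c (g v))" using c(1) by (simp add: smul_smul)
    then have "g v = smul (inverse c) v" by (simp only: c(3))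
    then show "v \<in> {v. v \<noteq> 0 \<and> (\<exists>k. g v = smul k v)}" using c(2) by blast
  next
    fix v assume "v \<in> {v. v \<noteq> 0 \<and> (\<exists>k. g v = smul k v)}"
    then obtain k where k: "v \<noteq> 0" "g v = smul k v" by blast
    have "g v \<noteq> g 0" using k(1) cubic_group_bij[OF g] by (simp add: bij_is_inj inj_eq)
    then have "k \<noteq> 0" using k g0 by auto
    then have "smul (inverse k) (g v) = v" "inverse k \<noteq> 0" by (simp_all add: k(2) smul_smul)
    then show "v \<in> (\<Union>c\<in>{c. c \<noteq> 0}. ?F c)" using k(1) by blast
  qed
  finally show ?thesis by (simp add: eig_def)
qed

definition orbit_rel :: "('k::prime_field vec3 \<times> 'k vec3) set" where
  "orbit_rel = {(x, y). \<exists>f\<in>cubic_group. y = f x}"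

theorem orbit_count:
  "card (UNIV // (orbit_rel :: ('k::prime_field vec3 \<times> 'k vec3) set)) * ((CARD('k) - 1) * card (cidx :: ('k option \<times> 'k) set)) =
    (\<Sum>(o', d)\<in>(cidx :: ('k option \<times> 'k) set). (CARD('k) - 1) + eig (celt o' d))"
proof -
  let ?S = "{c :: 'k. c \<noteq> 0} \<times> (cidx :: ('k option \<times> 'k) set)"
  let ?f = "\<lambda>(c, i). smul c \<circ> celt (fst i) (snd i) :: 'k vec3 \<Rightarrow> 'k vec3"
  have bij: "bij_betw ?f ?S cubic_group"
  proof (rule bij_betw_imageI)
    show "inj_on ?f ?S"
      by (rule inj_onI) (auto dest!: cubic_group_unique)
    show "?f ` ?S = cubic_group"
    proof
      show "?f ` ?S \<subseteq> cubic_group" by (auto intro!: cubic_group_comp cubic_group_smul celt_cubic_group)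
      show "cubic_group \<subseteq> ?f ` ?S"
      proof
        fix R :: "'k vec3 \<Rightarrow> 'k vec3" assume "R \<in> cubic_group"
        then obtain c o' d where "c \<noteq> 0" "(o', d) \<in> cidx" "R = smul c \<circ> celt o' d" using cubic_group_decomp by blast
        then show "R \<in> ?f ` ?S" by (intro image_eqI[of _ _ "(c, (o', d))"]) simp_all
      qed
    qed
  qed
  have "card (UNIV // (orbit_rel :: ('k vec3 \<times> 'k vec3) set)) * card (cubic_group :: ('k vec3 \<Rightarrow> 'k vec3) set)
     = (\<Sum>f\<in>(cubic_group :: ('k vec3 \<Rightarrow> 'k vec3) set). card {x. f x = x})"
    unfolding orbit_rel_def
    by (rule burnside[OF cubic_group_id cubic_group_comp cubic_group_inv cubic_group_bij])
  also have "\<dots> = (\<Sum>ci\<in>?S. card {x. ?f ci x = x})"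
    by (rule sum.reindex_bij_betw[OF bij, symmetric])
  also have "\<dots> = (\<Sum>c\<in>{c::'k. c \<noteq> 0}. \<Sum>i\<in>(cidx :: ('k option \<times> 'k) set). card {x. smul c (celt (fst i) (snd i) x) = x})"
    by (simp add: sum.cartesian_product split_def)
  also have "\<dots> = (\<Sum>i\<in>(cidx :: ('k option \<times> 'k) set). \<Sum>c\<in>{c::'k. c \<noteq> 0}. card {x. smul c (celt (fst i) (snd i) x) = x})"
    by (rule sum.swap)
  also have "\<dots> = (\<Sum>i\<in>(cidx :: ('k option \<times> 'k) set). (CARD('k) - 1) + eig (celt (fst i) (snd i)))"
    by (intro sum.cong refl fixed_points_sum celt_cubic_group) simp
  also have "card (cubic_group :: ('k vec3 \<Rightarrow> 'k vec3) set) = (CARD('k) - 1) * card (cidx :: ('k option \<times> 'k) set)"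
    using bij_betw_same_card[OF bij] by (simp add: card_cartesian_product CARD_minus)
  finally show ?thesis by (simp add: split_def)
qed

lemma card_line: "y \<noteq> 0 \<Longrightarrow> card {v. \<exists>t. t \<noteq> 0 \<and> v = smul t (y :: 'k::prime_field vec3)} = CARD('k) - 1"
proof -
  assume y: "y \<noteq> 0"
  have "{v. \<exists>t. t \<noteq> 0 \<and> v = smul t y} = (\<lambda>t. smul t y) ` {t. t \<noteq> 0}" by auto
  moreover have "inj_on (\<lambda>t. smul t y) {t. t \<noteq> 0}" using y by (auto intro!: inj_onI simp: smul_right_inj)
  ultimately show ?thesis by (simp add: card_image CARD_minus)
qed

text \<open>Eigenlines of distinct eigenvalues are disjoint, and each has \<open>p - 1\<close>
  nonzero vectors. The factor \<open>s\<close> normalizes the eigenvalues, so that maps built from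
  \<open>reflm\<close> need not be divided by their scalar.\<close>

lemma eig_lines:
  fixes g :: "'k::prime_field vec3 \<Rightarrow> 'k vec3"
  assumes s: "s \<noteq> 0"
    and L: "\<And>w. w \<in> S \<Longrightarrow> \<exists>y. y \<noteq> 0 \<and> (\<forall>v. v \<noteq> 0 \<and> g v = smul (s * w) v \<longleftrightarrow> (\<exists>t. t \<noteq> 0 \<and> v = smul t y))"
    and E: "\<And>w v. v \<noteq> 0 \<Longrightarrow> g v = smul (s * w) v \<Longrightarrow> w \<in> S"
  shows "eig g = (CARD('k) - 1) * card S"
proof -
  let ?E = "\<lambda>w. {v. v \<noteq> 0 \<and> g v = smul (s * w) v}"
  have "{v. v \<noteq> 0 \<and> (\<exists>k. g v = smul k v)} = (\<Union>w\<in>S. ?E w)"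
  proof (intro Set.set_eqI iffI)
    fix v assume "v \<in> {v. v \<noteq> 0 \<and> (\<exists>k. g v = smul k v)}"
    then obtain k where "v \<noteq> 0" "g v = smul k v" by blast
    then have "v \<noteq> 0" "g v = smul (s * (k / s)) v" using s by simp_all
    then show "v \<in> (\<Union>w\<in>S. ?E w)" using E by blast
  qed blast
  then have "eig g = card (\<Union>w\<in>S. ?E w)" by (simp add: eig_def)
  also have "\<dots> = (\<Sum>w\<in>S. card (?E w))"
  proof (rule card_UN_disjoint)
    show "\<forall>i\<in>S. \<forall>j\<in>S. i \<noteq> j \<longrightarrow> ?E i \<inter> ?E j = {}"
    proof (intro ballI impI equals0I)
      fix i j v assume "i \<noteq> j" "v \<in> ?E i \<inter> ?E j"
      then have "v \<noteq> 0" "smul (s * i) v = smul (s * j) v" by auto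
      then show False using smul_right_inj[of v "s * i" "s * j"] s \<open>i \<noteq> j\<close> by simp
    qed
  qed auto
  also have "\<dots> = (\<Sum>w\<in>S. CARD('k) - 1)"
  proof (rule sum.cong[OF refl])
    fix w assume "w \<in> S"
    then obtain y where y: "y \<noteq> 0" "\<forall>v. v \<noteq> 0 \<and> g v = smul (s * w) v \<longleftrightarrow> (\<exists>t. t \<noteq> 0 \<and> v = smul t y)" using L by blast
    then show "card (?E w) = CARD('k) - 1" using card_line[OF y(1)] by simp
  qed
  finally show ?thesis by simp
qed

section \<open>Eigenvectors\<close>

lemma diagm_1: "diagm 1 = id"
proof
  fix x :: "'a vec3" show "diagm 1 x = id x" by (cases x) simp
qed

lemma eig_diagm_1: "eig (diagm (1 :: 'k::prime_field)) = CARD('k) ^ 3 - 1"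
proof -
  have "{v :: 'k vec3. v \<noteq> 0 \<and> (\<exists>k. diagm 1 v = smul k v)} = UNIV - {0}"
    by (auto simp: diagm_1 intro!: exI[of _ 1])
  then show ?thesis by (simp add: eig_def card_Diff_subset CARD_vec3)
qed

lemma card_punctured_plane:
  assumes "inj f"
  shows "card (f ` (UNIV - {(0::'k::prime_field, 0::'k)})) = CARD('k)\<^sup>2 - 1"
proof -
  have "inj_on f (UNIV - {(0, 0)})" using assms by (rule inj_on_subset) simp
  then have "card (f ` (UNIV - {(0, 0)})) = card (UNIV - {(0::'k, 0::'k)})" by (rule card_image)
  also have "\<dots> = CARD('k)\<^sup>2 - 1" by (simp add: card_Diff_subset power2_eq_square)
  finally show ?thesis .
qed

text \<open>This is the reflection at the flex \<open>e3\<close> with axis \<open>z = 0\<close>, the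
  counterpart of \<open>reflm b\<close>: its eigenvectors fill a plane and a line outside
  it.\<close>

lemma eig_diagm_m1: "eig (diagm (- 1 :: 'k::prime_field)) = (CARD('k)\<^sup>2 - 1) + (CARD('k) - 1)"
proof -
  let ?f = "\<lambda>(x, y). Vec x y 0 :: 'k vec3"
  let ?P = "?f ` (UNIV - {(0, 0)})" and ?L = "{v. \<exists>t. t \<noteq> 0 \<and> v = smul t e3} :: 'k vec3 set"
  have "v \<noteq> 0 \<and> (\<exists>k. diagm (- 1) v = smul k v) \<longleftrightarrow> v \<in> ?P \<union> ?L" for v :: "'k vec3"
  proof -
    obtain x y z where v: "v = Vec x y z" by (cases v)
    show ?thesis
    proof (cases "x = 0 \<and> y = 0")
      case True
      then show ?thesis by (auto simp: v zero_vec3_def intro!: exI[of _ "- 1"])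
    next
      case False
      have "(\<exists>k. diagm (- 1) v = smul k v) \<longleftrightarrow> z = 0"
      proof
        assume "\<exists>k. diagm (- 1) v = smul k v"
        then obtain k where k: "x = k * x" "y = k * y" "- z = k * z" by (auto simp: v)
        then have "k = 1" using False by auto
        then have "2 * z = 0" using k(3) by simp
        then show "z = 0" by simp
      qed (auto simp: v intro!: exI[of _ 1])
      then show ?thesis using False by (auto simp: v zero_vec3_def)
    qed
  qed
  then have "{v :: 'k vec3. v \<noteq> 0 \<and> (\<exists>k. diagm (- 1) v = smul k v)} = ?P \<union> ?L"
    by (intro Set.set_eqI) (simp only: mem_Collect_eq)
  then have "eig (diagm (- 1 :: 'k)) = card (?P \<union> ?L)" by (simp only: eig_def)
  also have "\<dots> = card ?P + card ?L" by (rule card_Un_disjoint) auto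
  also have "card ?P = CARD('k)\<^sup>2 - 1" by (rule card_punctured_plane) (auto intro!: injI)
  also have "card ?L = CARD('k) - 1" by (rule card_line) (simp add: zero_vec3_def)
  finally show ?thesis .
qed

lemma i_facts:
  assumes "i * i = (- 1 :: 'k::prime_field)"
  shows "i \<noteq> 0" "i \<noteq> 1" "i \<noteq> - 1" "(1::'k) \<noteq> - 1"
proof -
  show 1: "(1::'k) \<noteq> - 1" using two_neq_0 by (metis add.right_inverse one_add_one)
  show "i \<noteq> 0" "i \<noteq> 1" "i \<noteq> - 1" using assms 1 by auto
qed

lemma eig_diagm_i:
  assumes i: "i * i = (- 1 :: 'k::prime_field)"
  shows "eig (diagm i) = (CARD('k) - 1) * 3"
proof -
  note f = i_facts[OF i]
  have mi: "i * x = - x \<longleftrightarrow> x = 0" for x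
  proof
    assume "i * x = - x"
    then have "(i + 1) * x = 0" by (simp add: distrib_right)
    moreover have "i + 1 \<noteq> 0" using f(3) by (simp add: eq_neg_iff_add_eq_0)
    ultimately show "x = 0" by simp
  qed simp
  have "eig (diagm i) = (CARD('k) - 1) * card {1, - 1, i}"
  proof (rule eig_lines[of 1])
    fix w assume "w \<in> {1, - 1, i}"
    then consider "w = 1" | "w = - 1" | "w = i" by blast
    then show "\<exists>y. y \<noteq> 0 \<and> (\<forall>v. v \<noteq> 0 \<and> diagm i v = smul (1 * w) v \<longleftrightarrow> (\<exists>t. t \<noteq> 0 \<and> v = smul t y))"
    proof cases
      case 1
      have "v \<noteq> 0 \<and> diagm i v = smul w v \<longleftrightarrow> (\<exists>t. t \<noteq> 0 \<and> v = smul t e1)" for v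
        using f by (cases v) (auto simp: 1 i zero_vec3_def minus_equation_iff[of "_ :: 'k"] equation_minus_iff)
      then show ?thesis by (intro exI[of _ e1]) (simp add: zero_vec3_def)
    next
      case 2
      have "v \<noteq> 0 \<and> diagm i v = smul w v \<longleftrightarrow> (\<exists>t. t \<noteq> 0 \<and> v = smul t e2)" for v
        using f by (cases v) (auto simp: 2 i mi zero_vec3_def)
      then show ?thesis by (intro exI[of _ e2]) (simp add: zero_vec3_def)
    next
      case 3
      have "v \<noteq> 0 \<and> diagm i v = smul w v \<longleftrightarrow> (\<exists>t. t \<noteq> 0 \<and> v = smul t e3)" for v
        using f by (cases v) (auto simp: 3 i mi eq_commute[of "- _" "i * _"] zero_vec3_def)
      then show ?thesis by (intro exI[of _ e3]) (simp add: zero_vec3_def)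
    qed
  next
    fix w v assume "v \<noteq> 0" "diagm i v = smul (1 * w) v"
    moreover have "- x = w * x \<longleftrightarrow> x = 0 \<or> w = - 1" for x
    proof -
      have "- x = w * x \<longleftrightarrow> (w + 1) * x = 0" by (simp add: distrib_right neg_eq_iff_add_eq_0 add.commute)
      then show ?thesis by (auto simp: eq_neg_iff_add_eq_0)
    qed
    ultimately show "w \<in> {1, - 1, i}" by (cases v) (auto simp: i zero_vec3_def)
  qed simp
  also have "card {1, - 1, i} = 3" using f by simp
  finally show ?thesis .
qed

lemma lform_eq_0_iff:
  "b \<noteq> 0 \<Longrightarrow> lform b (Vec x y z) = 0 \<longleftrightarrow> z = ((b ^ 4 + 3) * x - 2 * b\<^sup>2 * y) / (2 * (b :: 'k::prime_field))"
  by (simp add: field_simps eq_diff_eq)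

lemma flexpt_neq_0: "b \<noteq> 0 \<Longrightarrow> flexpt b \<noteq> (0 :: 'k::prime_field vec3)"
  by (simp add: flexpt_def zero_vec3_def)

lemma eig_reflm:
  fixes b :: "'k::prime_field"
  assumes b: "b \<in> froots"
  shows "eig (reflm b) = (CARD('k)\<^sup>2 - 1) + (CARD('k) - 1)"
proof -
  let ?s = "4 * b * (1 + b ^ 4)" and ?q = "flexpt b"
  note fD = frootsD[OF b]
  have s: "?s \<noteq> 0" using fD by simp
  have q: "?q \<noteq> 0" by (rule flexpt_neq_0[OF fD(2)])
  let ?f = "\<lambda>(x, y). Vec x y (((b ^ 4 + 3) * x - 2 * b\<^sup>2 * y) / (2 * b))"
  let ?P = "?f ` (UNIV - {(0, 0)})" and ?L = "{v. \<exists>t. t \<noteq> 0 \<and> v = smul t ?q}"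
  have P: "v \<in> ?P \<longleftrightarrow> v \<noteq> 0 \<and> lform b v = 0" for v
  proof -
    obtain x y z where v: "v = Vec x y z" by (cases v)
    show ?thesis unfolding v lform_eq_0_iff[OF fD(2)] by (auto simp: zero_vec3_def)
  qed
  have Lq: "lform b (smul t ?q) = t * (- 2 * ?s)" for t by (simp only: lform_smul lform_flexpt)
  have "v \<noteq> 0 \<and> (\<exists>k. reflm b v = smul k v) \<longleftrightarrow> v \<in> ?P \<union> ?L" for v
  proof
    assume "v \<noteq> 0 \<and> (\<exists>k. reflm b v = smul k v)"
    then obtain k where v: "v \<noteq> 0" and k: "smul ?s v + smul (lform b v) ?q = smul k v" unfolding reflm_def by blast
    show "v \<in> ?P \<union> ?L"
    proof (cases "lform b v = 0")
      case True
      then show ?thesis using P v by simp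
    next
      case False
      have "smul (k - ?s) v = smul k v - smul ?s v" by (cases v) (simp add: algebra_simps)
      also have "\<dots> = smul (lform b v) ?q" unfolding k[symmetric] by simp
      finally have e: "smul (k - ?s) v = smul (lform b v) ?q" .
      then have ks: "k - ?s \<noteq> 0" using False q by (metis smul_0_left smul_eq_0_iff)
      have "v = smul (inverse (k - ?s)) (smul (k - ?s) v)" using ks by (simp only: smul_smul left_inverse smul_1 simp_thms)
      then have "v = smul (inverse (k - ?s) * lform b v) ?q" unfolding e smul_smul .
      moreover have "inverse (k - ?s) * lform b v \<noteq> 0" using ks False by (simp only: mult_eq_0_iff inverse_nonzero_iff_nonzero simp_thms)
      ultimately show ?thesis by blast
    qed
  next
    assume "v \<in> ?P \<union> ?L"
    then show "v \<noteq> 0 \<and> (\<exists>k. reflm b v = smul k v)"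
    proof
      assume "v \<in> ?P"
      then have "v \<noteq> 0" "reflm b v = smul ?s v" unfolding P reflm_def by simp_all
      then show ?thesis by blast
    next
      assume "v \<in> ?L"
      then obtain t where t: "t \<noteq> 0" "v = smul t ?q" by blast
      have "reflm b v = smul (?s * t + t * (- 2 * ?s)) ?q"
        unfolding reflm_def t(2) Lq smul_smul smul_add_left ..
      also have "?s * t + t * (- 2 * ?s) = (- ?s) * t" by Groebner_Basis.algebra
      finally have "reflm b v = smul (- ?s) v" unfolding t(2) smul_smul .
      moreover have "v \<noteq> 0" unfolding t(2) smul_eq_0_iff using t(1) q by simp
      ultimately show ?thesis by blast
    qed
  qed
  then have "{v. v \<noteq> 0 \<and> (\<exists>k. reflm b v = smul k v)} = ?P \<union> ?L"
    by (intro Set.set_eqI) (simp only: mem_Collect_eq)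
  then have "eig (reflm b) = card (?P \<union> ?L)" by (simp only: eig_def)
  also have "\<dots> = card ?P + card ?L"
  proof (rule card_Un_disjoint)
    have PL: "v \<notin> ?P" if vL: "v \<in> ?L" for v
    proof -
      obtain t where t: "t \<noteq> 0" "v = smul t ?q" using vL by blast
      have "lform b v \<noteq> 0" unfolding t(2) Lq using t(1) s two_neq_0[where 'a = 'k]
        by (simp only: mult_eq_0_iff neg_equal_0_iff_equal simp_thms)
      then show ?thesis unfolding P by blast
    qed
    show "?P \<inter> ?L = {}"
    proof (rule Int_emptyI)
      fix v assume "v \<in> ?P" "v \<in> ?L"
      show False by (rule notE[OF PL[OF \<open>v \<in> ?L\<close>] \<open>v \<in> ?P\<close>])
    qed
  qed auto
  also have "card ?P = CARD('k)\<^sup>2 - 1" by (rule card_punctured_plane) (auto intro!: injI)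
  also have "card ?L = CARD('k) - 1" by (rule card_line[OF q])
  finally show ?thesis .
qed

text \<open>The maps below are diagonal up to a term of rank one, so the coordinates of an
  eigenvector are multiples of one number \<open>l\<close> over different denominators. A common
  denominator exhibits the vector as a multiple of a polynomial one.\<close>

lemma solve_common_denominator:
  fixes s :: "'k::field"
  assumes "s \<noteq> 0" "a \<noteq> 0" "b \<noteq> 0" "c \<noteq> 0"
  shows "x * (s * a) = k * l \<Longrightarrow> x = l / (s * a * b * c) * (k * b * c)"
    "x * (s * b) = k * l \<Longrightarrow> x = l / (s * a * b * c) * (k * a * c)"
    "x * (s * c) = k * l \<Longrightarrow> x = l / (s * a * b * c) * (k * a * b)"
  using assms by (simp_all add: field_simps)

text \<open>With \<open>e3\<close> as origin, \<open>diagm (- 1)\<close> is negation and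
  \<open>reflm b\<close> is \<open>P \<mapsto> - (q + P)\<close> for the flex \<open>q\<close>. The
  composite is a translation by a 3-torsion point. Its normalized eigenvalues are cube roots of
  unity, and two of them may be missing from the field.\<close>

lemma eig_translation:
  fixes b :: "'k::prime_field"
  assumes b: "b \<in> froots"
  shows "eig (reflm b \<circ> diagm (- 1)) = (CARD('k) - 1) * card {w :: 'k. w = 1 \<or> w * w + w + 1 = 0}"
proof (rule eig_lines[of "4 * b * (1 + b ^ 4)"])
  note fD = frootsD[OF b]
  define n where "n = 1 + b ^ 4"
  define s where "s = 4 * b * n"
  have s0: "s \<noteq> 0" and n0: "n \<noteq> 0" using fD by (simp_all add: s_def n_def)
  show "4 * b * (1 + b ^ 4) \<noteq> 0" using fD by simp
  define l where "l x1 x2 x3 = - 2 * b * x3 - (b ^ 4 + 3) * x1 + 2 * b\<^sup>2 * x2" for x1 x2 x3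
  have g: "(reflm b \<circ> diagm (- 1)) (Vec x1 x2 x3) = smul (4 * b * (1 + b ^ 4) * w) (Vec x1 x2 x3) \<longleftrightarrow>
     x1 * (s * (1 - w)) = - 2 * b * l x1 x2 x3 \<and> x2 * (s * (1 - w)) = 2 * b ^ 3 * l x1 x2 x3 \<and>
     x3 * (s * (1 + w)) = - n * l x1 x2 x3" for x1 x2 x3 w
  proof -
    have "lform b (diagm (- 1) (Vec x1 x2 x3)) = l x1 x2 x3" by (simp add: l_def)
    then show ?thesis unfolding comp_apply reflm_def n_def[symmetric] s_def[symmetric]
      by (auto simp: flexpt_def n_def algebra_simps eq_neg_iff_add_eq_0 neg_eq_iff_add_eq_0)
  qed
  \<comment> \<open>A combination of the three eigenvector equations in which the coordinates are
    eliminated. It leaves the part \<open>w\<^sup>2 + w + 1\<close> of the characteristic polynomial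
    times \<open>l\<close>; the eigenvalue \<open>1\<close> belongs to \<open>l = 0\<close>.\<close>
  have id: "- 4 * b * n * l x1 x2 x3 * (w * w + w + 1) = - 2 * b * (1 - w) * (x3 * (s * (1 + w)) + n * l x1 x2 x3)
      - (b ^ 4 + 3) * (1 + w) * (x1 * (s * (1 - w)) + 2 * b * l x1 x2 x3)
      + 2 * b\<^sup>2 * (1 + w) * (x2 * (s * (1 - w)) - 2 * b ^ 3 * l x1 x2 x3)" for x1 x2 x3 w
    unfolding l_def s_def n_def by Groebner_Basis.algebra
  have w1: "w \<noteq> 1 \<and> w \<noteq> - 1" if "w * w + w + 1 = 0" for w :: 'k using that three_neq_0[where 'a = 'k] by auto
  have key: "(w = 1 \<and> l x1 x2 x3 = 0 \<and> x3 = 0) \<or> (w * w + w + 1 = 0 \<and> l x1 x2 x3 \<noteq> 0)"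
    if v: "Vec x1 x2 x3 \<noteq> 0" and e: "x1 * (s * (1 - w)) = - 2 * b * l x1 x2 x3" "x2 * (s * (1 - w)) = 2 * b ^ 3 * l x1 x2 x3"
      "x3 * (s * (1 + w)) = - n * l x1 x2 x3" for x1 x2 x3 w
  proof (cases "l x1 x2 x3 = 0")
    case True
    show ?thesis
    proof (cases "w = 1")
      case True
      then show ?thesis using e(3) s0 \<open>l x1 x2 x3 = 0\<close> by simp
    next
      case False
      then have "x1 = 0" "x2 = 0" using e True s0 by simp_all
      then have "x3 = 0" using True fD(2) by (simp add: l_def)
      then show ?thesis using v \<open>x1 = 0\<close> \<open>x2 = 0\<close> by (simp add: zero_vec3_def)
    qed
  next
    case False
    have "- 4 * b * n * l x1 x2 x3 * (w * w + w + 1) = 0" unfolding id e by simp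
    then show ?thesis using False fD(2) n0 by simp
  qed
  show "w \<in> {w. w = 1 \<or> w * w + w + 1 = 0}"
    if "v \<noteq> 0" "(reflm b \<circ> diagm (- 1)) v = smul (4 * b * (1 + b ^ 4) * w) v" for w v
    using that key by (cases v) (auto simp only: g mem_Collect_eq)
  show "\<exists>y. y \<noteq> 0 \<and> (\<forall>v. v \<noteq> 0 \<and> (reflm b \<circ> diagm (- 1)) v = smul (4 * b * (1 + b ^ 4) * w) v \<longleftrightarrow> (\<exists>t. t \<noteq> 0 \<and> v = smul t y))"
    if "w \<in> {w. w = 1 \<or> w * w + w + 1 = 0}" for w
  proof (cases "w = 1")
    case True
    let ?y = "Vec (2 * b\<^sup>2) (b ^ 4 + 3) 0"
    have y0: "?y \<noteq> 0" using fD(2) by (simp add: zero_vec3_def)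
    have "v \<noteq> 0 \<and> (reflm b \<circ> diagm (- 1)) v = smul (4 * b * (1 + b ^ 4) * w) v \<longleftrightarrow> (\<exists>t. t \<noteq> 0 \<and> v = smul t ?y)" for v
    proof -
      obtain x1 x2 x3 where v: "v = Vec x1 x2 x3" by (cases v)
      show ?thesis
      proof
        assume a: "v \<noteq> 0 \<and> (reflm b \<circ> diagm (- 1)) v = smul (4 * b * (1 + b ^ 4) * w) v"
        then have "l x1 x2 x3 = 0 \<and> x3 = 0" using key[of x1 x2 x3 w] True w1[of w] unfolding v g by blast
        then have x3: "x3 = 0" and l0: "l x1 x2 0 = 0" by auto
        have "l x1 x2 0 = 2 * b\<^sup>2 * x2 - (b ^ 4 + 3) * x1" by (simp add: l_def)
        then have e: "(b ^ 4 + 3) * x1 = 2 * b\<^sup>2 * x2" using l0 by simp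
        have "v = smul (x1 / (2 * b\<^sup>2)) ?y" using fD(2) e by (simp add: v x3 field_simps)
        moreover have "x1 / (2 * b\<^sup>2) \<noteq> 0" using calculation a by (auto simp: zero_vec3_def)
        ultimately show "\<exists>t. t \<noteq> 0 \<and> v = smul t ?y" by blast
      next
        assume "\<exists>t. t \<noteq> 0 \<and> v = smul t ?y"
        then obtain t where t: "t \<noteq> 0" "v = smul t ?y" by blast
        have "v \<noteq> 0" unfolding t(2) smul_eq_0_iff using t(1) y0 by simp
        moreover have x: "x1 = t * (2 * b\<^sup>2)" "x2 = t * (b ^ 4 + 3)" "x3 = 0" using t(2) by (simp_all add: v)
        have "l x1 x2 x3 = 0" unfolding l_def x by Groebner_Basis.algebra
        ultimately show "v \<noteq> 0 \<and> (reflm b \<circ> diagm (- 1)) v = smul (4 * b * (1 + b ^ 4) * w) v"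
          unfolding v g by (simp add: True x(3))
      qed
    qed
    then show ?thesis using y0 by blast
  next
    case False
    then have w: "w * w + w + 1 = 0" using that by simp
    have w0: "1 - w \<noteq> 0" "1 + w \<noteq> 0" using w1[OF w] by (auto simp: add_eq_0_iff)
    let ?y = "Vec (2 * b * (1 + w)) (- 2 * b ^ 3 * (1 + w)) (n * (1 - w))"
    have y0: "?y \<noteq> 0" using n0 w0 by (simp add: zero_vec3_def)
    have "v \<noteq> 0 \<and> (reflm b \<circ> diagm (- 1)) v = smul (4 * b * (1 + b ^ 4) * w) v \<longleftrightarrow> (\<exists>t. t \<noteq> 0 \<and> v = smul t ?y)" for v
    proof -
      obtain x1 x2 x3 where v: "v = Vec x1 x2 x3" by (cases v)
      show ?thesis
      proof
        assume a: "v \<noteq> 0 \<and> (reflm b \<circ> diagm (- 1)) v = smul (4 * b * (1 + b ^ 4) * w) v"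
        then have e: "x1 * (s * (1 - w)) = - 2 * b * l x1 x2 x3" "x2 * (s * (1 - w)) = 2 * b ^ 3 * l x1 x2 x3"
            "x3 * (s * (1 + w)) = - n * l x1 x2 x3" unfolding v g by blast+
        have l0: "l x1 x2 x3 \<noteq> 0" using key[of x1 x2 x3 w] a e False v by blast
        have "l x1 x2 x3 / (s * (1 - w) * (1 + w) * 1) \<noteq> 0" using l0 s0 w0 by simp
        then obtain k where k: "k \<noteq> 0" "x1 = k * (- 2 * b * (1 + w) * 1)" "x2 = k * (2 * b ^ 3 * (1 + w) * 1)" "x3 = k * (- n * (1 - w) * 1)"
          using solve_common_denominator[OF s0 w0 one_neq_zero] e by blast
        have "v = smul (- k) ?y" unfolding v k by simp
        moreover have "- k \<noteq> 0" using k(1) by simp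
        ultimately show "\<exists>t. t \<noteq> 0 \<and> v = smul t ?y" by blast
      next
        assume "\<exists>t. t \<noteq> 0 \<and> v = smul t ?y"
        then obtain t where t: "t \<noteq> 0" "v = smul t ?y" by blast
        have v0: "v \<noteq> 0" unfolding t(2) smul_eq_0_iff using t(1) y0 by simp
        have x: "x1 = t * (2 * b * (1 + w))" "x2 = t * (- 2 * b ^ 3 * (1 + w))" "x3 = t * (n * (1 - w))"
          using t(2) by (simp_all add: v)
        have "l x1 x2 x3 = - 4 * b * n * t * (2 + w)"
          unfolding l_def x n_def by Groebner_Basis.algebra
        moreover have "- 4 * b * n * t * (2 + w) = - s * t * (1 + w) * (1 - w) + - 4 * b * n * t * (w * w + w + 1)"
          unfolding s_def by Groebner_Basis.algebra
        ultimately have "l x1 x2 x3 = - s * t * (1 + w) * (1 - w)" unfolding w by simp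
        then show "v \<noteq> 0 \<and> (reflm b \<circ> diagm (- 1)) v = smul (4 * b * (1 + b ^ 4) * w) v"
          using v0 unfolding v g by (simp add: x)
      qed
    qed
    then show ?thesis using y0 by blast
  qed
qed

text \<open>The equation is the characteristic one of \<open>reflm b \<circ> diagm i\<close>,
  normalized and with denominators cleared. This map is an automorphism of order four about another
  flex, so its eigenvalues are proportional to the entries \<open>1, - 1, - i\<close> of
  \<open>diagm (- i)\<close>.\<close>

lemma order4_eigenvalues:
  fixes n i :: "'k::prime_field"
  assumes n: "n * n = 8 - 4 * n" and i: "i * i = - 1" and n0: "n \<noteq> 0"
  shows "card {w. 2 * n * (i - w) * (1 - w * w) = i * n * (1 - w * w) + (n + 2) * (i - w) * (1 + w) + 2 * (n - 1) * (i - w) * (1 - w)} = 3"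
proof -
  \<comment> \<open>For eigenvalues \<open>w0, - w0, - (i * w0)\<close> the sum gives
    \<open>w0\<close> as \<open>i\<close> times the normalized trace. Since
    \<open>(n + 2)\<^sup>2 = 12\<close>, it is a primitive cube root of unity.\<close>
  define w0 where "w0 = - (2 + i * (n + 2)) / 4"
  have w4: "4 * w0 = - (2 + i * (n + 2))" by (simp add: w0_def)
  have "4 * (4 * (w0 * w0)) = (4 * w0) * (4 * w0)" by Groebner_Basis.algebra
  also have "\<dots> = 4 + 4 * i * (n + 2) + (i * i) * (n * n + 4 * n + 4)" unfolding w4 by Groebner_Basis.algebra
  also have "\<dots> = 4 * (- 2 + i * (n + 2))" unfolding i n by Groebner_Basis.algebra
  finally have q4: "4 * (w0 * w0) = - 2 + i * (n + 2)" by (simp only: mult_cancel_left four_neq_0 simp_thms)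
  have "4 * (4 * (w0 * w0 * w0)) = (4 * w0) * (4 * (w0 * w0))" by Groebner_Basis.algebra
  also have "\<dots> = 4 - (i * i) * (n * n + 4 * n + 4)" unfolding w4 q4 by Groebner_Basis.algebra
  also have "\<dots> = 4 * (4 * 1)" unfolding i n by Groebner_Basis.algebra
  finally have w3: "w0 * w0 * w0 = 1" by (simp only: mult_cancel_left four_neq_0 simp_thms)
  have p4: "4 * (i * w0) = n + 2 - 2 * i"
  proof -
    have "4 * (i * w0) = i * (4 * w0)" by Groebner_Basis.algebra
    also have "\<dots> = - 2 * i - (i * i) * (n + 2)" unfolding w4 by Groebner_Basis.algebra
    finally show ?thesis unfolding i by simp
  qed
  have P: "2 * n * (i * w0) = 4 - n - i * n"
  proof -
    have "4 * (2 * n * (i * w0)) = 2 * n * (4 * (i * w0))" by Groebner_Basis.algebra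
    also have "\<dots> = 2 * (n * n) + 4 * n - 4 * i * n" unfolding p4 by Groebner_Basis.algebra
    also have "\<dots> = 4 * (4 - n - i * n)" unfolding n by Groebner_Basis.algebra
    finally show ?thesis by (simp only: mult_cancel_left four_neq_0 simp_thms)
  qed
  have Q: "2 * n * (w0 * w0) = 4 * i - n - n * i"
  proof -
    have "4 * (2 * n * (w0 * w0)) = 2 * n * (4 * (w0 * w0))" by Groebner_Basis.algebra
    also have "\<dots> = 2 * i * (n * n) + 4 * n * i - 4 * n" unfolding q4 by Groebner_Basis.algebra
    also have "\<dots> = 4 * (4 * i - n - n * i)" unfolding n by Groebner_Basis.algebra
    finally show ?thesis by (simp only: mult_cancel_left four_neq_0 simp_thms)
  qed
  have fac: "2 * n * (i - w) * (1 - w * w) - (i * n * (1 - w * w) + (n + 2) * (i - w) * (1 + w) + 2 * (n - 1) * (i - w) * (1 - w))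
     = 2 * n * ((w - w0) * (w + w0) * (w + i * w0))" for w
  proof -
    have "2 * n * ((w - w0) * (w + w0) * (w + i * w0)) =
       2 * n * w * w * w + (2 * n * (i * w0)) * w * w - (2 * n * (w0 * w0)) * w - 2 * n * i * (w0 * w0 * w0)"
      by Groebner_Basis.algebra
    then show ?thesis unfolding P Q w3 by Groebner_Basis.algebra
  qed
  note f = i_facts[OF i]
  have w0: "w0 \<noteq> 0" using w3 by auto
  have "2 * n * (i - w) * (1 - w * w) = i * n * (1 - w * w) + (n + 2) * (i - w) * (1 + w) + 2 * (n - 1) * (i - w) * (1 - w)
     \<longleftrightarrow> w \<in> {w0, - w0, - (i * w0)}" for w
  proof -
    have "2 * n * (i - w) * (1 - w * w) = i * n * (1 - w * w) + (n + 2) * (i - w) * (1 + w) + 2 * (n - 1) * (i - w) * (1 - w)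
      \<longleftrightarrow> 2 * n * ((w - w0) * (w + w0) * (w + i * w0)) = 0"
      unfolding fac[symmetric] right_minus_eq ..
    also have "\<dots> \<longleftrightarrow> w \<in> {w0, - w0, - (i * w0)}" using n0 by (simp add: eq_neg_iff_add_eq_0)
    finally show ?thesis .
  qed
  then have "{w. 2 * n * (i - w) * (1 - w * w) = i * n * (1 - w * w) + (n + 2) * (i - w) * (1 + w) + 2 * (n - 1) * (i - w) * (1 - w)}
     = {w0, - w0, - (i * w0)}" by (intro Set.set_eqI) (simp only: mem_Collect_eq)
  moreover have "w0 \<noteq> - w0"
  proof
    assume "w0 = - w0"
    then have "2 * w0 = 0" by (metis add.right_inverse mult_2)
    then show False using w0 by simp
  qed
  moreover have "w0 \<noteq> - (i * w0)"
  proof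
    assume "w0 = - (i * w0)"
    then have "(1 + i) * w0 = 0" by (simp add: distrib_right eq_neg_iff_add_eq_0)
    then show False using w0 f(3) by (simp add: eq_neg_iff_add_eq_0 add.commute)
  qed
  moreover have "- w0 \<noteq> - (i * w0)" using w0 f(2) by simp
  ultimately show ?thesis by simp
qed

text \<open>The same elimination as for translations. Here no eigenvector has \<open>l = 0\<close>,
  all three eigenvalues are distinct, and they lie in the field as soon as \<open>i\<close> and a
  rational flex do.\<close>

lemma eig_order4:
  fixes b :: "'k::prime_field"
  assumes b: "b \<in> froots" and i: "i * i = - 1"
  shows "eig (reflm b \<circ> diagm i) = (CARD('k) - 1) * 3"
proof -
  note fD = frootsD[OF b] and f = i_facts[OF i]
  define n where "n = 1 + b ^ 4"
  define s where "s = 4 * b * n"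
  have s0: "s \<noteq> 0" and n0: "n \<noteq> 0" using fD by (simp_all add: s_def n_def)
  have nn: "n * n = 8 - 4 * n"
  proof -
    have "n * n = b ^ 8 + 6 * b ^ 4 - 4 * n + 5" unfolding n_def by Groebner_Basis.algebra
    then show ?thesis unfolding fD(1) by simp
  qed
  have n2: "n + 2 \<noteq> 0"
  proof
    assume "n + 2 = 0"
    moreover have "(n + 2) * (n + 2) = n * n + 4 * n + 4" by Groebner_Basis.algebra
    ultimately have "4 * 3 = (0::'k)" unfolding nn by simp
    then show False by (simp only: mult_eq_0_iff four_neq_0 three_neq_0 simp_thms)
  qed
  define l where "l x1 x2 x3 = 2 * b * (i * x3) - (n + 2) * x1 - 2 * b\<^sup>2 * x2" for x1 x2 x3
  define S where "S = {w. 2 * n * (i - w) * (1 - w * w) = i * n * (1 - w * w) + (n + 2) * (i - w) * (1 + w) + 2 * (n - 1) * (i - w) * (1 - w)}"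
  have g: "(reflm b \<circ> diagm i) (Vec x1 x2 x3) = smul (s * w) (Vec x1 x2 x3) \<longleftrightarrow>
     x1 * (s * (1 - w)) = - 2 * b * l x1 x2 x3 \<and> x2 * (s * (1 + w)) = - 2 * b ^ 3 * l x1 x2 x3 \<and>
     x3 * (s * (i - w)) = n * l x1 x2 x3" for x1 x2 x3 w
  proof -
    have "lform b (diagm i (Vec x1 x2 x3)) = l x1 x2 x3" by (simp add: l_def i n_def algebra_simps)
    moreover have "flexpt b = Vec (2 * b) (- 2 * b ^ 3) (- n)" by (simp add: flexpt_def n_def)
    moreover have "diagm i (Vec x1 x2 x3) = Vec x1 (- x2) (i * x3)" by (simp add: i)
    ultimately have "(reflm b \<circ> diagm i) (Vec x1 x2 x3) = Vec (s * x1 + l x1 x2 x3 * (2 * b)) (s * (- x2) + l x1 x2 x3 * (- 2 * b ^ 3)) (s * (i * x3) + l x1 x2 x3 * (- n))"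
      unfolding comp_apply reflm_def n_def[symmetric] s_def[symmetric] by simp
    moreover have "s * x1 + l x1 x2 x3 * (2 * b) = s * w * x1 \<longleftrightarrow> x1 * (s * (1 - w)) = - 2 * b * l x1 x2 x3"
      by (auto simp: algebra_simps eq_neg_iff_add_eq_0)
    moreover have "s * (- x2) + l x1 x2 x3 * (- 2 * b ^ 3) = s * w * x2 \<longleftrightarrow> x2 * (s * (1 + w)) = - 2 * b ^ 3 * l x1 x2 x3"
      by (auto simp: algebra_simps eq_neg_iff_add_eq_0 neg_eq_iff_add_eq_0)
    moreover have "s * (i * x3) + l x1 x2 x3 * (- n) = s * w * x3 \<longleftrightarrow> x3 * (s * (i - w)) = n * l x1 x2 x3"
      by (auto simp: algebra_simps)
    ultimately show ?thesis by simp
  qed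
  have b5: "b\<^sup>2 * b ^ 3 = b * (n - 1)" by (simp add: n_def eval_nat_numeral)
  have id: "2 * b * l x1 x2 x3 * (2 * n * (i - w) * (1 - w * w) - (i * n * (1 - w * w) + (n + 2) * (i - w) * (1 + w) + 2 * (n - 1) * (i - w) * (1 - w)))
     = 2 * b * i * (1 - w * w) * (x3 * (s * (i - w)) - n * l x1 x2 x3)
       - (n + 2) * (i - w) * (1 + w) * (x1 * (s * (1 - w)) + 2 * b * l x1 x2 x3)
       - 2 * b\<^sup>2 * (i - w) * (1 - w) * (x2 * (s * (1 + w)) + 2 * b ^ 3 * l x1 x2 x3)" for x1 x2 x3 w
    unfolding l_def s_def n_def by Groebner_Basis.algebra
  have key: "l x1 x2 x3 \<noteq> 0 \<and> w \<in> S"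
    if v: "Vec x1 x2 x3 \<noteq> 0" and e: "x1 * (s * (1 - w)) = - 2 * b * l x1 x2 x3" "x2 * (s * (1 + w)) = - 2 * b ^ 3 * l x1 x2 x3"
      "x3 * (s * (i - w)) = n * l x1 x2 x3" for x1 x2 x3 w
  proof
    show l0: "l x1 x2 x3 \<noteq> 0"
    proof
      assume l: "l x1 x2 x3 = 0"
      have x: "x1 = 0 \<or> w = 1" "x2 = 0 \<or> w = - 1" "x3 = 0 \<or> w = i"
        using e s0 unfolding l by (auto simp: eq_neg_iff_add_eq_0 add.commute)
      have "x1 = 0 \<and> x2 = 0 \<and> x3 = 0"
        using x l f fD(2) n2 unfolding l_def by auto
      then show False using v by (simp add: zero_vec3_def)
    qed
    have "2 * b * l x1 x2 x3 * (2 * n * (i - w) * (1 - w * w) - (i * n * (1 - w * w) + (n + 2) * (i - w) * (1 + w) + 2 * (n - 1) * (i - w) * (1 - w))) = 0"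
      unfolding id e by simp
    then show "w \<in> S" using l0 fD(2) unfolding S_def by simp
  qed
  \<comment> \<open>The eigenvalues avoid the diagonal entries \<open>1\<close>, \<open>- 1\<close>,
    \<open>i\<close>, so the denominators that were cleared are nonzero.\<close>
  have S0: "1 - w \<noteq> 0 \<and> 1 + w \<noteq> 0 \<and> i - w \<noteq> 0" if w: "w \<in> S" for w
  proof (intro conjI notI)
    note ws = w[unfolded S_def mem_Collect_eq]
    have b40: "n - 1 \<noteq> 0" using fD(2) by (simp add: n_def)
    { assume "1 - w = 0"
      then have "w = 1" by simp
      then have "(n + 2) * ((i - 1) * 2) = 0" using ws by simp
      then show False using n2 f(2) by (simp only: mult_eq_0_iff right_minus_eq two_neq_0 simp_thms) }
    { assume "1 + w = 0"
      then have "w = - 1" by (simp add: eq_neg_iff_add_eq_0 add.commute)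
      then have "2 * (n - 1) * (i - (- 1)) * 2 = 0" using ws by simp
      then show False using b40 f(3) by (simp only: mult_eq_0_iff right_minus_eq two_neq_0 simp_thms) }
    { assume "i - w = 0"
      then have "w = i" by simp
      then have "i * n * 2 = 0" using ws i by simp
      then show False using f(1) n0 by (simp only: mult_eq_0_iff two_neq_0 simp_thms) }
  qed
  have "eig (reflm b \<circ> diagm i) = (CARD('k) - 1) * card S"
  proof (rule eig_lines[OF s0])
    show "w \<in> S" if "v \<noteq> 0" "(reflm b \<circ> diagm i) v = smul (s * w) v" for w v
      using that key by (cases v) (auto simp only: g)
    show "\<exists>y. y \<noteq> 0 \<and> (\<forall>v. v \<noteq> 0 \<and> (reflm b \<circ> diagm i) v = smul (s * w) v \<longleftrightarrow> (\<exists>t. t \<noteq> 0 \<and> v = smul t y))"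
      if w: "w \<in> S" for w
    proof -
      have w0: "1 - w \<noteq> 0" "1 + w \<noteq> 0" "i - w \<noteq> 0" using S0[OF w] by blast+
      let ?y = "Vec (- 2 * b * (1 + w) * (i - w)) (- 2 * b ^ 3 * (1 - w) * (i - w)) (n * (1 - w) * (1 + w))"
      have y0: "?y \<noteq> 0" using n0 w0 by (simp add: zero_vec3_def)
      have "v \<noteq> 0 \<and> (reflm b \<circ> diagm i) v = smul (s * w) v \<longleftrightarrow> (\<exists>t. t \<noteq> 0 \<and> v = smul t ?y)" for v
      proof -
        obtain x1 x2 x3 where v: "v = Vec x1 x2 x3" by (cases v)
        show ?thesis
        proof
          assume a: "v \<noteq> 0 \<and> (reflm b \<circ> diagm i) v = smul (s * w) v"
          then have e: "x1 * (s * (1 - w)) = - 2 * b * l x1 x2 x3" "x2 * (s * (1 + w)) = - 2 * b ^ 3 * l x1 x2 x3"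
            "x3 * (s * (i - w)) = n * l x1 x2 x3" unfolding v g by blast+
          have l0: "l x1 x2 x3 \<noteq> 0" using key[of x1 x2 x3 w] a e v by blast
          let ?t = "l x1 x2 x3 / (s * (1 - w) * (1 + w) * (i - w))"
          have "x1 = ?t * (- 2 * b * (1 + w) * (i - w))" "x2 = ?t * (- 2 * b ^ 3 * (1 - w) * (i - w))" "x3 = ?t * (n * (1 - w) * (1 + w))"
            using solve_common_denominator[OF s0 w0] e by blast+
          then have "v = smul ?t ?y" unfolding v smul.simps vec3.inject by blast
          moreover have "?t \<noteq> 0" using l0 s0 w0 by simp
          ultimately show "\<exists>t. t \<noteq> 0 \<and> v = smul t ?y" by blast
        next
          assume "\<exists>t. t \<noteq> 0 \<and> v = smul t ?y"
          then obtain t where t: "t \<noteq> 0" "v = smul t ?y" by blast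
          have v0: "v \<noteq> 0" unfolding t(2) smul_eq_0_iff using t(1) y0 by simp
          have x: "x1 = t * (- 2 * b * (1 + w) * (i - w))" "x2 = t * (- 2 * b ^ 3 * (1 - w) * (i - w))" "x3 = t * (n * (1 - w) * (1 + w))"
            using t(2) by (simp_all add: v)
          have "l x1 x2 x3 = 2 * b * t * (i * n * (1 - w * w) + (n + 2) * (i - w) * (1 + w)) + 4 * (b\<^sup>2 * b ^ 3) * t * (1 - w) * (i - w)"
            unfolding l_def x by Groebner_Basis.algebra
          also have "\<dots> = 2 * b * t * (i * n * (1 - w * w) + (n + 2) * (i - w) * (1 + w) + 2 * (n - 1) * (i - w) * (1 - w))"
            unfolding b5 by Groebner_Basis.algebra
          also have "\<dots> = 2 * b * t * (2 * n * (i - w) * (1 - w * w))"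
            by (rule arg_cong[where f = "\<lambda>x. 2 * b * t * x"]) (rule sym[OF w[unfolded S_def mem_Collect_eq]])
          also have "\<dots> = t * s * (1 - w) * (1 + w) * (i - w)" unfolding s_def by Groebner_Basis.algebra
          finally have L: "l x1 x2 x3 = t * s * (1 - w) * (1 + w) * (i - w)" .
          have "x1 * (s * (1 - w)) = - 2 * b * l x1 x2 x3" unfolding L unfolding x by Groebner_Basis.algebra
          moreover have "x2 * (s * (1 + w)) = - 2 * b ^ 3 * l x1 x2 x3" unfolding L unfolding x by Groebner_Basis.algebra
          moreover have "x3 * (s * (i - w)) = n * l x1 x2 x3" unfolding L unfolding x by Groebner_Basis.algebra
          ultimately show "v \<noteq> 0 \<and> (reflm b \<circ> diagm i) v = smul (s * w) v"
            using v0 unfolding v g by blast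
        qed
      qed
      then show ?thesis using y0 by blast
    qed
  qed
  also have "card S = 3" unfolding S_def by (rule order4_eigenvalues[OF nn i n0])
  finally show ?thesis .
qed

section \<open>The number of rational flexes\<close>

lemma CARD_gt_3: "CARD('k::prime_field) > 3"
proof -
  have "CARD('k) \<noteq> 2" using of_nat_CARD[where 'k = 'k] two_neq_0[where 'a = 'k] by (metis of_nat_numeral)
  moreover have "CARD('k) \<noteq> 3" using of_nat_CARD[where 'k = 'k] three_neq_0[where 'a = 'k] by (metis of_nat_numeral)
  moreover have "CARD('k) > 1" using prime_CARD[where 'k = 'k] by (rule prime_gt_1_nat)
  ultimately show ?thesis by linarith
qed

lemma one_neq_m1: "(1 :: 'k::prime_field) \<noteq> - 1"
  using two_neq_0 by (metis add.right_inverse one_add_one)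

section \<open>Quadratic residues in the prime field\<close>

lemma of_int_Legendre:
  "of_int (Legendre a (int CARD('k))) = (of_int a :: 'k::prime_field) ^ ((CARD('k) - 1) div 2)"
proof -
  have "[Legendre a (int CARD('k)) = a ^ ((CARD('k) - 1) div 2)] (mod int CARD('k))"
    by (rule euler_criterion[OF prime_CARD]) (use CARD_gt_3[where 'k = 'k] in simp)
  then have "of_int (Legendre a (int CARD('k))) = (of_int (a ^ ((CARD('k) - 1) div 2)) :: 'k)"
    by (simp only: of_int_eq_iff_CARD cong_def)
  then show ?thesis by simp
qed

lemma euler_field:
  fixes a :: "'k::prime_field"
  assumes "a \<noteq> 0"
  shows "a ^ ((CARD('k) - 1) div 2) = (if \<exists>x. x * x = a then 1 else - 1)"
proof -
  have "\<not> [rep a = 0] (mod int CARD('k))"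
    using of_int_eq_iff_CARD[of "rep a" 0, where 'k = 'k] assms by (simp add: cong_def)
  moreover have "QuadRes (int CARD('k)) (rep a) \<longleftrightarrow> (\<exists>x. x * x = a)"
  proof
    assume "QuadRes (int CARD('k)) (rep a)"
    then obtain y where "[y\<^sup>2 = rep a] (mod int CARD('k))" by (auto simp: QuadRes_def)
    then have "of_int (y\<^sup>2) = (of_int (rep a) :: 'k)" by (simp only: of_int_eq_iff_CARD cong_def)
    then show "\<exists>x. x * x = a" by (intro exI[of _ "of_int y"]) (simp add: power2_eq_square)
  next
    assume "\<exists>x. x * x = a"
    then obtain x where "x * x = a" by blast
    then have "of_int ((rep x)\<^sup>2) = (of_int (rep a) :: 'k)" by (simp add: power2_eq_square)
    then show "QuadRes (int CARD('k)) (rep a)" unfolding QuadRes_def cong_def of_int_eq_iff_CARD by blast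
  qed
  ultimately have L: "Legendre (rep a) (int CARD('k)) = (if \<exists>x. x * x = a then 1 else - 1)"
    by (simp add: Legendre_def)
  have "a ^ ((CARD('k) - 1) div 2) = of_int (if \<exists>x. x * x = a then 1 else - 1)"
    using of_int_Legendre[of "rep a", where 'k = 'k] unfolding L of_int_rep by (rule sym)
  also have "\<dots> = (if \<exists>x. x * x = a then 1 else - 1)" by (rule trans[OF if_distrib]) simp
  finally show ?thesis .
qed

lemma square_iff_pow:
  "a \<noteq> (0 :: 'k::prime_field) \<Longrightarrow> (\<exists>x. x * x = a) \<longleftrightarrow> a ^ ((CARD('k) - 1) div 2) = 1"
  using euler_field[of a] one_neq_m1[where 'k = 'k] by (auto split: if_splits)

lemma nonsquare_iff_pow:
  "a \<noteq> (0 :: 'k::prime_field) \<Longrightarrow> (\<nexists>x. x * x = a) \<longleftrightarrow> a ^ ((CARD('k) - 1) div 2) = - 1"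
  using euler_field[of a] one_neq_m1[where 'k = 'k] by (auto split: if_splits)

lemma sqrt_minus_1_iff: "(\<exists>i :: 'k::prime_field. i * i = - 1) \<longleftrightarrow> even ((CARD('k) - 1) div 2)"
  using square_iff_pow[of "- 1 :: 'k"] one_neq_m1[where 'k = 'k] by (cases "even ((CARD('k) - 1) div 2)") auto

lemma Legendre_3: "\<not> 3 dvd p \<Longrightarrow> Legendre (int p) 3 = (if p mod 3 = 1 then 1 else - 1)"
proof -
  assume "\<not> 3 dvd p"
  then have p3: "p mod 3 = 1 \<or> p mod 3 = 2" by presburger
  have "\<not> [int p = 0] (mod 3)" using p3 by (auto simp: cong_def) presburger+
  moreover have "QuadRes 3 (int p) \<longleftrightarrow> p mod 3 = 1"
  proof
    assume "p mod 3 = 1"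
    then have "[1\<^sup>2 = int p] (mod 3)" by (simp add: cong_def) presburger
    then show "QuadRes 3 (int p)" unfolding QuadRes_def by blast
  next
    assume "QuadRes 3 (int p)"
    then obtain y where y: "[y\<^sup>2 = int p] (mod 3)" by (auto simp: QuadRes_def)
    have "y mod 3 = 0 \<or> y mod 3 = 1 \<or> y mod 3 = 2" by presburger
    then have "y\<^sup>2 mod 3 = 0 \<or> y\<^sup>2 mod 3 = 1" using power_mod[of y 3 2] by auto
    then have "int p mod 3 = 0 \<or> int p mod 3 = 1" using y by (simp add: cong_def)
    then show "p mod 3 = 1" using p3 by presburger
  qed
  ultimately show ?thesis by (simp add: Legendre_def)
qed

text \<open>Quadratic reciprocity carried into the field. Whether \<open>3\<close> is a square
  depends on \<open>p mod 3\<close> and on whether \<open>- 1\<close> is one, hence on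
  \<open>p mod 12\<close>.\<close>

lemma three_pow:
  "(3 :: 'k::prime_field) ^ ((CARD('k) - 1) div 2) = (if CARD('k) mod 3 = 1 then 1 else - 1) * (- 1) ^ ((CARD('k) - 1) div 2)"
proof -
  let ?p = "CARD('k)"
  have p3: "?p > 3" by (rule CARD_gt_3)
  have "\<not> 3 dvd ?p"
  proof
    assume "3 dvd ?p"
    then have "3 = ?p" using prime_CARD[where 'k = 'k] unfolding prime_nat_iff by auto
    then show False using p3 by simp
  qed
  note L3 = Legendre_3[OF this]
  have pr3: "Factorial_Ring.prime (3::nat)" by simp
  have "Legendre (int ?p) (int 3) * Legendre (int 3) (int ?p) = (- 1) ^ ((?p - 1) div 2 * ((3 - 1) div 2))"
    by (rule Quadratic_Reciprocity) (use prime_CARD[where 'k = 'k] pr3 p3 in simp_all)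
  then have Q: "Legendre (int ?p) 3 * Legendre 3 (int ?p) = (- 1) ^ ((?p - 1) div 2)" by simp
  have "Legendre 3 (int ?p) = Legendre (int ?p) 3 * (Legendre (int ?p) 3 * Legendre 3 (int ?p))"
    unfolding L3 by simp
  also have "\<dots> = Legendre (int ?p) 3 * (- 1) ^ ((?p - 1) div 2)" by (simp only: Q)
  also have "\<dots> = (if ?p mod 3 = 1 then 1 else - 1) * (- 1) ^ ((?p - 1) div 2)" by (simp only: L3)
  finally have "(of_int (Legendre 3 (int ?p)) :: 'k) = of_int ((if ?p mod 3 = 1 then 1 else - 1) * (- 1) ^ ((?p - 1) div 2))"
    by (rule arg_cong)
  then show ?thesis unfolding of_int_Legendre by (simp split: if_splits)
qed

text \<open>Completing the square in the equation for \<open>b\<^sup>4\<close> gives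
  \<open>(b\<^sup>4 + 3)\<^sup>2 = 12\<close>.\<close>

lemma froots_imp_sqrt_3:
  fixes b :: "'k::prime_field"
  assumes b: "b \<in> froots"
  shows "\<exists>s :: 'k. s * s = 3"
proof -
  have "4 * ((b ^ 4 + 3) / 2 * ((b ^ 4 + 3) / 2)) = (b ^ 4 + 3) * (b ^ 4 + 3)" by simp
  also have "\<dots> = (b ^ 8 + 6 * b ^ 4) + 9" by Groebner_Basis.algebra
  also have "\<dots> = 4 * 3" unfolding frootsD(1)[OF b] by simp
  finally have "(b ^ 4 + 3) / 2 * ((b ^ 4 + 3) / 2) = 3" by (simp only: mult_cancel_left four_neq_0 simp_thms)
  then show ?thesis by blast
qed

lemma froots_empty:
  assumes "CARD('k::prime_field) mod 12 = 5 \<or> CARD('k) mod 12 = 7"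
  shows "(froots :: 'k set) = {}"
proof -
  have "(3::'k) ^ ((CARD('k) - 1) div 2) = - 1"
  proof (cases "CARD('k) mod 12 = 5")
    case True
    then have "CARD('k) mod 3 \<noteq> 1" "even ((CARD('k) - 1) div 2)" by presburger+
    then show ?thesis unfolding three_pow by simp
  next
    case False
    then have "CARD('k) mod 12 = 7" using assms by simp
    then have "CARD('k) mod 3 = 1" "odd ((CARD('k) - 1) div 2)" by presburger+
    then show ?thesis unfolding three_pow by simp
  qed
  then have "\<nexists>s :: 'k. s * s = 3" using nonsquare_iff_pow[of "3 :: 'k"] by simp
  then show ?thesis using froots_imp_sqrt_3 by blast
qed

lemma froots_iff:
  assumes "x + y = - 6" "x * y = - 3"
  shows "b \<in> froots \<longleftrightarrow> b ^ 4 = x \<or> b ^ 4 = (y :: 'k::prime_field)"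
proof -
  have "(b ^ 4 - x) * (b ^ 4 - y) = b ^ 8 - (x + y) * b ^ 4 + x * y" by Groebner_Basis.algebra
  also have "\<dots> = b ^ 8 + 6 * b ^ 4 - 3" unfolding assms by simp
  finally have "b ^ 8 + 6 * b ^ 4 - 3 = 0 \<longleftrightarrow> b ^ 4 = x \<or> b ^ 4 = y" by (metis mult_eq_0_iff right_minus_eq)
  then show ?thesis unfolding froots_def mem_Collect_eq right_minus_eq .
qed

text \<open>Here \<open>3\<close> is a square and \<open>- 1\<close> is not. The two candidates for
  \<open>b\<^sup>4\<close> have the nonsquare product \<open>- 3\<close>, so exactly one of them,
  \<open>x\<close>, is a square. Of its two square roots exactly one, \<open>z\<close>, is a square
  again, which leaves the two values of \<open>b\<close>.\<close>

lemma card_froots_11: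
  assumes p: "CARD('k::prime_field) mod 12 = 11"
  shows "card (froots :: 'k set) = 2"
proof -
  let ?h = "(CARD('k) - 1) div 2"
  have p': "CARD('k) mod 3 \<noteq> 1" "odd ?h" using p by presburger+
  have "(3::'k) ^ ?h = 1" unfolding three_pow using p' by simp
  then obtain s0 :: 'k where s0: "s0 * s0 = 3" using square_iff_pow[of "3 :: 'k"] by auto
  have m1: "(- 1 :: 'k) ^ ?h = - 1" using p' by simp
  have prod: "(2 * s - 3) * (- 2 * s - 3) = - 3" if "s * s = 3" for s :: 'k
  proof -
    have "(2 * s - 3) * (- 2 * s - 3) = 9 - 4 * (s * s)" by Groebner_Basis.algebra
    then show ?thesis unfolding that by simp
  qed
  have nz: "2 * s - 3 \<noteq> 0 \<and> - 2 * s - 3 \<noteq> 0" if "s * s = 3" for s :: 'k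
    using prod[OF that] three_neq_0[where 'a = 'k] by (metis mult_zero_left mult_zero_right neg_equal_0_iff_equal)
  have "(- 3 :: 'k) ^ ?h = - 1"
  proof -
    have "(- 3 :: 'k) ^ ?h = (- 1) ^ ?h * 3 ^ ?h" by (simp flip: power_mult_distrib)
    then show ?thesis unfolding m1 \<open>3 ^ ?h = 1\<close> by simp
  qed
  then have chi: "(2 * s - 3) ^ ?h * (- 2 * s - 3) ^ ?h = - 1" if "s * s = 3" for s :: 'k
    unfolding power_mult_distrib[symmetric] prod[OF that] .
  have "\<exists>s :: 'k. s * s = 3 \<and> (2 * s - 3) ^ ?h = 1"
  proof (cases "(2 * s0 - 3) ^ ?h = 1")
    case False
    then have "(2 * s0 - 3) ^ ?h = - 1" using euler_field[of "2 * s0 - 3"] nz[OF s0] by (auto split: if_splits)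
    then have "(- 2 * s0 - 3) ^ ?h = 1" using chi[OF s0] by simp
    then show ?thesis using s0 by (intro exI[of _ "- s0"]) simp
  qed (use s0 in blast)
  then obtain s :: 'k where s: "s * s = 3" "(2 * s - 3) ^ ?h = 1" by blast
  define x y where "x = 2 * s - 3" and "y = - 2 * s - 3"
  have x0: "x \<noteq> 0" and y0: "y \<noteq> 0" using nz[OF s(1)] by (simp_all add: x_def y_def)
  have xh: "x ^ ?h = 1" and yh: "y ^ ?h = - 1" using s(2) chi[OF s(1)] by (simp_all add: x_def y_def)
  have fr: "b \<in> froots \<longleftrightarrow> b ^ 4 = x \<or> b ^ 4 = y" for b
    by (rule froots_iff) (simp add: x_def y_def, use prod[OF s(1)] in \<open>simp only: x_def y_def\<close>)
  obtain z0 where z0: "z0 * z0 = x" using square_iff_pow[OF x0] xh by blast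
  have neg: "(- z) ^ ?h = - (z ^ ?h)" for z :: 'k using p' by simp
  have "\<exists>z. z * z = x \<and> z ^ ?h = 1"
  proof (cases "z0 ^ ?h = 1")
    case False
    have "z0 \<noteq> 0" using z0 x0 by auto
    then have "z0 ^ ?h = - 1" using euler_field[of z0] False by (auto split: if_splits)
    then show ?thesis using z0 neg[of z0] by (intro exI[of _ "- z0"]) simp
  qed (use z0 in blast)
  then obtain z where z: "z * z = x" "z ^ ?h = 1" by blast
  have z00: "z \<noteq> 0" using z(1) x0 by auto
  obtain c where c: "c * c = z" using square_iff_pow[OF z00] z(2) by blast
  have c0: "c \<noteq> 0" using c z00 by auto
  have "b \<in> froots \<longleftrightarrow> b \<in> {c, - c}" for b
  proof -
    have b4: "b ^ 4 = (b * b) * (b * b)" by (simp add: eval_nat_numeral mult.assoc)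
    have "b ^ 4 \<noteq> y" using nonsquare_iff_pow[OF y0] yh unfolding b4 by blast
    moreover have "b ^ 4 = x \<longleftrightarrow> b * b = z"
    proof
      assume "b ^ 4 = x"
      then have "(b * b) * (b * b) = z * z" unfolding b4 z(1) .
      then have "b * b = z \<or> b * b = - z" by (simp only: square_eq_iff)
      moreover have "b * b \<noteq> - z"
      proof -
        have "(- z) ^ ?h = - 1" using neg[of z] z(2) by simp
        then show ?thesis using nonsquare_iff_pow[of "- z"] z00 by auto
      qed
      ultimately show "b * b = z" by blast
    qed (simp only: b4 z(1)[symmetric])
    moreover have "b * b = z \<longleftrightarrow> b \<in> {c, - c}" unfolding c[symmetric] square_eq_iff by simp
    ultimately show ?thesis unfolding fr by blast
  qed
  then have "(froots :: 'k set) = {c, - c}" by (intro Set.set_eqI)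
  moreover have "c \<noteq> - c"
  proof
    assume "c = - c"
    then have "2 * c = 0" by (metis add.right_inverse mult_2)
    then show False using c0 by simp
  qed
  ultimately show ?thesis unfolding card_2_iff by blast
qed

lemma fourth_roots:
  assumes i: "i * i = (- 1 :: 'k::prime_field)"
  shows "x ^ 4 = c ^ 4 \<longleftrightarrow> x \<in> {c, - c, i * c, - (i * c)}"
    and "c \<noteq> 0 \<Longrightarrow> card {c, - c, i * c, - (i * c)} = 4"
proof -
  note f = i_facts[OF i]
  have "x ^ 4 = c ^ 4 \<longleftrightarrow> (x * x) * (x * x) = (c * c) * (c * c)" by (simp add: eval_nat_numeral mult.assoc)
  also have "\<dots> \<longleftrightarrow> x * x = c * c \<or> x * x = - (c * c)" by (simp only: square_eq_iff)
  also have "- (c * c) = (i * c) * (i * c)"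
  proof -
    have "(i * c) * (i * c) = (i * i) * (c * c)" by (simp only: mult_ac)
    then show ?thesis unfolding i by simp
  qed
  finally show "x ^ 4 = c ^ 4 \<longleftrightarrow> x \<in> {c, - c, i * c, - (i * c)}" by (simp only: square_eq_iff insert_iff empty_iff simp_thms disj_assoc)
  assume c: "c \<noteq> 0"
  have m: "z \<noteq> - z" if "z \<noteq> 0" for z :: 'k
  proof
    assume "z = - z"
    then have "2 * z = 0" by (metis add.right_inverse mult_2)
    then show False using that by simp
  qed
  have "c \<noteq> - c" "i * c \<noteq> - (i * c)" using m[of c] m[of "i * c"] c f(1) by simp_all
  moreover have "c \<noteq> i * c" "- c \<noteq> i * c" "c \<noteq> - (i * c)" "- c \<noteq> - (i * c)"
  proof -
    show "c \<noteq> i * c" "- c \<noteq> - (i * c)" using c f(2) by simp_all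
    have "- c = i * c \<longleftrightarrow> (i + 1) * c = 0" by (simp add: distrib_right neg_eq_iff_add_eq_0 add.commute)
    then show "- c \<noteq> i * c" using c f(3) by (simp add: eq_neg_iff_add_eq_0)
    then show "c \<noteq> - (i * c)" by (metis minus_minus)
  qed
  ultimately show "card {c, - c, i * c, - (i * c)} = 4" by simp
qed

text \<open>When \<open>- 1\<close> is a square, a single rational flex besides \<open>e3\<close>
  makes all nine rational. The fourth roots of unity turn \<open>b\<close> into four parameters, and
  one from the other quadruple can be written down.\<close>

lemma card_froots_8:
  fixes b i :: "'k::prime_field"
  assumes b: "b \<in> froots" and i: "i * i = - 1"
  shows "card (froots :: 'k set) = 8"
proof -
  note fD = frootsD[OF b]
  define n where "n = 1 + b ^ 4"
  have n0: "n \<noteq> 0" using fD by (simp add: n_def)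
  have nn: "n * n = 8 - 4 * n"
  proof -
    have "n * n = b ^ 8 + 6 * b ^ 4 - 4 * n + 5" unfolding n_def by Groebner_Basis.algebra
    then show ?thesis unfolding fD(1) by simp
  qed
  \<comment> \<open>A fourth root of the other solution \<open>- 6 - b\<^sup>4\<close> of
    \<open>t\<^sup>2 + 6 t - 3 = 0\<close>. It stems from multiplication of the 3-torsion point of
    \<open>b\<close> by \<open>1 + i\<close> or \<open>1 - i\<close>.\<close>
  define c where "c = 2 * b * (1 + i) / n"
  have cn: "c * n = 2 * b * (1 + i)" using n0 by (simp add: c_def)
  have i4: "(1 + i) ^ 4 = - 4"
  proof -
    have "(1 + i) ^ 4 = (1 + 2 * i + i * i) * (1 + 2 * i + i * i)" by Groebner_Basis.algebra
    also have "\<dots> = (2 * i) * (2 * i)" unfolding i by simp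
    also have "\<dots> = 4 * (i * i)" by Groebner_Basis.algebra
    finally show ?thesis unfolding i by simp
  qed
  have n4: "n ^ 4 = 64 * (3 - 2 * n)"
  proof -
    have "n ^ 4 = (n * n) * (n * n)" by (simp add: eval_nat_numeral mult.assoc)
    also have "\<dots> = (8 - 4 * n) * (8 - 4 * n)" by (simp only: nn)
    also have "\<dots> = 64 - 64 * n + 16 * (n * n)" by Groebner_Basis.algebra
    also have "\<dots> = 64 - 64 * n + 16 * (8 - 4 * n)" by (simp only: nn)
    also have "\<dots> = 64 * (3 - 2 * n)" by Groebner_Basis.algebra
    finally show ?thesis .
  qed
  have "c ^ 4 * n ^ 4 = (2 * b * (1 + i)) ^ 4" unfolding cn[symmetric] by (simp only: power_mult_distrib)
  also have "\<dots> = 16 * b ^ 4 * (1 + i) ^ 4" by (simp add: power_mult_distrib)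
  also have "\<dots> = - 64 * (n - 1)" unfolding i4 by (simp add: n_def)
  also have "\<dots> = (- n - 5) * n ^ 4"
  proof -
    have "(- n - 5) * (64 * (3 - 2 * n)) = 128 * (n * n) + 64 * (7 * n - 15)" by Groebner_Basis.algebra
    then show ?thesis unfolding n4 nn by simp
  qed
  finally have c4: "c ^ 4 = - n - 5" using n0 by simp
  have fr: "x \<in> froots \<longleftrightarrow> x ^ 4 = b ^ 4 \<or> x ^ 4 = c ^ 4" for x
  proof (rule froots_iff)
    show "b ^ 4 + c ^ 4 = - 6" unfolding c4 by (simp add: n_def)
    have "b ^ 4 * c ^ 4 = - (b ^ 8 + 6 * b ^ 4)" unfolding c4 n_def by Groebner_Basis.algebra
    then show "b ^ 4 * c ^ 4 = - 3" unfolding fD(1) .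
  qed
  have bc: "b ^ 4 \<noteq> c ^ 4"
  proof
    assume "b ^ 4 = c ^ 4"
    then have "2 * (n + 2) = 0" unfolding c4 by (simp add: n_def algebra_simps eq_neg_iff_add_eq_0)
    then have n2: "n + 2 = 0" by (simp only: mult_eq_0_iff two_neq_0 simp_thms)
    have "(n + 2) * (n + 2) = n * n + 4 * n + 4" by Groebner_Basis.algebra
    then have "4 * 3 = (0::'k)" unfolding nn n2 by simp
    then show False by (simp only: mult_eq_0_iff four_neq_0 three_neq_0 simp_thms)
  qed
  have c0: "c \<noteq> 0" using n0 fD(2) i_facts(3)[OF i] by (simp add: c_def eq_neg_iff_add_eq_0 add.commute)
  have F: "(froots :: 'k set) = {b, - b, i * b, - (i * b)} \<union> {c, - c, i * c, - (i * c)}"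
    by (intro Set.set_eqI) (simp only: fr fourth_roots(1)[OF i] Un_iff)
  have I: "{b, - b, i * b, - (i * b)} \<inter> {c, - c, i * c, - (i * c)} = {}"
  proof (rule Int_emptyI)
    fix x assume "x \<in> {b, - b, i * b, - (i * b)}" "x \<in> {c, - c, i * c, - (i * c)}"
    then have "x ^ 4 = b ^ 4" "x ^ 4 = c ^ 4" by (simp_all only: fourth_roots(1)[OF i])
    then show False using bc by simp
  qed
  have "card (froots :: 'k set) = card {b, - b, i * b, - (i * b)} + card {c, - c, i * c, - (i * c)}"
    unfolding F by (rule card_Un_disjoint[OF _ _ I]) simp_all
  then show ?thesis unfolding fourth_roots(2)[OF i fD(2)] fourth_roots(2)[OF i c0] by simp
qed

lemma Vp_neq_0_iff:
  "Vp CARD('k::prime_field) \<noteq> 0 \<longleftrightarrow> (\<exists>x y :: 'k. x ^ 4 + 6 * x ^ 2 - 3 = 0 \<and> y ^ 2 - (x ^ 3 - x) = 0)"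
proof -
  let ?p = "int CARD('k)"
  let ?V = "{(x, y). (x::int) \<in> {0..<?p} \<and> (y::int) \<in> {0..<?p} \<and>
     (x ^ 4 + 6 * x ^ 2 - 3) mod ?p = 0 \<and> (y ^ 2 - (x ^ 3 - x)) mod ?p = 0}"
  have "finite ?V" by (rule finite_subset[of _ "{0..<?p} \<times> {0..<?p}"]) auto
  then have "Vp CARD('k) \<noteq> 0 \<longleftrightarrow> ?V \<noteq> {}" unfolding Vp_def by simp
  also have "\<dots> \<longleftrightarrow> (\<exists>x y :: 'k. x ^ 4 + 6 * x ^ 2 - 3 = 0 \<and> y ^ 2 - (x ^ 3 - x) = 0)"
  proof
    assume "?V \<noteq> {}"
    then obtain x y where "?p dvd x ^ 4 + 6 * x ^ 2 - 3" "?p dvd y ^ 2 - (x ^ 3 - x)" by auto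
    then have "of_int (x ^ 4 + 6 * x ^ 2 - 3) = (0::'k)" "of_int (y ^ 2 - (x ^ 3 - x)) = (0::'k)"
      by (simp_all only: of_int_eq_0_iff_CARD)
    then show "\<exists>x y :: 'k. x ^ 4 + 6 * x ^ 2 - 3 = 0 \<and> y ^ 2 - (x ^ 3 - x) = 0"
      by (intro exI[of _ "of_int x"] exI[of _ "of_int y"]) simp
  next
    assume "\<exists>x y :: 'k. x ^ 4 + 6 * x ^ 2 - 3 = 0 \<and> y ^ 2 - (x ^ 3 - x) = 0"
    then obtain x y :: 'k where xy: "x ^ 4 + 6 * x ^ 2 - 3 = 0" "y ^ 2 - (x ^ 3 - x) = 0" by blast
    have "of_int ((rep x) ^ 4 + 6 * (rep x) ^ 2 - 3) = (0::'k)" "of_int ((rep y) ^ 2 - ((rep x) ^ 3 - rep x)) = (0::'k)"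
      using xy by simp_all
    then have "(rep x, rep y) \<in> ?V" using rep_range[of x] rep_range[of y]
      by (simp only: of_int_eq_0_iff_CARD mod_eq_0_iff_dvd mem_Collect_eq case_prod_conv simp_thms)
    then show "?V \<noteq> {}" by (metis empty_iff)
  qed
  finally show ?thesis .
qed

text \<open>The quartic can be written \<open>(x\<^sup>2 + 1)\<^sup>2 = - 4 (x\<^sup>2 - 1)\<close>,
  so at its roots \<open>x\<^sup>3 - x\<close> is \<open>- x\<close> times the square of
  \<open>(x\<^sup>2 + 1) / 2\<close>. With \<open>- 1\<close> a square, \<open>x\<^sup>3 - x\<close>
  is a square iff \<open>x\<close> is, and \<open>x = b\<^sup>2\<close> turns the quartic into the
  equation of \<open>froots\<close>.\<close>

lemma Vp_iff_froots:
  assumes i: "i * i = (- 1 :: 'k::prime_field)"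
  shows "Vp CARD('k) \<noteq> 0 \<longleftrightarrow> (froots :: 'k set) \<noteq> {}"
  unfolding Vp_neq_0_iff
proof
  assume "\<exists>x y :: 'k. x ^ 4 + 6 * x ^ 2 - 3 = 0 \<and> y ^ 2 - (x ^ 3 - x) = 0"
  then obtain z y :: 'k where z: "z ^ 4 + 6 * z ^ 2 - 3 = 0" and y: "y ^ 2 - (z ^ 3 - z) = 0" by blast
  have e: "(z\<^sup>2 + 1) * (z\<^sup>2 + 1) = - 4 * (z\<^sup>2 - 1)"
  proof -
    have "(z\<^sup>2 + 1) * (z\<^sup>2 + 1) = (z ^ 4 + 6 * z ^ 2 - 3) - 4 * (z\<^sup>2 - 1)" by Groebner_Basis.algebra
    then show ?thesis unfolding z by simp
  qed
  have z1: "z\<^sup>2 + 1 \<noteq> 0"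
  proof
    assume z1: "z\<^sup>2 + 1 = 0"
    then have "4 * (z\<^sup>2 - 1) = 0" using e by simp
    moreover have "4 * (z\<^sup>2 - 1) = 4 * (z\<^sup>2 + 1) - 4 * 2" by Groebner_Basis.algebra
    ultimately have "4 * 2 = (0::'k)" unfolding z1 by simp
    then show False by (simp only: mult_eq_0_iff four_neq_0 two_neq_0 simp_thms)
  qed
  define b where "b = 2 * i * y / (z\<^sup>2 + 1)"
  have bz: "b * (z\<^sup>2 + 1) = 2 * i * y" using z1 by (simp add: b_def)
  have "(b * b - z) * ((z\<^sup>2 + 1) * (z\<^sup>2 + 1)) = (b * (z\<^sup>2 + 1)) * (b * (z\<^sup>2 + 1)) - z * ((z\<^sup>2 + 1) * (z\<^sup>2 + 1))"
    by Groebner_Basis.algebra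
  also have "\<dots> = 4 * (i * i) * (y ^ 2) + 4 * z * (z\<^sup>2 - 1)" unfolding bz unfolding e by Groebner_Basis.algebra
  also have "\<dots> = - 4 * (y ^ 2 - (z ^ 3 - z))" unfolding i by Groebner_Basis.algebra
  finally have "(b * b - z) * ((z\<^sup>2 + 1) * (z\<^sup>2 + 1)) = 0" unfolding y by simp
  then have bb: "b * b = z" using z1 by simp
  have "b ^ 8 + 6 * b ^ 4 = (b * b) ^ 4 + 6 * (b * b) ^ 2" by Groebner_Basis.algebra
  also have "\<dots> = 3" using z unfolding bb by simp
  finally have "b \<in> froots" by (simp add: froots_def)
  then show "(froots :: 'k set) \<noteq> {}" by blast
next
  assume "(froots :: 'k set) \<noteq> {}"
  then obtain b :: 'k where b: "b \<in> froots" by blast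
  note fD = frootsD[OF b]
  define y where "y = i * b * (b ^ 4 + 1) / 2"
  have y2: "2 * y = i * b * (b ^ 4 + 1)" by (simp add: y_def)
  have "(b\<^sup>2) ^ 4 + 6 * (b\<^sup>2) ^ 2 - 3 = (b ^ 8 + 6 * b ^ 4) - 3" by Groebner_Basis.algebra
  then have 1: "(b\<^sup>2) ^ 4 + 6 * (b\<^sup>2) ^ 2 - 3 = 0" unfolding fD(1) by simp
  have "4 * (y ^ 2 - ((b\<^sup>2) ^ 3 - b\<^sup>2)) = (2 * y) * (2 * y) - 4 * (b ^ 6 - b\<^sup>2)" by Groebner_Basis.algebra
  also have "\<dots> = (i * i) * b\<^sup>2 * (b ^ 8 + 2 * b ^ 4 + 1) - 4 * (b ^ 6 - b\<^sup>2)" unfolding y2 by Groebner_Basis.algebra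
  also have "\<dots> = - (b\<^sup>2) * ((b ^ 8 + 6 * b ^ 4) - 3)" unfolding i by Groebner_Basis.algebra
  finally have "4 * (y ^ 2 - ((b\<^sup>2) ^ 3 - b\<^sup>2)) = 0" unfolding fD(1) by simp
  then have "y ^ 2 - ((b\<^sup>2) ^ 3 - b\<^sup>2) = 0" by (simp only: mult_eq_0_iff four_neq_0 simp_thms)
  then show "\<exists>x y :: 'k. x ^ 4 + 6 * x ^ 2 - 3 = 0 \<and> y ^ 2 - (x ^ 3 - x) = 0" using 1 by blast
qed

section \<open>The count\<close>

lemma card_range_quotient: "card (UNIV // {(x, y). f x = f y}) = card (range f)"
proof -
  have "UNIV // {(x, y). f x = f y} = (\<lambda>z. f -` {z}) ` range f"
  proof -
    have "UNIV // {(x, y). f x = f y} = (\<lambda>x. {(x, y). f x = f y} `` {x}) ` UNIV" unfolding quotient_def by blast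
    also have "\<dots> = (\<lambda>x. f -` {f x}) ` UNIV" by (rule image_cong) auto
    finally show ?thesis by (simp only: image_image)
  qed
  moreover have "inj_on (\<lambda>z. f -` {z}) (range f)"
    by (rule inj_onI) (metis (no_types, lifting) rangeE singletonD singletonI vimage_eq)
  ultimately show ?thesis by (simp add: card_image)
qed

text \<open>Sending \<open>v\<close> to the class of a copy of its model group on the naturals has
  the orbits as fibres, and its range is the set of classes counted by \<open>Dp\<close>.\<close>

lemma Dp_eq_orbits:
  "Dp CARD('k::prime_field) = card (UNIV // (orbit_rel :: ('k vec3 \<times> 'k vec3) set))"
proof -
  let ?r = "{(K, L). K \<cong> L} :: (nat monoid \<times> nat monoid) set"
  let ?A = "{K :: nat monoid. immediate_descendant_Gp CARD('k) K \<and> Coset.order K = CARD('k) ^ 10 \<and> has_exponent K CARD('k)}"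
  have "\<exists>L :: nat monoid. group L \<and> desc_group v \<cong> L" for v :: "'k vec3"
    using nat_copy[OF group_desc_group, of v] finite_elt by (metis carrier_desc_group)
  then obtain c :: "'k vec3 \<Rightarrow> nat monoid" where c: "\<And>v. group (c v)" "\<And>v. desc_group v \<cong> c v" by metis
  have sym: "L \<cong> K" if "group K" "K \<cong> L" for K :: "nat monoid" and L :: "nat monoid"
    using group.iso_sym[OF that] .
  \<comment> \<open>The classes are formed among all structures, and \<open>\<cong>\<close> ignores
    the unit, so they may contain structures that are not groups. For two groups equality of classes
    is still isomorphism.\<close>
  have cls: "?r `` {K} = ?r `` {L} \<longleftrightarrow> K \<cong> L" if "group K" "group L" for K L
  proof
    assume "?r `` {K} = ?r `` {L}"
    then have "L \<in> ?r `` {K}" using iso_refl[of L] by blast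
    then show "K \<cong> L" by simp
  next
    assume "K \<cong> L"
    then show "?r `` {K} = ?r `` {L}" using sym[OF that(1)] iso_trans by blast
  qed
  define f where "f v = ?r `` {c v}" for v
  have "f v = f v' \<longleftrightarrow> (v, v') \<in> orbit_rel" for v v'
  proof -
    have "f v = f v' \<longleftrightarrow> c v \<cong> c v'" unfolding f_def by (rule cls[OF c(1) c(1)])
    also have "\<dots> \<longleftrightarrow> desc_group v \<cong> desc_group v'"
    proof
      assume "c v \<cong> c v'"
      then have "desc_group v \<cong> c v'" by (rule iso_trans[OF c(2)])
      then show "desc_group v \<cong> desc_group v'" using group.iso_sym[OF group_desc_group c(2)[of v']] by (rule iso_trans)
    next
      assume "desc_group v \<cong> desc_group v'"
      then have "desc_group v \<cong> c v'" using c(2)[of v'] by (rule iso_trans)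
      then show "c v \<cong> c v'" by (rule iso_trans[OF group.iso_sym[OF group_desc_group c(2)[of v]]])
    qed
    also have "\<dots> \<longleftrightarrow> (v, v') \<in> orbit_rel"
      unfolding orbit_rel_def using desc_group_iso_imp_orbit orbit_imp_desc_group_iso by blast
    finally show ?thesis .
  qed
  then have orb: "orbit_rel = {(v, v'). f v = f v'}" by auto
  have A: "K \<in> ?A \<longleftrightarrow> is_desc CARD('k) K" for K by (simp add: is_desc_def)
  have "?A // ?r = range f"
  proof
    show "?A // ?r \<subseteq> range f"
    proof
      fix S assume "S \<in> ?A // ?r"
      then obtain K where K: "K \<in> ?A" "S = ?r `` {K}" by (rule quotientE)
      have gK: "group K" using K(1) by (simp add: immediate_descendant_Gp_def)
      obtain v :: "'k vec3" where v: "desc_group v \<cong> K" using is_desc_imp_iso[OF gK] K(1) A by blast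
      have "c v \<cong> K" by (rule iso_trans[OF group.iso_sym[OF group_desc_group c(2)] v])
      then have "f v = S" unfolding f_def K(2) using cls[OF c(1) gK] by blast
      then show "S \<in> range f" by blast
    qed
    show "range f \<subseteq> ?A // ?r"
    proof
      fix S assume "S \<in> range f"
      then obtain v where v: "S = f v" by blast
      have "c v \<in> ?A" unfolding A by (rule is_desc_iso[OF group_desc_group c(1) c(2) is_desc_desc_group])
      then show "S \<in> ?A // ?r" unfolding v f_def by (rule quotientI)
    qed
  qed
  then have "Dp CARD('k) = card (range f)" unfolding Dp_def by simp
  then show ?thesis unfolding orb card_range_quotient .
qed

lemma cidx_sum:
  "(\<Sum>(o', d)\<in>(cidx :: ('k::prime_field option \<times> 'k) set). F o' d) =
    (\<Sum>d\<in>{d :: 'k. d ^ 4 = 1}. F None d) + (\<Sum>b\<in>froots. \<Sum>d\<in>{d :: 'k. d ^ 4 = 1}. F (Some b) d)"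
proof -
  have "(\<Sum>(o', d)\<in>(cidx :: ('k option \<times> 'k) set). F o' d) = (\<Sum>o'\<in>insert None (Some ` (froots :: 'k set)). \<Sum>d\<in>{d :: 'k. d ^ 4 = 1}. F o' d)"
    unfolding cidx_def by (rule sum.cartesian_product[symmetric])
  also have "\<dots> = (\<Sum>d\<in>{d :: 'k. d ^ 4 = 1}. F None d) + (\<Sum>o'\<in>Some ` (froots :: 'k set). \<Sum>d\<in>{d :: 'k. d ^ 4 = 1}. F o' d)"
    by (rule sum.insert) auto
  also have "(\<Sum>o'\<in>Some ` (froots :: 'k set). \<Sum>d\<in>{d :: 'k. d ^ 4 = 1}. F o' d) = (\<Sum>b\<in>froots. \<Sum>d\<in>{d :: 'k. d ^ 4 = 1}. F (Some b) d)"
    by (simp add: sum.reindex)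
  finally show ?thesis .
qed

lemma card_cidx: "card (cidx :: ('k::prime_field option \<times> 'k) set) = (1 + card (froots :: 'k set)) * card {d :: 'k. d ^ 4 = 1}"
proof -
  have "card (insert None (Some ` (froots :: 'k set))) = 1 + card (froots :: 'k set)"
    by (simp add: card_image)
  then show ?thesis by (simp only: cidx_def card_cartesian_product)
qed

lemma unit_roots_no_i:
  assumes "\<nexists>i :: 'k::prime_field. i * i = - 1"
  shows "{d :: 'k. d ^ 4 = 1} = {1, - 1}"
proof -
  have "d ^ 4 = 1 \<longleftrightarrow> d \<in> {1, - 1}" for d :: 'k
  proof -
    have "d ^ 4 = 1 \<longleftrightarrow> (d * d) * (d * d) = 1 * 1" by (simp add: eval_nat_numeral mult.assoc)
    also have "\<dots> \<longleftrightarrow> d * d = 1 \<or> d * d = - 1" by (simp only: square_eq_iff)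
    also have "\<dots> \<longleftrightarrow> d * d = 1 * 1" using assms by auto
    also have "\<dots> \<longleftrightarrow> d \<in> {1, - 1}" by (simp only: square_eq_iff insert_iff empty_iff simp_thms)
    finally show ?thesis .
  qed
  then show ?thesis by (intro Set.set_eqI) (simp only: mem_Collect_eq)
qed

lemma unit_roots_i:
  assumes i: "i * i = (- 1 :: 'k::prime_field)"
  shows "{d :: 'k. d ^ 4 = 1} = {1, - 1, i, - i}"
  using fourth_roots(1)[OF i, of _ 1] by (intro Set.set_eqI) simp

abbreviation transl_eigs :: "'k::prime_field set" where
  "transl_eigs \<equiv> {w. w = 1 \<or> w * w + w + 1 = 0}"

lemma CARD_Suc:
  obtains q where "CARD('k::prime_field) = Suc q" "q > 0"
  using CARD_gt_3[where 'k = 'k] by (intro that[of "CARD('k) - 1"]) simp_all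

text \<open>Burnside's count divided by \<open>q = p - 1\<close>. The first summand stems from the
  zero vector, \<open>q\<^sup>2 + 4 q + 6\<close> from the identity and \<open>diagm (- 1)\<close>,
  and each flex parameter adds a reflection with \<open>q + 3\<close> and a translation.\<close>

lemma Dp_no_i:
  assumes ni: "\<nexists>i :: 'k::prime_field. i * i = - 1" and q: "CARD('k) = Suc q" "q > 0"
  shows "Dp CARD('k) * ((1 + card (froots :: 'k set)) * 2) =
    (1 + card (froots :: 'k set)) * 2 + (q * q + 4 * q + 6) + card (froots :: 'k set) * (q + 3 + card (transl_eigs :: 'k set))"
proof -
  let ?r = "card (froots :: 'k set)" and ?w = "card (transl_eigs :: 'k set)"
  note o = orbit_count[where 'k = 'k, folded Dp_eq_orbits, unfolded card_cidx cidx_sum unit_roots_no_i[OF ni]]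
  have ne: "(1::'k) \<noteq> - 1" by (rule one_neq_m1)
  have p2: "CARD('k)\<^sup>2 - 1 = q * (q + 2)" "CARD('k) ^ 3 - 1 = q * (q * q + 3 * q + 3)" "CARD('k) - 1 = q"
    by (simp_all add: q power2_eq_square power3_eq_cube algebra_simps)
  have S1: "(\<Sum>d\<in>{1, - 1 :: 'k}. (CARD('k) - 1) + eig (celt None d)) = q * (q * q + 4 * q + 8)"
  proof -
    have "(\<Sum>d\<in>{1, - 1 :: 'k}. (CARD('k) - 1) + eig (celt None d)) =
       (CARD('k) - 1) + eig (celt None (1 :: 'k)) + ((CARD('k) - 1) + eig (celt None (- 1 :: 'k)))" using ne by simp
    also have "\<dots> = q + q * (q * q + 3 * q + 3) + (q + (q * (q + 2) + q))"
      unfolding celt.simps eig_diagm_1 eig_diagm_m1 p2 ..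
    finally show ?thesis by (simp add: algebra_simps)
  qed
  have S2: "(\<Sum>d\<in>{1, - 1 :: 'k}. (CARD('k) - 1) + eig (celt (Some b) d)) = q * (q + 5 + ?w)" if b: "b \<in> froots" for b :: 'k
  proof -
    have "(\<Sum>d\<in>{1, - 1 :: 'k}. (CARD('k) - 1) + eig (celt (Some b) d)) =
       (CARD('k) - 1) + eig (celt (Some b) 1) + ((CARD('k) - 1) + eig (celt (Some b) (- 1)))" using ne by simp
    also have "\<dots> = q + (q * (q + 2) + q) + (q + q * ?w)"
      unfolding celt.simps eig_translation[OF b] diagm_1 comp_id eig_reflm[OF b] p2 ..
    finally show ?thesis by (simp add: algebra_simps)
  qed
  have "(\<Sum>b\<in>(froots :: 'k set). \<Sum>d\<in>{1, - 1 :: 'k}. (CARD('k) - 1) + eig (celt (Some b) d)) = (\<Sum>b\<in>(froots :: 'k set). q * (q + 5 + ?w))"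
    by (intro sum.cong refl S2)
  then have "Dp CARD('k) * (q * ((1 + ?r) * card {1, - 1 :: 'k})) = q * (q * q + 4 * q + 8) + ?r * (q * (q + 5 + ?w))"
    using o[unfolded S1] unfolding p2(3) by simp
  then have "q * (Dp CARD('k) * ((1 + ?r) * 2)) = q * ((1 + ?r) * 2 + (q * q + 4 * q + 6) + ?r * (q + 3 + ?w))"
    using ne by (simp add: algebra_simps)
  then show ?thesis using q(2) by (simp only: mult_cancel1) simp
qed

text \<open>Beyond the case without \<open>i\<close>, there are two more elements for
  \<open>e3\<close> and for each flex parameter, with three eigenlines apiece.\<close>

lemma Dp_i:
  assumes i: "i * i = (- 1 :: 'k::prime_field)" and q: "CARD('k) = Suc q" "q > 0"
  shows "Dp CARD('k) * ((1 + card (froots :: 'k set)) * 4) =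
    (1 + card (froots :: 'k set)) * 4 + (q * q + 4 * q + 12) + card (froots :: 'k set) * (q + 9 + card (transl_eigs :: 'k set))"
proof -
  let ?r = "card (froots :: 'k set)" and ?w = "card (transl_eigs :: 'k set)"
  note f = i_facts[OF i]
  have i': "(- i) * (- i) = (- 1 :: 'k)" using i by simp
  have dist: "1 \<notin> {- 1, i, - i}" "- 1 \<notin> {i, - i}" "i \<notin> {- i}"
  proof -
    show "1 \<notin> {- 1, i, - i}" "- 1 \<notin> {i, - i}" using f i_facts[OF i'] by auto
    have "2 * i \<noteq> 0" using f(1) by simp
    then show "i \<notin> {- i}" by (metis add.right_inverse mult_2 singletonD)
  qed
  have four: "(\<Sum>d\<in>{1, - 1, i, - i}. F d) = F 1 + (F (- 1) + (F i + F (- i)))" for F :: "'k \<Rightarrow> nat"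
    using dist by (simp only: sum.insert finite.intros sum.empty not_False_eq_True) simp
  note o = orbit_count[where 'k = 'k, folded Dp_eq_orbits, unfolded card_cidx cidx_sum unit_roots_i[OF i] four]
  have c4: "card {1, - 1, i, - i} = 4" using fourth_roots(2)[OF i, of 1] by simp
  have p2: "CARD('k)\<^sup>2 - 1 = q * (q + 2)" "CARD('k) ^ 3 - 1 = q * (q * q + 3 * q + 3)" "CARD('k) - 1 = q"
    by (simp_all add: q power2_eq_square power3_eq_cube algebra_simps)
  have S1: "(CARD('k) - 1) + eig (celt None (1 :: 'k)) + ((CARD('k) - 1) + eig (celt None (- 1 :: 'k)) + ((CARD('k) - 1) + eig (celt None i) + ((CARD('k) - 1) + eig (celt None (- i)))))
     = q * (q * q + 4 * q + 16)"
    unfolding celt.simps eig_diagm_1 eig_diagm_m1 eig_diagm_i[OF i] eig_diagm_i[OF i'] p2 by (simp add: algebra_simps)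
  have S2: "(CARD('k) - 1) + eig (celt (Some b) 1) + ((CARD('k) - 1) + eig (celt (Some b) (- 1)) + ((CARD('k) - 1) + eig (celt (Some b) i) + ((CARD('k) - 1) + eig (celt (Some b) (- i)))))
     = q * (q + 13 + ?w)" if b: "b \<in> froots" for b :: 'k
    unfolding celt.simps diagm_1 comp_id eig_reflm[OF b] eig_translation[OF b] eig_order4[OF b i] eig_order4[OF b i'] p2
    by (simp add: algebra_simps)
  have "(\<Sum>b\<in>(froots :: 'k set). (CARD('k) - 1) + eig (celt (Some b) 1) + ((CARD('k) - 1) + eig (celt (Some b) (- 1)) + ((CARD('k) - 1) + eig (celt (Some b) i) + ((CARD('k) - 1) + eig (celt (Some b) (- i))))))
     = (\<Sum>b\<in>(froots :: 'k set). q * (q + 13 + ?w))"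
    by (intro sum.cong refl S2)
  then have "Dp CARD('k) * (q * ((1 + ?r) * 4)) = q * (q * q + 4 * q + 16) + ?r * (q * (q + 13 + ?w))"
    using o[unfolded S1] unfolding p2(3) c4 by simp
  then have "q * (Dp CARD('k) * ((1 + ?r) * 4)) = q * ((1 + ?r) * 4 + (q * q + 4 * q + 12) + ?r * (q + 9 + ?w))"
    by (simp add: algebra_simps)
  then show ?thesis using q(2) by (simp only: mult_cancel1) simp
qed

lemma minus_3_pow:
  "(- 3 :: 'k::prime_field) ^ ((CARD('k) - 1) div 2) = (if CARD('k) mod 3 = 1 then 1 else - 1)"
proof -
  let ?h = "(CARD('k) - 1) div 2"
  have "(- 3 :: 'k) ^ ?h = (- 1) ^ ?h * 3 ^ ?h" by (simp flip: power_mult_distrib)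
  also have "\<dots> = (if CARD('k) mod 3 = 1 then 1 else - 1) * ((- 1) ^ ?h * (- 1) ^ ?h)" unfolding three_pow by (simp only: mult_ac)
  also have "(- 1 :: 'k) ^ ?h * (- 1) ^ ?h = 1" by (simp flip: power_mult_distrib)
  finally show ?thesis by simp
qed

lemma transl_eig_iff: "w * w + w + 1 = 0 \<longleftrightarrow> (2 * w + 1) * (2 * w + 1) = (- 3 :: 'k::prime_field)"
proof -
  have e: "(2 * w + 1) * (2 * w + 1) = 4 * (w * w + w + 1) - 3" by Groebner_Basis.algebra
  have "w * w + w + 1 = 0 \<longleftrightarrow> 4 * (w * w + w + 1) = 0" by (simp only: mult_eq_0_iff four_neq_0 simp_thms)
  also have "\<dots> \<longleftrightarrow> 4 * (w * w + w + 1) - 3 = 0 - 3" by (metis diff_add_cancel)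
  finally show ?thesis unfolding e by simp
qed

lemma card_transl_eigs_1:
  assumes "(- 3 :: 'k::prime_field) ^ ((CARD('k) - 1) div 2) = - 1"
  shows "card (transl_eigs :: 'k set) = 1"
proof -
  have "\<nexists>x :: 'k. x * x = - 3" using nonsquare_iff_pow[of "- 3 :: 'k"] assms by simp
  then have "(transl_eigs :: 'k set) = {1}" unfolding transl_eig_iff by blast
  then show ?thesis by simp
qed

lemma card_transl_eigs_3:
  assumes "(- 3 :: 'k::prime_field) ^ ((CARD('k) - 1) div 2) = 1"
  shows "card (transl_eigs :: 'k set) = 3"
proof -
  obtain t :: 'k where t: "t * t = - 3" using square_iff_pow[of "- 3 :: 'k"] assms by auto
  have t0: "t \<noteq> 0"
  proof
    assume "t = 0"
    then have "(3::'k) = 0" using t by (metis mult_zero_left neg_equal_0_iff_equal)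
    then show False by simp
  qed
  have "w * w + w + 1 = 0 \<longleftrightarrow> w = (t - 1) / 2 \<or> w = (- t - 1) / 2" for w
  proof -
    have "w * w + w + 1 = 0 \<longleftrightarrow> 2 * w + 1 = t \<or> 2 * w + 1 = - t"
      unfolding transl_eig_iff t[symmetric] square_eq_iff ..
    also have "\<dots> \<longleftrightarrow> w = (t - 1) / 2 \<or> w = (- t - 1) / 2"
    proof -
      have "2 * w + 1 = u \<longleftrightarrow> w = (u - 1) / 2" for u
      proof
        assume "2 * w + 1 = u"
        then have "u - 1 = 2 * w" by auto
        then show "w = (u - 1) / 2" by simp
      next
        assume "w = (u - 1) / 2"
        then have "2 * w = u - 1" by (simp add: mult.commute)
        then show "2 * w + 1 = u" by (simp only: diff_add_cancel)
      qed
      then show ?thesis by (simp only:)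
    qed
    finally show ?thesis .
  qed
  then have "(transl_eigs :: 'k set) = {1, (t - 1) / 2, (- t - 1) / 2}"
    by (intro Set.set_eqI) (simp only: mem_Collect_eq insert_iff empty_iff simp_thms)
  moreover have "(t - 1) / 2 \<noteq> (- t - 1) / 2"
  proof
    assume "(t - 1) / 2 = (- t - 1) / 2"
    then have "t - 1 = - t - 1" by (simp only: divide_cancel_right two_neq_0 simp_thms)
    then have "(t - 1) - (- t - 1) = 0" by (simp only: right_minus_eq)
    moreover have "2 * t = (t - 1) - (- t - 1)" by Groebner_Basis.algebra
    ultimately have "2 * t = 0" by (rule trans[rotated])
    then show False using t0 by simp
  qed
  moreover have "(1::'k) \<noteq> (t - 1) / 2 \<and> 1 \<noteq> (- t - 1) / 2"
  proof -
    have "(1::'k) * 1 + 1 + 1 \<noteq> 0" by simp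
    then show ?thesis using \<open>\<And>w. w * w + w + 1 = 0 \<longleftrightarrow> w = (t - 1) / 2 \<or> w = (- t - 1) / 2\<close> by blast
  qed
  ultimately show ?thesis unfolding card_3_iff by blast
qed

text \<open>A predicate of the number alone, so that a possible counterexample can be chosen before
  any field is fixed.\<close>

definition descendant_formula :: "nat \<Rightarrow> bool" where
  "descendant_formula p \<longleftrightarrow>
       (p mod 12 = 5 \<longrightarrow> real (Dp p) = (real p + 1)^2 / 4 + 3)
       \<and> (p mod 12 = 7 \<longrightarrow> real (Dp p) = (real p + 1)^2 / 2 + 2)
       \<and> (p mod 12 = 11 \<longrightarrow> real (Dp p) = (real p + 1)^2 / 6 + (real p + 1) / 3 + 2)
       \<and> (p mod 12 = 1 \<and> Vp p = 0 \<longrightarrow> real (Dp p) = (real p + 1)^2 / 4 + 3)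
       \<and> (p mod 12 = 1 \<and> Vp p \<noteq> 0 \<longrightarrow> real (Dp p) = (real p - 1)^2 / 36 + (real p - 1) / 3 + 4)"

lemma descendant_formula_CARD: "descendant_formula CARD('k::prime_field)"
proof -
  obtain q where q: "CARD('k) = Suc q" "q > 0" by (rule CARD_Suc)
  let ?D = "Dp CARD('k)"
  have i_case: "\<exists>i :: 'k. i * i = - 1" if "CARD('k) mod 12 = 5 \<or> CARD('k) mod 12 = 1"
  proof -
    have "even ((CARD('k) - 1) div 2)" using that by presburger
    then show ?thesis using sqrt_minus_1_iff by blast
  qed
  have ni_case: "\<nexists>i :: 'k. i * i = - 1" if "CARD('k) mod 12 = 7 \<or> CARD('k) mod 12 = 11"
  proof -
    have "odd ((CARD('k) - 1) div 2)" using that by presburger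
    then show ?thesis using sqrt_minus_1_iff by blast
  qed
  have r: "real CARD('k) = real q + 1" by (simp add: q)
  have empty_i: "real ?D = (real CARD('k) + 1)\<^sup>2 / 4 + 3" if e: "(froots :: 'k set) = {}" and ex: "\<exists>i :: 'k. i * i = - 1"
  proof -
    obtain i :: 'k where i: "i * i = - 1" using ex by blast
    have "?D * 4 = 4 + (q * q + 4 * q + 12)" using Dp_i[OF i q] unfolding e by simp
    then have "real (?D * 4) = real (4 + (q * q + 4 * q + 12))" by (rule arg_cong)
    then show ?thesis unfolding r by (simp add: power2_eq_square field_simps)
  qed
  have c5: "real ?D = (real CARD('k) + 1)\<^sup>2 / 4 + 3" if "CARD('k) mod 12 = 5"
    by (rule empty_i[OF froots_empty i_case]) (use that in simp_all)
  have c7: "real ?D = (real CARD('k) + 1)\<^sup>2 / 2 + 2" if p: "CARD('k) mod 12 = 7"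
  proof -
    have e: "(froots :: 'k set) = {}" using froots_empty p by blast
    have "?D * 2 = 2 + (q * q + 4 * q + 6)" using Dp_no_i[OF ni_case q] p unfolding e by simp
    then have "real (?D * 2) = real (2 + (q * q + 4 * q + 6))" by (rule arg_cong)
    then show ?thesis unfolding r by (simp add: power2_eq_square field_simps)
  qed
  have c11: "real ?D = (real CARD('k) + 1)\<^sup>2 / 6 + (real CARD('k) + 1) / 3 + 2" if p: "CARD('k) mod 12 = 11"
  proof -
    have "CARD('k) mod 3 \<noteq> 1" using p by presburger
    then have w: "card (transl_eigs :: 'k set) = 1" using card_transl_eigs_1 minus_3_pow[where 'k = 'k] by simp
    \<comment> \<open>Three rational flexes and two automorphisms fixing the origin: modulo scalars
      a group of order 6.\<close>
    have "?D * ((1 + 2) * 2) = (1 + 2) * 2 + (q * q + 4 * q + 6) + 2 * (q + 3 + 1)"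
      using Dp_no_i[OF ni_case q] p unfolding card_froots_11[OF p] w by simp
    then have "real (?D * ((1 + 2) * 2)) = real ((1 + 2) * 2 + (q * q + 4 * q + 6) + 2 * (q + 3 + 1))" by (rule arg_cong)
    then show ?thesis unfolding r by (simp add: power2_eq_square field_simps)
  qed
  have c1: "real ?D = (real CARD('k) + 1)\<^sup>2 / 4 + 3" if p: "CARD('k) mod 12 = 1" "Vp CARD('k) = 0"
  proof (rule empty_i)
    obtain i :: 'k where i: "i * i = - 1" using i_case p(1) by blast
    show "(froots :: 'k set) = {}" using Vp_iff_froots[OF i] p(2) by simp
    show "\<exists>i :: 'k. i * i = - 1" using i by blast
  qed
  have c1': "real ?D = (real CARD('k) - 1)\<^sup>2 / 36 + (real CARD('k) - 1) / 3 + 4" if p: "CARD('k) mod 12 = 1" "Vp CARD('k) \<noteq> 0"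
  proof -
    obtain i :: 'k where i: "i * i = - 1" using i_case p(1) by blast
    obtain b :: 'k where b: "b \<in> froots" using Vp_iff_froots[OF i] p(2) by blast
    have "CARD('k) mod 3 = 1" using p(1) by presburger
    then have w: "card (transl_eigs :: 'k set) = 3" using card_transl_eigs_3 minus_3_pow[where 'k = 'k] by simp
    \<comment> \<open>Nine rational flexes and four automorphisms fixing the origin: modulo scalars
      a group of order 36.\<close>
    have "?D * ((1 + 8) * 4) = (1 + 8) * 4 + (q * q + 4 * q + 12) + 8 * (q + 9 + 3)"
      using Dp_i[OF i q] unfolding card_froots_8[OF b i] w .
    then have "real (?D * ((1 + 8) * 4)) = real ((1 + 8) * 4 + (q * q + 4 * q + 12) + 8 * (q + 9 + 3))" by (rule arg_cong)
    then show ?thesis unfolding r by (simp add: power2_eq_square field_simps)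
  qed
  show ?thesis unfolding descendant_formula_def using c5 c7 c11 c1 c1' by blast
qed

section \<open>From fields to arbitrary primes\<close>

class prime_card_gt_3 = prime_card + assumes CARD_gt_3': "CARD('a) > 3"

instance mod_ring :: (prime_card_gt_3) prime_field
proof
  fix x :: "'a mod_ring"
  show "\<exists>n. x = of_nat n" using surj_of_nat_mod_ring[of x] by blast
next
  have "\<not> CARD('a) dvd 2" using CARD_gt_3'[where 'a = 'a] by (auto dest: dvd_imp_le)
  then show "(2 :: 'a mod_ring) \<noteq> 0" using of_nat_0_mod_ring_dvd[of 2, where 'a = 'a] by auto
  have "\<not> CARD('a) dvd 3" using CARD_gt_3'[where 'a = 'a] by (auto dest: dvd_imp_le)
  then show "(3 :: 'a mod_ring) \<noteq> 0" using of_nat_0_mod_ring_dvd[of 3, where 'a = 'a] by auto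
qed

text \<open>A type cannot depend on the prime. So we fix a prime that is a counterexample to the formula if
  there is one, and refute that it is one in the field with that many elements.\<close>

definition generic_prime :: nat where
  "generic_prime = (SOME p. Factorial_Ring.prime p \<and> p > 3 \<and>
     ((\<exists>q. Factorial_Ring.prime q \<and> q > 3 \<and> \<not> descendant_formula q) \<longrightarrow> \<not> descendant_formula p))"

lemma generic_prime: "Factorial_Ring.prime generic_prime" "generic_prime > 3"
  "Factorial_Ring.prime q \<Longrightarrow> q > 3 \<Longrightarrow> \<not> descendant_formula q \<Longrightarrow> \<not> descendant_formula generic_prime"
proof -
  \<comment> \<open>Without a counterexample any admissible prime satisfies the condition of the
    choice.\<close>
  have "Factorial_Ring.prime (5::nat)" by simp
  then have "\<exists>p. Factorial_Ring.prime p \<and> p > 3 \<and>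
     ((\<exists>q. Factorial_Ring.prime q \<and> q > 3 \<and> \<not> descendant_formula q) \<longrightarrow> \<not> descendant_formula p)"
    by (cases "\<exists>q. Factorial_Ring.prime q \<and> q > 3 \<and> \<not> descendant_formula q") (blast, intro exI[of _ 5], auto)
  note * = someI_ex[OF this, folded generic_prime_def]
  show "Factorial_Ring.prime generic_prime" "generic_prime > 3" using * by blast+
  show "\<not> descendant_formula generic_prime" if "Factorial_Ring.prime q" "q > 3" "\<not> descendant_formula q"
    using * that by blast
qed

typedef generic_index = "{..<generic_prime}"
  using generic_prime(2) by (intro exI[of _ 0]) simp

lemma CARD_generic_index: "CARD(generic_index) = generic_prime"
  using type_definition.card[OF type_definition_generic_index] by simp

instance generic_index :: prime_card_gt_3
  by standard (simp_all add: CARD_generic_index generic_prime)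

theorem theorem1:
  fixes p :: nat
  assumes "Factorial_Ring.prime p" and "p > 3"
  shows "(p mod 12 = 5 \<longrightarrow> real (Dp p) = (real p + 1)^2 / 4 + 3)
       \<and> (p mod 12 = 7 \<longrightarrow> real (Dp p) = (real p + 1)^2 / 2 + 2)
       \<and> (p mod 12 = 11 \<longrightarrow> real (Dp p) = (real p + 1)^2 / 6 + (real p + 1) / 3 + 2)
       \<and> (p mod 12 = 1 \<and> Vp p = 0 \<longrightarrow> real (Dp p) = (real p + 1)^2 / 4 + 3)
       \<and> (p mod 12 = 1 \<and> Vp p \<noteq> 0 \<longrightarrow> real (Dp p) = (real p - 1)^2 / 36 + (real p - 1) / 3 + 4)"
proof -
  have "descendant_formula generic_prime"
    using descendant_formula_CARD[where 'k = "generic_index mod_ring"] by (simp add: CARD_generic_index)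
  then have "descendant_formula p" using generic_prime(3)[OF assms] by blast
  then show ?thesis unfolding descendant_formula_def .
qed

end
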